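(* Let $d\ge1$, let $\lambda_0\in\mathbb{C}$ with $a=|\operatorname{Im}(\lambda_0)|\neq 0$, let $z_0\in N(\lambda_0)$, where $N(\lambda_0)$ is the outward normal to the parabola $\partial\Lambda(\Omega_a)$ at $\lambda_0^2$, and let $A\in\mathbb{C}$ be non-zero. For a doubly infinite sequence $\{T_k\}_{k\in\mathbb{Z}}$ of exponential tempered distributions of type $a$ on $\mathbb{R}^d$ consider the conditions (1) $(\Delta-z_0 I)T_k=A T_{k+1}$ for all $k\in\mathbb{Z}$; (2) there exist a seminorm $\gamma$ on $S^a(\mathbb{R}^d)$ and a constant $M>0$ such that $|\langle T_k,f\rangle|\le M\gamma(f)$ for all $f\in S^a(\mathbb{R}^d)$ and all $k\in\mathbb{Z}$. Then the following hold. (a) If $|A|=|\lambda_0^2-z_0|$, then every sequence $\{T_k\}_{k\in\mathbb{Z}}$ satisfying (1) and (2) satisfies $\Delta T_0=\lambda_0^2 T_0$. (b) If $|A|<|\lambda_0^2-z_0|$, then every sequence $\{T_k\}_{k\in\mathbb{Z}}$ satisfying (1) and (2) satisfies $T_k=0$ for all $k\in\mathbb{Z}$. (c) If $|A|>|\lambda_0^2-z_0|$, then there exists a sequence $\{T_k\}_{k\in\mathbb{Z}}$ satisfying (1) and (2) such that $T_0$ is not an eigendistribution of $\Delta$ (i.e. there is no $\mu\in\mathbb{C}$ with $\Delta T_0=\mu T_0$).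
   Context: $\Delta=-\sum_{j=1}^d \frac{\partial^2}{\partial x_j^2}$ is the (positive) Laplacian on $\mathbb{R}^d$ and $I$ is the identity operator. For $a\ge 0$, $S^a(\mathbb{R}^d)$ is the space of all $C^\infty$ functions $f:\mathbb{R}^d\to\mathbb{C}$ such that $$\gamma_{m,\alpha}(f)=\sup_{x\in\mathbb{R}^d} e^{a|x|}(1+|x|)^m|D^\alpha f(x)|<\infty$$ for every non-negative integer $m$ and every multi-index $\alpha=(\alpha_1,\dots,\alpha_d)$, where $D^\alpha f=\frac{\partial^{|\alpha|}f}{\partial x_1^{\alpha_1}\cdots\partial x_d^{\alpha_d}}$. It is a Fréchet space with the topology induced by the seminorms $\gamma_{m,\alpha}$; "seminorm on $S^a(\mathbb{R}^d)$" refers to this topology. Its (continuous) dual $S^a(\mathbb{R}^d)'$ is called the space of exponential tempered distributions of type $a$ on $\mathbb{R}^d$, and $\langle\cdot,\cdot\rangle$ is the dual bracket. For $T\in S^a(\mathbb{R}^d)'$, $\Delta T$ is defined by $\langle\Delta T,\psi\rangle=\langle T,\Delta\psi\rangle$ for $\psi\in S^a(\mathbb{R}^d)$. For $a>0$, $\Omega_a$ here denotes the strip $\{\lambda\in\mathbb{C}: |\operatorname{Im}(\lambda)|\le a\}$ and $\Lambda$ is the map $\lambda\mapsto\lambda^2$. One has $\Lambda(\Omega_a)=\{s+it: s,t\in\mathbb{R},\ t^2\le 4a^2(s+a^2)\}$, a closed convex region whose boundary is the parabola $\partial\Lambda(\Omega_a)=\{s+it: t^2=4a^2(s+a^2)\}$.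 If $a=|\operatorname{Im}(\lambda_0)|$ then $\lambda_0^2\in\partial\Lambda(\Omega_a)$. The outward normal $N(\lambda_0)$ is the set of points on the ray starting at $\lambda_0^2$, perpendicular to the tangent line of the parabola at $\lambda_0^2$ and pointing away from $\Lambda(\Omega_a)$; explicitly $N(\lambda_0)=\{\lambda_0^2+ i r\operatorname{Im}(\lambda_0)\lambda_0 : r\ge 0\}$. *)

theory Defs
  imports "HOL-Analysis.Analysis"
begin

definition partial_deriv :: "'d::finite \<Rightarrow> (real^'d \<Rightarrow> complex) \<Rightarrow> real^'d \<Rightarrow> complex" where
  "partial_deriv i f x = vector_derivative (\<lambda>t. f (x + t *\<^sub>R axis i 1)) (at 0)"

definition iter_partial :: "'d::finite list \<Rightarrow> (real^'d \<Rightarrow> complex) \<Rightarrow> real^'d \<Rightarrow> complex" where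
  "iter_partial js f = foldr partial_deriv js f"

definition C_infty :: "(real^'d::finite \<Rightarrow> complex) \<Rightarrow> bool" where
  "C_infty f \<longleftrightarrow>
     (\<forall>js. continuous_on UNIV (iter_partial js f) \<and>
           (\<forall>i x. (\<lambda>t::real. iter_partial js f (x + t *\<^sub>R axis i 1)) differentiable (at 0)))"

text \<open>A multi-index is a function \<^term>\<open>\<alpha> :: 'd \<Rightarrow> nat\<close>. The coordinate type \<^typ>\<open>'d\<close> carries no
  order, so the partial derivatives are taken along an arbitrary but fixed enumeration of the
  coordinates; on smooth functions the choice is irrelevant.\<close>

definition coord_list :: "'d::finite list" where
  "coord_list = (SOME js. distinct js \<and> set js = UNIV)"

definition multi_deriv :: "('d::finite \<Rightarrow> nat) \<Rightarrow> (real^'d \<Rightarrow> complex) \<Rightarrow> real^'d \<Rightarrow> complex" where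
  "multi_deriv \<alpha> f = foldr (\<lambda>i. partial_deriv i ^^ \<alpha> i) coord_list f"

definition laplacian :: "(real^'d::finite \<Rightarrow> complex) \<Rightarrow> real^'d \<Rightarrow> complex" where
  "laplacian f x = - (\<Sum>j\<in>UNIV. partial_deriv j (partial_deriv j f) x)"

definition weighted_deriv ::
  "real \<Rightarrow> nat \<Rightarrow> ('d::finite \<Rightarrow> nat) \<Rightarrow> (real^'d \<Rightarrow> complex) \<Rightarrow> real^'d \<Rightarrow> real" where
  "weighted_deriv a m \<alpha> f x = exp (a * norm x) * (1 + norm x) ^ m * cmod (multi_deriv \<alpha> f x)"

definition exp_schwartz :: "real \<Rightarrow> (real^'d::finite \<Rightarrow> complex) set" where
  "exp_schwartz a = {f. C_infty f \<and> (\<forall>m \<alpha>. bdd_above (range (weighted_deriv a m \<alpha> f)))}"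

definition exp_seminorm ::
  "real \<Rightarrow> nat \<Rightarrow> ('d::finite \<Rightarrow> nat) \<Rightarrow> (real^'d \<Rightarrow> complex) \<Rightarrow> real" where
  "exp_seminorm a m \<alpha> f = (SUP x. weighted_deriv a m \<alpha> f x)"

text \<open>The topology induced by the seminorms: their open balls form a subbasis.\<close>

definition exp_schwartz_topology :: "real \<Rightarrow> (real^'d::finite \<Rightarrow> complex) topology" where
  "exp_schwartz_topology a = topology_generated_by
     {{g \<in> exp_schwartz a. exp_seminorm a m \<alpha> (\<lambda>x. g x - f x) < \<epsilon>} | f m \<alpha> \<epsilon>.
        f \<in> exp_schwartz a \<and> \<epsilon> > 0}"

definition continuous_seminorm :: "real \<Rightarrow> ((real^'d::finite \<Rightarrow> complex) \<Rightarrow> real) \<Rightarrow> bool" where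
  "continuous_seminorm a \<gamma> \<longleftrightarrow>
     (\<forall>f\<in>exp_schwartz a. \<forall>g\<in>exp_schwartz a. \<gamma> (\<lambda>x. f x + g x) \<le> \<gamma> f + \<gamma> g) \<and>
     (\<forall>c. \<forall>f\<in>exp_schwartz a. \<gamma> (\<lambda>x. c * f x) = cmod c * \<gamma> f) \<and>
     continuous_map (exp_schwartz_topology a) euclideanreal \<gamma>"

text \<open>The distributions of type \<^term>\<open>a\<close> are represented by functions on the whole type, of which
  only the values on \<^term>\<open>exp_schwartz a\<close> are meaningful. Hence two of them are equal as
  distributions iff they agree on \<^term>\<open>exp_schwartz a\<close>.\<close>

type_synonym 'd functional = "(real^'d \<Rightarrow> complex) \<Rightarrow> complex"

definition exp_tempered_distr :: "real \<Rightarrow> ('d::finite) functional set" where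
  "exp_tempered_distr a = {T.
     (\<forall>f\<in>exp_schwartz a. \<forall>g\<in>exp_schwartz a. T (\<lambda>x. f x + g x) = T f + T g) \<and>
     (\<forall>c. \<forall>f\<in>exp_schwartz a. T (\<lambda>x. c * f x) = c * T f) \<and>
     continuous_map (exp_schwartz_topology a) euclidean T}"

definition distr_eq :: "real \<Rightarrow> ('d::finite) functional \<Rightarrow> 'd functional \<Rightarrow> bool" where
  "distr_eq a T U \<longleftrightarrow> (\<forall>\<psi>\<in>exp_schwartz a. T \<psi> = U \<psi>)"

definition laplacian_distr :: "('d::finite) functional \<Rightarrow> 'd functional" where
  "laplacian_distr T = (\<lambda>\<psi>. T (laplacian \<psi>))"

definition laplacian_recurrence ::
  "real \<Rightarrow> complex \<Rightarrow> complex \<Rightarrow> (int \<Rightarrow> ('d::finite) functional) \<Rightarrow> bool" where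
  "laplacian_recurrence a z\<^sub>0 A T \<longleftrightarrow>
     (\<forall>k. distr_eq a (\<lambda>\<psi>. laplacian_distr (T k) \<psi> - z\<^sub>0 * T k \<psi>) (\<lambda>\<psi>. A * T (k + 1) \<psi>))"

definition uniformly_bounded_distr :: "real \<Rightarrow> (int \<Rightarrow> ('d::finite) functional) \<Rightarrow> bool" where
  "uniformly_bounded_distr a T \<longleftrightarrow>
     (\<exists>\<gamma> M. continuous_seminorm a \<gamma> \<and> M > 0 \<and>
        (\<forall>f\<in>exp_schwartz a. \<forall>k. cmod (T k f) \<le> M * \<gamma> f))"

definition strip :: "real \<Rightarrow> complex set" where
  "strip a = {l. \<bar>Im l\<bar> \<le> a}"

definition outward_normal :: "complex \<Rightarrow> complex set" where
  "outward_normal l\<^sub>0 = {l\<^sub>0\<^sup>2 + \<i> * of_real r * of_real (Im l\<^sub>0) * l\<^sub>0 | r. r \<ge> 0}"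

text \<open>Geometric description: \<^term>\<open>2 * l\<^sub>0\<close> is the velocity at \<^term>\<open>l\<^sub>0\<^sup>2\<close> of the boundary curve
  \<open>s \<mapsto> (s + \<i> Im l\<^sub>0)\<^sup>2\<close> of the convex region \<open>(\<lambda>l. l\<^sup>2) ` strip \<bar>Im l\<^sub>0\<bar>\<close>.\<close>

lemma outward_normal_geometric:
  assumes "Im l\<^sub>0 \<noteq> 0"
  shows "outward_normal l\<^sub>0 =
    {z. (z - l\<^sub>0\<^sup>2) \<bullet> (2 * l\<^sub>0) = 0 \<and>
        (\<forall>w \<in> (\<lambda>l. l\<^sup>2) ` strip \<bar>Im l\<^sub>0\<bar>. (z - l\<^sub>0\<^sup>2) \<bullet> (w - l\<^sub>0\<^sup>2) \<le> 0)}" (is "_ = ?R")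
proof (rule set_eqI, rule iffI)
  fix z assume "z \<in> outward_normal l\<^sub>0"
  then obtain r where r: "r \<ge> 0" and z: "z = l\<^sub>0\<^sup>2 + \<i> * of_real r * of_real (Im l\<^sub>0) * l\<^sub>0"
    by (auto simp: outward_normal_def)
  obtain x y where l0: "l\<^sub>0 = Complex x y" by (cases l\<^sub>0)
  have "(z - l\<^sub>0\<^sup>2) \<bullet> (2 * l\<^sub>0) = 0"
    by (simp add: z l0 inner_complex_def algebra_simps)
  moreover have "(z - l\<^sub>0\<^sup>2) \<bullet> (l\<^sup>2 - l\<^sub>0\<^sup>2) \<le> 0" if "l \<in> strip \<bar>Im l\<^sub>0\<bar>" for l
  proof -
    obtain s t where l: "l = Complex s t" by (cases l)
    have "t\<^sup>2 \<le> y\<^sup>2"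
      using that by (simp add: l l0 strip_def abs_le_square_iff)
    moreover have "(z - l\<^sub>0\<^sup>2) \<bullet> (l\<^sup>2 - l\<^sub>0\<^sup>2) =
        - (r * ((y * s - x * t)\<^sup>2 + (x\<^sup>2 + y\<^sup>2) * (y\<^sup>2 - t\<^sup>2)))"
      by (simp add: z l l0 inner_complex_def power2_eq_square algebra_simps)
    ultimately show ?thesis
      using r by simp
  qed
  ultimately show "z \<in> ?R" by auto
next
  fix z assume z: "z \<in> ?R"
  obtain x y where l0: "l\<^sub>0 = Complex x y" by (cases l\<^sub>0)
  have y: "y \<noteq> 0" using assms by (simp add: l0)
  obtain p q where v: "z - l\<^sub>0\<^sup>2 = Complex p q" by (cases "z - l\<^sub>0\<^sup>2")
  have "(z - l\<^sub>0\<^sup>2) \<bullet> (2 * l\<^sub>0) = 0" using z by blast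
  then have perp: "p * x + q * y = 0"
    unfolding v by (simp add: l0 inner_complex_def)
  define r where "r = - p / y\<^sup>2"
  have p: "p = - r * y\<^sup>2" using y by (simp add: r_def)
  have q: "q = r * y * x"
    using perp y unfolding p by (simp add: power2_eq_square)
  have "0 \<in> (\<lambda>l. l\<^sup>2) ` strip \<bar>Im l\<^sub>0\<bar>"
    by (rule image_eqI[of _ _ 0]) (auto simp: strip_def)
  then have "(z - l\<^sub>0\<^sup>2) \<bullet> (0 - l\<^sub>0\<^sup>2) \<le> 0" using z by blast
  then have "r * (y\<^sup>2 * (x\<^sup>2 + y\<^sup>2)) \<ge> 0"
    unfolding v by (simp add: l0 p q inner_complex_def power2_eq_square algebra_simps)
  moreover have "y\<^sup>2 * (x\<^sup>2 + y\<^sup>2) > 0" using y by (simp add: add_nonneg_pos)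
  ultimately have "r \<ge> 0" by (simp add: zero_le_mult_iff)
  moreover have "z - l\<^sub>0\<^sup>2 = \<i> * of_real r * of_real (Im l\<^sub>0) * l\<^sub>0"
    unfolding v by (simp add: l0 p q complex_eq_iff power2_eq_square)
  then have "z = l\<^sub>0\<^sup>2 + \<i> * of_real r * of_real (Im l\<^sub>0) * l\<^sub>0" by (simp add: algebra_simps)
  ultimately show "z \<in> outward_normal l\<^sub>0" unfolding outward_normal_def by blast
qed

end

theory Submission
  imports Defs "HOL-Complex_Analysis.Cauchy_Integral_Formula"
begin

text \<open>Write \<open>l\<^sub>0 = x + \<i> y\<close> and \<open>\<zeta> = 1 + \<i> x / y\<close>. The half-plane that contains the region
\<open>{l\<^sup>2 | \<bar>Im l\<bar> \<le> a}\<close> and touches it at \<open>l\<^sub>0\<^sup>2\<close> is \<open>{w. Re (\<zeta> w) \<ge> Re (\<zeta> l\<^sub>0\<^sup>2)}\<close>, and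
\<open>Re (\<zeta> l\<^sub>0\<^sup>2) = - \<bar>l\<^sub>0\<bar>\<^sup>2\<close>. So the semigroup \<open>exp (- t \<zeta> \<Delta>)\<close> should grow no faster than
\<open>exp (t \<bar>l\<^sub>0\<bar>\<^sup>2)\<close> on functions of type \<open>a\<close>, up to powers of \<open>t\<close>. Indeed, the semigroup is
convolution with a multiple of the Gaussian \<open>exp (- \<bar>y\<bar>\<^sup>2 / (4 \<zeta> t))\<close>, and completing the square
in \<open>a \<bar>y\<bar> - Re (1 / (4 \<zeta> t)) \<bar>y\<bar>\<^sup>2\<close> bounds its weighted mass
(\<open>gaussian_weight_bound\<close>, \<open>heat_weighted_bound\<close>).

For a bounded solution \<open>T\<close> of the recurrence put \<open>g\<^sub>k t = T k (exp (- t \<zeta> (\<Delta> - z\<^sub>0)) f)\<close>. As \<open>z\<^sub>0\<close>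
lies on the outward normal, \<open>\<zeta> (l\<^sub>0\<^sup>2 - z\<^sub>0)\<close> is a real number \<open>\<rho> \<ge> 0\<close>, and all \<open>g\<^sub>k t\<close> are
bounded by a polynomial times \<open>exp (- \<rho> t)\<close>, uniformly in \<open>k\<close>. The recurrence becomes
\<open>g\<^sub>k' = - B g\<^sub>k\<^sub>+\<^sub>1\<close> with \<open>B = \<zeta> A\<close>, so \<open>g\<^sub>0\<close> extends to an entire function whose Taylor series
at any \<open>t \<ge> 0\<close> has coefficients of size \<open>\<bar>B\<bar>\<^sup>n / n!\<close> times that bound (\<open>evolution_taylor_bound\<close>).
The condition on \<open>A\<close> compares \<open>\<bar>B\<bar>\<close> with \<open>\<rho>\<close>.

If \<open>\<bar>B\<bar> < \<rho>\<close>, going back from \<open>t\<close> to \<open>0\<close> costs less than the decay gains, and \<open>g\<^sub>0 0 = T 0 f\<close>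
vanishes. If \<open>\<bar>B\<bar> = \<rho>\<close>, the same comparison with \<open>t\<close> large shows that \<open>exp (\<rho> w) g\<^sub>0 w\<close> has
polynomial growth in the whole plane and is bounded on the negative axis; by Liouville's theorem it
is constant. Its derivative at \<open>0\<close> is \<open>\<rho> T 0 f - B T 1 f\<close>, and \<open>B T 1 f = \<rho> T 0 f\<close> says that
\<open>T 0\<close> is an eigendistribution with eigenvalue \<open>l\<^sub>0\<^sup>2\<close> (\<open>evolution_decay\<close>,
\<open>recurrence_dichotomy\<close>).

If \<open>\<bar>A\<bar> > \<bar>l\<^sub>0\<^sup>2 - z\<^sub>0\<bar>\<close>, the circle of radius \<open>\<bar>A\<bar>\<close> around \<open>z\<^sub>0\<close> meets the parabola in two
different points \<open>l\<^sub>1\<^sup>2\<close> and \<open>l\<^sub>2\<^sup>2\<close>. The plane waves with these eigenvalues of \<open>\<Delta>\<close> are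
distributions of type \<open>a\<close>, and multiplying them by the powers of the unimodular numbers
\<open>(l\<^sub>j\<^sup>2 - z\<^sub>0) / A\<close> gives a bounded solution that mixes two eigenvalues
(\<open>recurrence_nonuniqueness\<close>).\<close>

section \<open>Integrals dominated by an inverse power of the norm\<close>

abbreviation inv_power :: "real \<Rightarrow> real^'d::finite \<Rightarrow> real" where
  "inv_power C x \<equiv> C / (1 + norm x) ^ (CARD('d) + 2)"

text \<open>The function is dominated by the sum over \<open>n\<close> of \<open>(n + 1) ^ - (d + 2)\<close> times the indicator of the
ball of radius \<open>n + 1\<close>, whose volume is a constant times \<open>(n + 1) ^ d\<close>. Every domination argument
below uses this one integrable function.\<close>

lemma integrable_inverse_power_norm:
  "integrable lborel (\<lambda>x::real^'d::finite. inv_power 1 x)"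
proof (rule integrableI_bounded)
  let ?V = "unit_ball_vol (real CARD('d))"
  let ?c = "\<lambda>n::nat. 1 / (real n + 1) ^ (CARD('d) + 2)"
  let ?B = "\<lambda>n::nat. ball (0::real^'d) (real n + 1)"
  show "(\<lambda>x::real^'d. inv_power 1 x) \<in> borel_measurable lborel"
    by simp
  have term_le_suminf: "f n \<le> suminf f" for f :: "nat \<Rightarrow> ennreal" and n
    using sum_le_suminf[of f "{n}"] by simp
  have pt: "ennreal (norm (inv_power 1 x))
      \<le> (\<Sum>n. ennreal (?c n) * indicator (?B n) x)" for x :: "real^'d"
  proof -
    define n where "n = nat \<lfloor>norm x\<rfloor>"
    have n: "real n \<le> norm x" "norm x < real n + 1"
      unfolding n_def by (simp_all add: of_nat_nat)
    have "inv_power 1 x \<le> ?c n"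
      using n by (intro divide_left_mono power_mono mult_pos_pos zero_less_power) auto
    then have "ennreal (norm (inv_power 1 x)) \<le> ennreal (?c n) * indicator (?B n) x"
      using n by (simp add: ennreal_leI)
    also have "\<dots> \<le> (\<Sum>n. ennreal (?c n) * indicator (?B n) x)"
      by (rule term_le_suminf)
    finally show ?thesis .
  qed
  have cancel: "1 / x ^ (CARD('d) + 2) * (V * x ^ CARD('d)) = V / x\<^sup>2" if "x \<noteq> 0" for x V :: real
    using that by (simp add: power_add power2_eq_square)
  have eq: "ennreal (?c n) * emeasure lborel (?B n) = ennreal (?V / (real n + 1)\<^sup>2)" for n
  proof -
    have "ennreal (?c n) * emeasure lborel (?B n) = ennreal (?c n) * ennreal (?V * (real n + 1) ^ CARD('d))"
      by (subst emeasure_ball) auto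
    also have "\<dots> = ennreal (?c n * (?V * (real n + 1) ^ CARD('d)))"
      by (rule ennreal_mult[symmetric]) auto
    also have "?c n * (?V * (real n + 1) ^ CARD('d)) = ?V / (real n + 1)\<^sup>2"
      by (rule cancel) auto
    finally show ?thesis .
  qed
  have "summable (\<lambda>n. 1 / real (Suc n) ^ 2)"
    using inverse_power_summable[of 2, where 'a=real] 
    by (subst summable_Suc_iff) (simp add: inverse_eq_divide power_one_over)
  from summable_mult[OF this, of ?V]
  have sm: "summable (\<lambda>n. ?V / (real n + 1)\<^sup>2)"
    by (simp add: add.commute)
  have "(\<integral>\<^sup>+x. ennreal (norm (inv_power 1 x)) \<partial>(lborel :: (real^'d) measure))
      \<le> (\<integral>\<^sup>+x. (\<Sum>n. ennreal (?c n) * indicator (?B n) x) \<partial>lborel)"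
    by (intro nn_integral_mono pt)
  also have "\<dots> = (\<Sum>n. \<integral>\<^sup>+x. ennreal (?c n) * indicator (?B n) x \<partial>lborel)"
    by (intro nn_integral_suminf borel_measurable_times_ennreal borel_measurable_indicator) auto
  also have "\<dots> = (\<Sum>n. ennreal (?V / (real n + 1)\<^sup>2))"
    by (subst nn_integral_cmult_indicator) (simp, simp only: eq)
  also have "\<dots> = ennreal (\<Sum>n. ?V / (real n + 1)\<^sup>2)"
    by (rule suminf_ennreal2) (use sm in auto)
  also have "\<dots> < \<infinity>" by simp
  finally show "(\<integral>\<^sup>+x. ennreal (norm (inv_power 1 x)) \<partial>(lborel :: (real^'d) measure)) < \<infinity>" .
qed

lemma integrable_dominated:
  fixes f :: "real^'d::finite \<Rightarrow> complex"
  assumes "continuous_on UNIV f" "\<And>x. norm (f x) \<le> inv_power C x"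
  shows "integrable lborel f"
proof (rule Bochner_Integration.integrable_bound)
  show "integrable lborel (\<lambda>x::real^'d. C * inv_power 1 x)"
    by (intro integrable_mult_right integrable_inverse_power_norm)
  show "f \<in> borel_measurable lborel"
    using borel_measurable_continuous_onI[OF assms(1)] by simp
  show "AE x in lborel. norm (f x) \<le> norm (C * inv_power 1 x)"
    using order_trans[OF assms(2) abs_ge_self] by (intro AE_I2) simp
qed

text \<open>By dominated convergence of the difference quotients. Applied to the translates of a function this
also gives integration by parts (\<open>integral_axis_derivative_eq_0\<close>), without iterated integrals.\<close>

lemma has_vector_derivative_integral:
  fixes F F' :: "real \<Rightarrow> real^'d::finite \<Rightarrow> complex"
  assumes "\<delta> > 0"
    and der: "\<And>s y. \<bar>s - s0\<bar> < \<delta> \<Longrightarrow> ((\<lambda>s. F s y) has_vector_derivative F' s y) (at s)"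
    and cont: "\<And>s. continuous_on UNIV (F s)" and cont': "continuous_on UNIV (F' s0)"
    and int: "integrable lborel (F s0)"
    and bnd: "\<And>s y. \<bar>s - s0\<bar> < \<delta> \<Longrightarrow> norm (F' s y) \<le> inv_power C y"
  shows "((\<lambda>s. \<integral>y. F s y \<partial>lborel) has_vector_derivative (\<integral>y. F' s0 y \<partial>lborel)) (at s0)"
proof -
  let ?w = "\<lambda>y::real^'d. inv_power C y"
  let ?Q = "\<lambda>s y. (1 / norm (s - s0)) *\<^sub>R (F s y - (F s0 y + (s - s0) *\<^sub>R F' s0 y))"
  have w: "integrable lborel ?w"
    using integrable_mult_right[OF integrable_inverse_power_norm[where 'd='d], of C] by simp
  have quotient: "norm ((1 / norm d) *\<^sub>R D) \<le> W + W"
    if "norm D \<le> W * \<bar>d\<bar> + W * \<bar>d\<bar>" "d \<noteq> 0" for d W :: real and D :: complex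
    using that by (simp add: field_simps)
  have lip: "norm (F s y - F s0 y) \<le> ?w y * norm (s - s0)" if "\<bar>s - s0\<bar> < \<delta>" for s y
  proof (rule differentiable_bound[of "ball s0 \<delta>" _ "\<lambda>s h. h *\<^sub>R F' s y"])
    show "((\<lambda>s. F s y) has_derivative (\<lambda>h. h *\<^sub>R F' x y)) (at x within ball s0 \<delta>)" if "x \<in> ball s0 \<delta>" for x
      using der[of x y] that unfolding has_vector_derivative_def
      by (auto simp: dist_real_def abs_minus_commute intro: has_derivative_at_withinI)
    show "onorm (\<lambda>h. h *\<^sub>R F' x y) \<le> ?w y" if "x \<in> ball s0 \<delta>" for x
      using bnd[of x y] that by (auto simp: onorm_scaleR_left dist_real_def abs_minus_commute onorm_id)
  qed (use that \<open>\<delta> > 0\<close> in \<open>auto simp: dist_real_def abs_minus_commute\<close>)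
  have int': "integrable lborel (F' s0)"
    by (rule integrable_dominated[OF cont' bnd]) (use \<open>\<delta> > 0\<close> in simp)
  have intF: "integrable lborel (F s)" if s: "\<bar>s - s0\<bar> < \<delta>" for s
  proof -
    have "integrable lborel (\<lambda>y. F s y - F s0 y)"
    proof (rule Bochner_Integration.integrable_bound)
      show "integrable lborel (\<lambda>y. ?w y * norm (s - s0))" by (intro integrable_mult_left w)
      show "AE y in lborel. norm (F s y - F s0 y) \<le> norm (?w y * norm (s - s0))"
        using lip[OF s] by (intro AE_I2) (metis abs_ge_self order_trans real_norm_def)
      show "(\<lambda>y. F s y - F s0 y) \<in> borel_measurable lborel"
        using borel_measurable_continuous_onI[OF continuous_on_diff[OF cont[of s] cont[of s0]]] by simp
    qed
    from Bochner_Integration.integrable_add[OF this int] show ?thesis by simp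
  qed
  have "((\<lambda>s. \<integral>y. ?Q s y \<partial>lborel) \<longlongrightarrow> 0) (at s0 within ball s0 \<delta>)"
    unfolding tendsto_at_iff_sequentially
  proof (intro allI impI)
    fix X :: "nat \<Rightarrow> real" assume X: "\<forall>i. X i \<in> ball s0 \<delta> - {s0}" "X \<longlonglongrightarrow> s0"
    then have X': "\<bar>X i - s0\<bar> < \<delta>" "X i \<noteq> s0" for i
      by (auto simp: dist_real_def abs_minus_commute)
    have "(\<lambda>i. \<integral>y. ?Q (X i) y \<partial>lborel) \<longlonglongrightarrow> (\<integral>y. (0::complex) \<partial>(lborel :: (real^'d) measure))"
    proof (rule integral_dominated_convergence)
      show "(\<lambda>y. ?Q (X i) y) \<in> borel_measurable lborel" for i
        using borel_measurable_continuous_onI[OF cont[of "X i"]]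
          borel_measurable_continuous_onI[OF cont[of s0]] borel_measurable_continuous_onI[OF cont']
        by simp
      show "integrable lborel (\<lambda>y. ?w y + ?w y)" by (intro Bochner_Integration.integrable_add w)
      show "AE y in lborel. norm (?Q (X i) y) \<le> ?w y + ?w y" for i
      proof (rule AE_I2)
        fix y
        have "norm (F (X i) y - (F s0 y + (X i - s0) *\<^sub>R F' s0 y))
            \<le> norm (F (X i) y - F s0 y) + norm ((X i - s0) *\<^sub>R F' s0 y)"
          using norm_triangle_ineq4[of "F (X i) y - F s0 y" "(X i - s0) *\<^sub>R F' s0 y"]
          by (simp add: algebra_simps)
        also have "\<dots> \<le> ?w y * \<bar>X i - s0\<bar> + ?w y * \<bar>X i - s0\<bar>"
          using lip[OF X'(1), of i y] bnd[of s0 y] \<open>\<delta> > 0\<close>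
            mult_right_mono[OF bnd[of s0 y], of "\<bar>X i - s0\<bar>"]
          by (intro add_mono) (auto simp: mult.commute)
        finally show "norm (?Q (X i) y) \<le> ?w y + ?w y"
          using X'(2)[of i] by (intro quotient) auto
      qed
      show "AE y in lborel. (\<lambda>i. ?Q (X i) y) \<longlonglongrightarrow> 0"
      proof (rule AE_I2)
        fix y
        have "((\<lambda>s. ?Q s y) \<longlongrightarrow> 0) (at s0)"
          using der[of s0 y] \<open>\<delta> > 0\<close>
          unfolding has_vector_derivative_def has_derivative_within by simp
        then show "(\<lambda>i. ?Q (X i) y) \<longlonglongrightarrow> 0"
          unfolding tendsto_at_iff_sequentially using X X'(2) by (auto simp: o_def)
      qed
    qed simp
    then show "((\<lambda>s. \<integral>y. ?Q s y \<partial>lborel) \<circ> X) \<longlonglongrightarrow> 0" by (simp add: o_def)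
  qed
  then have lim: "((\<lambda>s. \<integral>y. ?Q s y \<partial>lborel) \<longlongrightarrow> 0) (at s0)"
    using \<open>\<delta> > 0\<close> by (simp add: at_within_open[of s0 "ball s0 \<delta>"])
  have "eventually (\<lambda>s. s \<in> ball s0 \<delta>) (at s0)"
    using \<open>\<delta> > 0\<close> eventually_at_in_open'[of "ball s0 \<delta>" s0] by simp
  then have "eventually (\<lambda>s. (\<integral>y. ?Q s y \<partial>lborel) = (1 / norm (s - s0)) *\<^sub>R
      ((\<integral>y. F s y \<partial>lborel) - ((\<integral>y. F s0 y \<partial>lborel) + (s - s0) *\<^sub>R (\<integral>y. F' s0 y \<partial>lborel)))) (at s0)"
  proof eventually_elim
    case (elim s)
    then have "integrable lborel (F s)"
      by (intro intF) (auto simp: dist_real_def abs_minus_commute)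
    then show ?case using int int' by simp
  qed
  from Lim_transform_eventually[OF lim this]
  show ?thesis
    unfolding has_vector_derivative_def has_derivative_within
    by (simp add: bounded_linear_scaleR_left)
qed

lemma continuous_on_integral:
  fixes F :: "'a::{first_countable_topology,t2_space} \<Rightarrow> real^'d::finite \<Rightarrow> complex"
  assumes "\<And>y. continuous_on UNIV (\<lambda>x. F x y)" "\<And>x. continuous_on UNIV (F x)"
    and "\<And>x y. norm (F x y) \<le> inv_power C y"
  shows "continuous_on UNIV (\<lambda>x. \<integral>y. F x y \<partial>lborel)"
proof -
  let ?w = "\<lambda>y::real^'d. inv_power C y"
  have w: "integrable lborel ?w"
    using integrable_mult_right[OF integrable_inverse_power_norm[where 'd='d], of C] by simp
  have meas: "F x \<in> borel_measurable lborel" for x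
    using borel_measurable_continuous_onI[OF assms(2)] by simp
  have "continuous (at x) (\<lambda>x. \<integral>y. F x y \<partial>lborel)" for x
    unfolding continuous_within tendsto_at_iff_sequentially
  proof (intro allI impI)
    fix X assume X: "\<forall>i. X i \<in> UNIV - {x}" "X \<longlonglongrightarrow> x"
    show "((\<lambda>x. \<integral>y. F x y \<partial>lborel) \<circ> X) \<longlonglongrightarrow> (\<integral>y. F x y \<partial>lborel)"
      unfolding o_def
    proof (rule integral_dominated_convergence[OF meas meas w])
      show "AE y in lborel. (\<lambda>i. F (X i) y) \<longlonglongrightarrow> F x y"
        using assms(1) X(2)
        by (intro AE_I2 isCont_tendsto_compose[of x "\<lambda>x. F x _"]) (simp_all add: continuous_on_eq_continuous_at)
    qed (use assms(3) in auto)
  qed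
  then show ?thesis by (simp add: continuous_on_eq_continuous_at)
qed

lemma has_vector_derivative_along_line:
  fixes F :: "'a::real_normed_vector \<Rightarrow> 'b::real_normed_vector"
  assumes "((\<lambda>t. F ((x + s *\<^sub>R e) + t *\<^sub>R e)) has_vector_derivative D) (at 0)"
  shows "((\<lambda>t. F (x + t *\<^sub>R e)) has_vector_derivative D) (at s)"
proof -
  have "((\<lambda>t::real. t - s) has_vector_derivative 1) (at s)"
    by (auto intro!: derivative_eq_intros)
  from vector_diff_chain_at[OF this, of "\<lambda>t. F ((x + s *\<^sub>R e) + t *\<^sub>R e)" D] assms
  show ?thesis by (simp add: o_def algebra_simps)
qed

lemma inverse_power_norm_translate:
  fixes x h :: "'a::real_normed_vector"
  assumes "norm h \<le> 1" "C \<ge> 0"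
  shows "C / (1 + norm (x + h)) ^ q \<le> (C * 2 ^ q) / (1 + norm x) ^ q"
proof -
  have "norm x \<le> norm (x + h) + norm h" by (metis norm_triangle_ineq2 add_diff_cancel_right' norm_triangle_sub add.commute norm_minus_commute diff_add_cancel)
  then have "1 + norm x \<le> 2 * (1 + norm (x + h))"
    using assms(1) norm_ge_zero[of "x + h"] by argo
  then have "(1 + norm x) ^ q \<le> 2 ^ q * (1 + norm (x + h)) ^ q"
    unfolding power_mult_distrib[symmetric] by (intro power_mono) auto
  moreover have "1 + norm x > 0" "1 + norm (x + h) > 0" by (auto simp: add_pos_nonneg)
  ultimately show ?thesis
    using \<open>C \<ge> 0\<close> mult_left_mono[of "(1 + norm x) ^ q" "2 ^ q * (1 + norm (x + h)) ^ q" C]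
    by (simp add: field_simps)
qed

text \<open>The integral of \<open>x \<mapsto> F (x + s e\<^sub>k)\<close> does not depend on \<open>s\<close>; its derivative in \<open>s\<close> is the integral
of the partial derivative.\<close>

lemma integral_axis_derivative_eq_0:
  fixes F F' :: "real^'d::finite \<Rightarrow> complex"
  assumes der: "\<And>x. ((\<lambda>t. F (x + t *\<^sub>R axis k 1)) has_vector_derivative F' x) (at 0)"
    and cont: "continuous_on UNIV F" "continuous_on UNIV F'"
    and bnd: "\<And>x. norm (F x) \<le> inv_power C x"
    and bnd': "\<And>x. norm (F' x) \<le> inv_power C x"
  shows "(\<integral>x. F' x \<partial>lborel) = 0"
proof -
  have C: "C \<ge> 0" using order_trans[OF norm_ge_zero bnd[of 0]] by simp
  let ?e = "axis k 1 :: real^'d"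
  have "((\<lambda>s. \<integral>y. F (y + s *\<^sub>R ?e) \<partial>lborel) has_vector_derivative (\<integral>y. F' (y + 0 *\<^sub>R ?e) \<partial>lborel)) (at 0)"
  proof (rule has_vector_derivative_integral[where \<delta> = 1 and C = "C * 2 ^ (CARD('d) + 2)"])
    show "((\<lambda>s. F (y + s *\<^sub>R ?e)) has_vector_derivative F' (y + s *\<^sub>R ?e)) (at s)" for s y
      by (rule has_vector_derivative_along_line, rule der)
    show "continuous_on UNIV (\<lambda>y. F (y + s *\<^sub>R ?e))" for s
      by (intro continuous_on_compose2[OF cont(1)] continuous_intros) auto
    show "continuous_on UNIV (\<lambda>y. F' (y + 0 *\<^sub>R ?e))" using cont(2) by simp
    show "integrable lborel (\<lambda>y. F (y + 0 *\<^sub>R ?e))" using integrable_dominated[OF cont(1) bnd] by simp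
    show "norm (F' (y + s *\<^sub>R ?e)) \<le> C * 2 ^ (CARD('d) + 2) / (1 + norm y) ^ (CARD('d) + 2)"
      if "\<bar>s - 0\<bar> < 1" for s y
      by (rule order_trans[OF bnd' inverse_power_norm_translate]) (use that C in \<open>auto simp: norm_axis_1\<close>)
  qed simp
  moreover have "(\<integral>y. F (y + s *\<^sub>R ?e) \<partial>lborel) = (\<integral>y. F y \<partial>lborel)" for s
  proof -
    have "(\<integral>y. F y \<partial>lborel) = (\<integral>y. F y \<partial>(distr lborel borel (\<lambda>x. s *\<^sub>R ?e + x)))"
      using lborel_distr_plus[of "s *\<^sub>R ?e"] by simp
    also have "\<dots> = (\<integral>y. F (s *\<^sub>R ?e + y) \<partial>lborel)"
      using borel_measurable_continuous_onI[OF cont(1)] by (intro integral_distr) auto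
    finally show ?thesis by (simp add: add.commute)
  qed
  ultimately have "((\<lambda>s::real. \<integral>y. F y \<partial>lborel) has_vector_derivative (\<integral>y. F' y \<partial>lborel)) (at 0)"
    by simp
  from vector_derivative_unique_at[OF this has_vector_derivative_const]
  show ?thesis .
qed

section \<open>Smooth functions and their iterated partial derivatives\<close>

lemma vector_derivative_bound_segment:
  fixes f :: "real \<Rightarrow> 'a::real_normed_vector"
  assumes "\<And>s. s \<in> closed_segment a b \<Longrightarrow> (f has_vector_derivative f' s) (at s)"
    and "\<And>s. s \<in> closed_segment a b \<Longrightarrow> norm (f' s) \<le> B"
  shows "norm (f b - f a) \<le> B * \<bar>b - a\<bar>"
  using differentiable_bound[of "closed_segment a b" f "\<lambda>s h. h *\<^sub>R f' s" B b a] assms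
  by (auto simp: has_vector_derivative_def onorm_scaleR_left onorm_id intro: has_derivative_at_withinI)

lemma has_vector_derivative_linear: "((\<lambda>t::real. t *\<^sub>R c) has_vector_derivative c) (at t)"
  by (auto intro!: derivative_eq_intros)

text \<open>The increment is split along the coordinates, one coordinate at a time, which is the induction over
finite sets of coordinates in the proof.\<close>

lemma has_derivative_continuous_partials:
  fixes f :: "real^'d::finite \<Rightarrow> complex" and g :: "'d \<Rightarrow> real^'d \<Rightarrow> complex"
  assumes der: "\<And>i x. ((\<lambda>t. f (x + t *\<^sub>R axis i 1)) has_vector_derivative g i x) (at 0)"
    and cont: "\<And>i. continuous_on UNIV (g i)"
  shows "(f has_derivative (\<lambda>h. \<Sum>i\<in>UNIV. (h $ i) *\<^sub>R g i x)) (at x)"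
proof -
  let ?p = "\<lambda>S h. \<Sum>i\<in>S. (h $ i) *\<^sub>R (axis i 1 :: real^'d)"
  have p_nth: "?p S h $ j = (if j \<in> S then h $ j else 0)" if "finite S" for S h j
    using that by (induction S rule: finite_induct) (auto simp: axis_def)
  have p_norm: "norm (?p S h) \<le> norm h" if "finite S" for S and h :: "real^'d"
    by (rule norm_le_componentwise_cart) (simp only: p_nth[OF that], simp)
  have p_UNIV: "?p UNIV h = h" for h :: "real^'d"
    unfolding vec_eq_iff p_nth[OF finite] by simp
  have main: "\<forall>e>0. \<exists>d>0. \<forall>h. norm h < d \<longrightarrow>
      norm (f (x + ?p S h) - f x - (\<Sum>i\<in>S. (h $ i) *\<^sub>R g i x)) \<le> e * norm h" if "finite S" for S
    using that
  proof (induction S rule: finite_induct)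
    case empty
    then show ?case by (auto intro!: exI[of _ 1])
  next
    case (insert k S)
    show ?case
    proof (intro allI impI)
      fix e :: real assume "e > 0"
      then have "e / 2 > 0" by simp
      with insert.IH obtain d1 where d1: "d1 > 0" "\<And>h. norm h < d1 \<Longrightarrow>
          norm (f (x + ?p S h) - f x - (\<Sum>i\<in>S. (h $ i) *\<^sub>R g i x)) \<le> e / 2 * norm h"
        by blast
      have "isCont (g k) x" using cont[of k] by (simp add: continuous_on_eq_continuous_at)
      then obtain d2 where d2: "d2 > 0" "\<And>z. norm (z - x) < d2 \<Longrightarrow> norm (g k z - g k x) < e / 2"
        using half_gt_zero[OF \<open>e > 0\<close>] unfolding continuous_at_eps_delta dist_norm by blast
      have "norm (f (x + ?p (insert k S) h) - f x - (\<Sum>i\<in>insert k S. (h $ i) *\<^sub>R g i x)) \<le> e * norm h"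
        if h: "norm h < min d1 (d2 / 2)" for h
      proof -
        let ?q = "\<lambda>t. f (x + ?p S h + t *\<^sub>R axis k 1) - t *\<^sub>R g k x"
        have "norm (?q (h $ k) - ?q 0) \<le> e / 2 * \<bar>h $ k - 0\<bar>"
        proof (rule vector_derivative_bound_segment)
          show "(?q has_vector_derivative g k (x + ?p S h + t *\<^sub>R axis k 1) - g k x) (at t)" for t
            by (rule has_vector_derivative_diff[OF has_vector_derivative_along_line[OF der] has_vector_derivative_linear])
          fix t assume "t \<in> closed_segment 0 (h $ k)"
          then have "\<bar>t\<bar> \<le> \<bar>h $ k\<bar>" by (auto simp: closed_segment_eq_real_ivl split: if_splits)
          then have t: "\<bar>t\<bar> \<le> norm h" using component_le_norm_cart[of h k] by linarith
          have "norm (?p S h + t *\<^sub>R axis k 1) \<le> norm h + \<bar>t\<bar>"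
            using norm_triangle_ineq[of "?p S h" "t *\<^sub>R axis k 1"] p_norm[OF insert.hyps(1), of h] by simp
          also have "\<dots> < d2" using h t by simp
          finally have "norm (x + ?p S h + t *\<^sub>R axis k 1 - x) < d2" by (simp add: add.assoc)
          from d2(2)[OF this] show "norm (g k (x + ?p S h + t *\<^sub>R axis k 1) - g k x) \<le> e / 2" by simp
        qed
        also have "\<dots> \<le> e / 2 * norm h"
          using component_le_norm_cart[of h k] \<open>e > 0\<close> by (intro mult_left_mono) auto
        finally have 1: "norm (?q (h $ k) - ?q 0) \<le> e / 2 * norm h" .
        have eq: "f (x + ?p (insert k S) h) - f x - (\<Sum>i\<in>insert k S. (h $ i) *\<^sub>R g i x)
            = (f (x + ?p S h) - f x - (\<Sum>i\<in>S. (h $ i) *\<^sub>R g i x)) + (?q (h $ k) - ?q 0)"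
          using insert.hyps by (simp add: algebra_simps)
        show ?thesis unfolding eq
          using norm_triangle_ineq[of "f (x + ?p S h) - f x - (\<Sum>i\<in>S. (h $ i) *\<^sub>R g i x)" "?q (h $ k) - ?q 0"]
            1 d1(2)[of h] h by (simp del: scaleR_zero_left)
      qed
      then show "\<exists>d>0. \<forall>h. norm h < d \<longrightarrow>
          norm (f (x + ?p (insert k S) h) - f x - (\<Sum>i\<in>insert k S. (h $ i) *\<^sub>R g i x)) \<le> e * norm h"
        using d1(1) d2(1) by (intro exI[of _ "min d1 (d2 / 2)"]) auto
    qed
  qed
  show ?thesis
    unfolding has_derivative_within_alt
  proof (intro conjI allI impI)
    show "bounded_linear (\<lambda>h. \<Sum>i\<in>UNIV. (h $ i) *\<^sub>R g i x)"
      by (intro bounded_linear_sum bounded_linear_scaleR_const bounded_linear_vec_nth)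
    fix e :: real assume "e > 0"
    with main[of UNIV] obtain d where d: "d > 0" "\<And>h. norm h < d \<Longrightarrow>
        norm (f (x + ?p UNIV h) - f x - (\<Sum>i\<in>UNIV. (h $ i) *\<^sub>R g i x)) \<le> e * norm h"
      by auto
    show "\<exists>d>0. \<forall>y\<in>UNIV. norm (y - x) < d \<longrightarrow>
        norm (f y - f x - (\<Sum>i\<in>UNIV. ((y - x) $ i) *\<^sub>R g i x)) \<le> e * norm (y - x)"
      using d(1) d(2)[unfolded p_UNIV, of "_ - x"] by (intro exI[of _ d]) simp
  qed
qed

text \<open>The second difference of \<open>f\<close> over a square of side \<open>h\<close> determines the mixed derivative and is
symmetric in the two directions, which yields the symmetry of the mixed derivatives
(\<open>mixed_partials_eq\<close>).\<close>

lemma mixed_difference_quotient: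
  fixes f g m :: "real^'d::finite \<Rightarrow> complex"
  assumes f: "\<And>x. ((\<lambda>t. f (x + t *\<^sub>R axis i 1)) has_vector_derivative g x) (at 0)"
    and g: "\<And>x. ((\<lambda>t. g (x + t *\<^sub>R axis j 1)) has_vector_derivative m x) (at 0)"
    and cont: "continuous_on UNIV m" and "e > 0"
  shows "\<exists>d>0. \<forall>h. 0 < h \<and> h < d \<longrightarrow>
    norm (f (x + h *\<^sub>R axis i 1 + h *\<^sub>R axis j 1) - f (x + h *\<^sub>R axis i 1)
      - f (x + h *\<^sub>R axis j 1) + f x - h\<^sup>2 *\<^sub>R m x) \<le> e * h\<^sup>2"
proof -
  have "isCont m x" using cont by (simp add: continuous_on_eq_continuous_at)
  then obtain d where d: "d > 0" "\<And>z. norm (z - x) < d \<Longrightarrow> norm (m z - m x) < e"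
    using \<open>e > 0\<close> unfolding continuous_at_eps_delta dist_norm by blast
  have "norm (f (x + h *\<^sub>R axis i 1 + h *\<^sub>R axis j 1) - f (x + h *\<^sub>R axis i 1)
      - f (x + h *\<^sub>R axis j 1) + f x - h\<^sup>2 *\<^sub>R m x) \<le> e * h\<^sup>2" if h: "0 < h" "h < d / 2" for h
  proof -
    let ?u = "\<lambda>s. f (x + h *\<^sub>R axis j 1 + s *\<^sub>R axis i 1) - f (x + s *\<^sub>R axis i 1) - (s * h) *\<^sub>R m x"
    let ?v = "\<lambda>s t. g (x + s *\<^sub>R axis i 1 + t *\<^sub>R axis j 1) - t *\<^sub>R m x"
    have inner: "norm (?v s h - ?v s 0) \<le> e * \<bar>h - 0\<bar>" if s: "s \<in> closed_segment 0 h" for s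
    proof (rule vector_derivative_bound_segment)
      show "(?v s has_vector_derivative m (x + s *\<^sub>R axis i 1 + t *\<^sub>R axis j 1) - m x) (at t)" for t
        by (rule has_vector_derivative_diff[OF has_vector_derivative_along_line[OF g] has_vector_derivative_linear])
      fix t assume t: "t \<in> closed_segment 0 h"
      have "norm (s *\<^sub>R axis i 1 + t *\<^sub>R axis j 1 :: real^'d) \<le> \<bar>s\<bar> + \<bar>t\<bar>"
        using norm_triangle_ineq[of "s *\<^sub>R axis i 1" "t *\<^sub>R axis j 1 :: real^'d"] by simp
      also have "\<dots> < d" using s t h by (auto simp: closed_segment_eq_real_ivl)
      finally show "norm (m (x + s *\<^sub>R axis i 1 + t *\<^sub>R axis j 1) - m x) \<le> e"
        by (intro less_imp_le d(2)) (simp add: add.assoc)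
    qed
    have "norm (?u h - ?u 0) \<le> (e * h) * \<bar>h - 0\<bar>"
    proof (rule vector_derivative_bound_segment)
      show "(?u has_vector_derivative ?v s h - ?v s 0) (at s)" for s
      proof -
        have "(?u has_vector_derivative g (x + h *\<^sub>R axis j 1 + s *\<^sub>R axis i 1) - g (x + s *\<^sub>R axis i 1) - (h *\<^sub>R m x)) (at s)"
          using has_vector_derivative_linear[of "h *\<^sub>R m x" s]
          by (intro has_vector_derivative_diff[OF has_vector_derivative_diff[OF
                has_vector_derivative_along_line[OF f] has_vector_derivative_along_line[OF f]]]) simp
        then show ?thesis by (simp add: algebra_simps)
      qed
      show "norm (?v s h - ?v s 0) \<le> e * h" if "s \<in> closed_segment 0 h" for s
        using inner[OF that] h by simp
    qed
    then show ?thesis using h by (simp add: power2_eq_square algebra_simps)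
  qed
  then show ?thesis using d(1) by (intro exI[of _ "d / 2"]) auto
qed

lemma mixed_partials_eq:
  fixes f gi gj mij mji :: "real^'d::finite \<Rightarrow> complex"
  assumes fi: "\<And>x. ((\<lambda>t. f (x + t *\<^sub>R axis i 1)) has_vector_derivative gi x) (at 0)"
    and gi: "\<And>x. ((\<lambda>t. gi (x + t *\<^sub>R axis j 1)) has_vector_derivative mij x) (at 0)"
    and fj: "\<And>x. ((\<lambda>t. f (x + t *\<^sub>R axis j 1)) has_vector_derivative gj x) (at 0)"
    and gj: "\<And>x. ((\<lambda>t. gj (x + t *\<^sub>R axis i 1)) has_vector_derivative mji x) (at 0)"
    and "continuous_on UNIV mij" "continuous_on UNIV mji"
  shows "mij x = mji x"
proof (rule ccontr)
  assume "mij x \<noteq> mji x"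
  (* Two approximations within e each cannot bridge a gap of 3 e. *)
  define e where "e = norm (mij x - mji x) / 3"
  have e: "e > 0" using \<open>mij x \<noteq> mji x\<close> by (simp add: e_def)
  let ?D = "\<lambda>h::real. f (x + h *\<^sub>R axis i 1 + h *\<^sub>R axis j 1) - f (x + h *\<^sub>R axis i 1)
      - f (x + h *\<^sub>R axis j 1) + f x"
  obtain d1 where d1: "d1 > 0" "\<And>h. 0 < h \<Longrightarrow> h < d1 \<Longrightarrow> norm (?D h - h\<^sup>2 *\<^sub>R mij x) \<le> e * h\<^sup>2"
    using mixed_difference_quotient[OF fi gi assms(5) e, of x] by blast
  obtain d2 where d2: "d2 > 0" "\<And>h. 0 < h \<Longrightarrow> h < d2 \<Longrightarrow> norm (?D h - h\<^sup>2 *\<^sub>R mji x) \<le> e * h\<^sup>2"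
    using mixed_difference_quotient[OF fj gj assms(6) e, of x] by (auto simp: algebra_simps)
  define h where "h = min d1 d2 / 2"
  have h: "0 < h" "h < d1" "h < d2" using d1(1) d2(1) by (auto simp: h_def)
  have "h\<^sup>2 * norm (mij x - mji x) = norm (h\<^sup>2 *\<^sub>R mij x - h\<^sup>2 *\<^sub>R mji x)"
    by (simp add: scaleR_diff_right[symmetric])
  also have "\<dots> \<le> norm (?D h - h\<^sup>2 *\<^sub>R mji x) + norm (?D h - h\<^sup>2 *\<^sub>R mij x)"
    using norm_triangle_ineq4[of "?D h - h\<^sup>2 *\<^sub>R mji x" "?D h - h\<^sup>2 *\<^sub>R mij x"] by simp
  also have "\<dots> \<le> e * h\<^sup>2 + e * h\<^sup>2" using d1(2) d2(2) h by (intro add_mono) auto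
  also have "\<dots> < h\<^sup>2 * (3 * e)" using e h by simp
  finally show False by (simp add: e_def)
qed

lemma partial_deriv_eqI:
  "((\<lambda>t. f (x + t *\<^sub>R axis i 1)) has_vector_derivative D) (at 0) \<Longrightarrow> partial_deriv i f x = D"
  unfolding partial_deriv_def by (rule vector_derivative_at)

lemma iter_partial_Nil [simp]: "iter_partial [] f = f"
  and iter_partial_Cons [simp]: "iter_partial (j # js) f = partial_deriv j (iter_partial js f)"
  and iter_partial_append: "iter_partial (js @ ks) f = iter_partial js (iter_partial ks f)"
  by (simp_all add: iter_partial_def)

text \<open>Iterated partial derivatives are controlled by a family of functions that is closed under
differentiation along the axes: linear combinations of smooth functions, heat flows, or products of
polynomials with a fixed Gaussian wave.\<close>

lemma iter_partial_closed:
  assumes "f \<in> S"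
    and der: "\<And>g i. g \<in> S \<Longrightarrow>
      \<exists>g'\<in>S. \<forall>x. ((\<lambda>t. g (x + t *\<^sub>R axis i 1)) has_vector_derivative g' x) (at 0)"
  shows "iter_partial js f \<in> S"
proof (induction js)
  case (Cons j js)
  from der[OF this, of j] obtain g' where g': "g' \<in> S"
    "\<forall>x. ((\<lambda>t. iter_partial js f (x + t *\<^sub>R axis j 1)) has_vector_derivative g' x) (at 0)" by blast
  then have "iter_partial (j # js) f = g'" by (auto intro!: partial_deriv_eqI)
  with g'(1) show ?case by simp
qed (simp add: \<open>f \<in> S\<close>)

lemma C_infty_coinduct:
  assumes "f \<in> S" and cont: "\<And>g. g \<in> S \<Longrightarrow> continuous_on UNIV g"
    and der: "\<And>g i. g \<in> S \<Longrightarrow>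
      \<exists>g'\<in>S. \<forall>x. ((\<lambda>t. g (x + t *\<^sub>R axis i 1)) has_vector_derivative g' x) (at 0)"
  shows "C_infty f"
proof -
  note S = iter_partial_closed[OF assms(1) der]
  show ?thesis unfolding C_infty_def
    using cont[OF S] der[OF S] by (blast intro: differentiableI_vector)
qed

lemma C_infty_iter_partial: "C_infty f \<Longrightarrow> C_infty (iter_partial ks f)"
  unfolding C_infty_def by (metis iter_partial_append)

lemma C_infty_partial_deriv: "C_infty f \<Longrightarrow> C_infty (partial_deriv j f)"
  using C_infty_iter_partial[of f "[j]"] by simp

lemma C_infty_continuous: "C_infty f \<Longrightarrow> continuous_on UNIV f"
  unfolding C_infty_def by (metis iter_partial_Nil)

lemma C_infty_has_vector_derivative:
  "C_infty f \<Longrightarrow> ((\<lambda>t. f (x + t *\<^sub>R axis i 1)) has_vector_derivative partial_deriv i f x) (at 0)"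
  unfolding C_infty_def partial_deriv_def vector_derivative_works[symmetric] by (metis iter_partial_Nil)

lemma C_infty_derivative_along_ray:
  assumes "C_infty f"
  shows "((\<lambda>s. f (x - s *\<^sub>R y)) has_vector_derivative
    - (\<Sum>i\<in>UNIV. (y $ i) *\<^sub>R partial_deriv i f (x - s *\<^sub>R y))) (at s)"
proof -
  have "((\<lambda>s. x - s *\<^sub>R y) has_derivative (\<lambda>h. - (h *\<^sub>R y))) (at s)"
    by (auto intro!: derivative_eq_intros)
  moreover have "(f has_derivative (\<lambda>h. \<Sum>i\<in>UNIV. (h $ i) *\<^sub>R partial_deriv i f z)) (at z)" for z
    by (rule has_derivative_continuous_partials)
      (intro C_infty_has_vector_derivative C_infty_continuous C_infty_partial_deriv assms)+
  ultimately
  have "((\<lambda>s. f (x - s *\<^sub>R y)) has_derivative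
      (\<lambda>h. \<Sum>i\<in>UNIV. ((- (h *\<^sub>R y)) $ i) *\<^sub>R partial_deriv i f (x - s *\<^sub>R y))) (at s)"
    by (rule has_derivative_compose)
  then show ?thesis
    unfolding has_vector_derivative_def by (simp add: scaleR_sum_right sum_negf)
qed

lemma partial_deriv_commute:
  assumes "C_infty f" shows "partial_deriv i (partial_deriv j f) = partial_deriv j (partial_deriv i f)"
proof
  fix x
  note d = C_infty_has_vector_derivative[OF assms]
    C_infty_has_vector_derivative[OF C_infty_partial_deriv[OF assms]]
  show "partial_deriv i (partial_deriv j f) x = partial_deriv j (partial_deriv i f) x"
    by (rule mixed_partials_eq[OF d d]) (intro C_infty_continuous C_infty_partial_deriv assms)+
qed

lemma iter_partial_partial_deriv:
  "C_infty f \<Longrightarrow> iter_partial js (partial_deriv i f) = partial_deriv i (iter_partial js f)"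
  by (induction js) (simp_all add: partial_deriv_commute C_infty_iter_partial)

lemma iter_partial_permute:
  assumes "C_infty f"
  shows "mset js = mset ks \<Longrightarrow> iter_partial js f = iter_partial ks f"
proof (induction js arbitrary: ks)
  case (Cons j js)
  have "j \<in> set ks" using Cons.prems by (metis list.set_intros(1) mset_eq_setD)
  then obtain us vs where ks: "ks = us @ j # vs" by (meson split_list)
  have "iter_partial js f = iter_partial (us @ vs) f"
    using Cons.prems by (intro Cons.IH) (simp add: ks)
  then show ?case
    using assms by (simp add: ks iter_partial_append iter_partial_partial_deriv C_infty_iter_partial)
qed simp

lemma multi_deriv_eq_iter_partial:
  "multi_deriv \<alpha> f = iter_partial (concat (map (\<lambda>i. replicate (\<alpha> i) i) coord_list)) f"
proof -
  have "foldr (\<lambda>i. partial_deriv i ^^ \<alpha> i) xs f = iter_partial (concat (map (\<lambda>i. replicate (\<alpha> i) i) xs)) f"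
    for xs
    by (induction xs) (simp_all add: iter_partial_append, simp add: iter_partial_def)
  then show ?thesis by (simp add: multi_deriv_def)
qed

lemma iter_partial_eq_multi_deriv:
  fixes f :: "real^'d::finite \<Rightarrow> complex"
  assumes "C_infty f"
  shows "iter_partial js f = multi_deriv (count (mset js)) f"
proof -
  have "distinct (coord_list :: 'd list) \<and> set (coord_list :: 'd list) = UNIV"
    unfolding coord_list_def by (rule someI_ex) (metis finite_distinct_list finite)
  then have c: "count (mset (coord_list :: 'd list)) i = 1" for i
    by (simp add: count_mset distinct_count_atmost_1)
  have "count (mset (concat (map (\<lambda>i. replicate (\<alpha> i) i) xs))) i = count (mset xs) i * \<alpha> i"
    for xs and \<alpha> :: "'d \<Rightarrow> nat" and i
    by (induction xs) auto
  then have "mset (concat (map (\<lambda>i. replicate (count (mset js) i) i) coord_list)) = mset js"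
    by (simp add: multiset_eq_iff c)
  from iter_partial_permute[OF assms this] show ?thesis by (simp add: multi_deriv_eq_iter_partial)
qed

lemma iter_partial_lincomb:
  assumes "C_infty f" "C_infty g"
  shows "iter_partial js (\<lambda>x. c * f x + d * g x) = (\<lambda>x. c * iter_partial js f x + d * iter_partial js g x)"
proof (induction js)
  case (Cons j js)
  show ?case
    unfolding iter_partial_Cons Cons.IH
    using assms
    by (auto intro!: ext partial_deriv_eqI derivative_eq_intros has_vector_derivative_mult_right
        C_infty_has_vector_derivative C_infty_iter_partial simp flip: iter_partial_Cons)
qed simp

lemma C_infty_lincomb:
  assumes "C_infty f" "C_infty g"
  shows "C_infty (\<lambda>x. c * f x + d * g x)"
proof (rule C_infty_coinduct[where S = "{\<lambda>x. c * f x + d * g x | f g. C_infty f \<and> C_infty g}"])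
  fix h i assume "h \<in> {\<lambda>x. c * f x + d * g x | f g. C_infty f \<and> C_infty g}"
  then obtain f g where h: "h = (\<lambda>x. c * f x + d * g x)" and fg: "C_infty f" "C_infty g" by blast
  show "\<exists>h'\<in>{\<lambda>x. c * f x + d * g x | f g. C_infty f \<and> C_infty g}.
      \<forall>x. ((\<lambda>t. h (x + t *\<^sub>R axis i 1)) has_vector_derivative h' x) (at 0)"
    unfolding h using fg
    by (intro bexI[of _ "\<lambda>x. c * partial_deriv i f x + d * partial_deriv i g x"])
      (auto intro!: derivative_eq_intros has_vector_derivative_mult_right C_infty_has_vector_derivative
        intro: C_infty_partial_deriv)
qed (use assms in \<open>auto intro!: continuous_on_add continuous_on_mult_left dest: C_infty_continuous\<close>)

lemma C_infty_0: "C_infty (\<lambda>x. 0)"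
  by (rule C_infty_coinduct[where S = "{\<lambda>x. 0}"]) (auto intro!: derivative_eq_intros)

lemma iter_partial_0: "iter_partial js (\<lambda>x. 0) = (\<lambda>x. 0)"
  using iter_partial_lincomb[OF C_infty_0 C_infty_0, of js 0 0] by simp

lemma C_infty_sum: "finite S \<Longrightarrow> (\<And>i. i \<in> S \<Longrightarrow> C_infty (f i)) \<Longrightarrow> C_infty (\<lambda>x. \<Sum>i\<in>S. f i x)"
proof (induction S rule: finite_induct)
  case (insert k S)
  then show ?case using C_infty_lincomb[of "f k" "\<lambda>x. \<Sum>i\<in>S. f i x" 1 1] by simp
qed (simp add: C_infty_0)

lemma iter_partial_sum:
  "finite S \<Longrightarrow> (\<And>i. i \<in> S \<Longrightarrow> C_infty (f i)) \<Longrightarrow>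
    iter_partial js (\<lambda>x. \<Sum>i\<in>S. f i x) = (\<lambda>x. \<Sum>i\<in>S. iter_partial js (f i) x)"
proof (induction S rule: finite_induct)
  case (insert k S)
  then show ?case using iter_partial_lincomb[of "f k" "\<lambda>x. \<Sum>i\<in>S. f i x" js 1 1] C_infty_sum[of S f] by simp
qed (simp add: iter_partial_0)

lemma C_infty_cmult: "C_infty f \<Longrightarrow> C_infty (\<lambda>x. c * f x)"
  and iter_partial_cmult: "C_infty f \<Longrightarrow> iter_partial js (\<lambda>x. c * f x) = (\<lambda>x. c * iter_partial js f x)"
  and iter_partial_diff: "C_infty f \<Longrightarrow> C_infty g \<Longrightarrow>
    iter_partial js (\<lambda>x. f x - g x) = (\<lambda>x. iter_partial js f x - iter_partial js g x)"
  using C_infty_lincomb[of f f c 0] iter_partial_lincomb[of f f js c 0] iter_partial_lincomb[of f g js 1 "-1"]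
  by simp_all

lemma laplacian_eq_cmult_sum:
  "laplacian f = (\<lambda>x. (- 1) * (\<Sum>j\<in>UNIV. partial_deriv j (partial_deriv j f) x))"
  by (simp add: laplacian_def fun_eq_iff)

lemma C_infty_laplacian: "C_infty f \<Longrightarrow> C_infty (laplacian f)"
  unfolding laplacian_eq_cmult_sum by (intro C_infty_cmult C_infty_sum C_infty_partial_deriv finite)

lemma iter_partial_laplacian:
  "C_infty f \<Longrightarrow> iter_partial js (laplacian f) = laplacian (iter_partial js f)"
  unfolding laplacian_eq_cmult_sum
  by (subst iter_partial_cmult; (subst iter_partial_sum)?)
    (auto intro!: C_infty_sum C_infty_partial_deriv
      simp: iter_partial_partial_deriv C_infty_partial_deriv C_infty_iter_partial)

section \<open>Exponentially decaying smooth functions\<close>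

text \<open>The seminorms use one fixed order of differentiation. On smooth functions the order is irrelevant, so
every iterated derivative has the same decay, and the space is closed under differentiation.\<close>

lemma exp_schwartz_iff:
  "f \<in> exp_schwartz a \<longleftrightarrow> C_infty f \<and>
    (\<forall>m js. \<exists>C. \<forall>x. exp (a * norm x) * (1 + norm x) ^ m * cmod (iter_partial js f x) \<le> C)"
proof (cases "C_infty f")
  case True
  have "bdd_above (range (weighted_deriv a m \<alpha> f)) \<longleftrightarrow>
      (\<exists>C. \<forall>x. exp (a * norm x) * (1 + norm x) ^ m * cmod (multi_deriv \<alpha> f x) \<le> C)" for m \<alpha>
    by (auto simp: bdd_above_def weighted_deriv_def)
  moreover have "(\<forall>\<alpha>. P (multi_deriv \<alpha> f)) \<longleftrightarrow> (\<forall>js. P (iter_partial js f))" for P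
    by (metis iter_partial_eq_multi_deriv[OF True] multi_deriv_eq_iter_partial)
  from this[of "\<lambda>g. \<exists>C. \<forall>x. exp (a * norm x) * (1 + norm x) ^ m * cmod (g x) \<le> C" for m]
  have "(\<forall>\<alpha>. \<exists>C. \<forall>x. exp (a * norm x) * (1 + norm x) ^ m * cmod (multi_deriv \<alpha> f x) \<le> C) \<longleftrightarrow>
      (\<forall>js. \<exists>C. \<forall>x. exp (a * norm x) * (1 + norm x) ^ m * cmod (iter_partial js f x) \<le> C)" for m .
  ultimately have "(\<forall>m \<alpha>. bdd_above (range (weighted_deriv a m \<alpha> f))) \<longleftrightarrow>
    (\<forall>m js. \<exists>C. \<forall>x. exp (a * norm x) * (1 + norm x) ^ m * cmod (iter_partial js f x) \<le> C)"
    by simp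
  with True show ?thesis by (simp add: exp_schwartz_def)
qed (simp add: exp_schwartz_def)

lemma exp_schwartz_C_infty: "f \<in> exp_schwartz a \<Longrightarrow> C_infty f"
  by (simp add: exp_schwartz_iff)

lemma exp_schwartz_iter_partial: "f \<in> exp_schwartz a \<Longrightarrow> iter_partial js f \<in> exp_schwartz a"
  unfolding exp_schwartz_iff by (metis C_infty_iter_partial iter_partial_append)

lemma exp_schwartz_partial_deriv: "f \<in> exp_schwartz a \<Longrightarrow> partial_deriv j f \<in> exp_schwartz a"
  using exp_schwartz_iter_partial[of f a "[j]"] by simp

lemma exp_schwartz_lincomb:
  assumes "f \<in> exp_schwartz a" "g \<in> exp_schwartz a"
  shows "(\<lambda>x. c * f x + d * g x) \<in> exp_schwartz a"
proof -
  note cf = exp_schwartz_C_infty[OF assms(1)] exp_schwartz_C_infty[OF assms(2)]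
  have "\<exists>C. \<forall>x. exp (a * norm x) * (1 + norm x) ^ m * cmod (iter_partial js (\<lambda>x. c * f x + d * g x) x) \<le> C" for m js
  proof -
    let ?w = "\<lambda>x::real^'a. exp (a * norm x) * (1 + norm x) ^ m"
    obtain C D where C: "\<And>x. ?w x * cmod (iter_partial js f x) \<le> C"
      and D: "\<And>x. ?w x * cmod (iter_partial js g x) \<le> D"
      using assms unfolding exp_schwartz_iff by metis
    have "?w x * cmod (iter_partial js (\<lambda>x. c * f x + d * g x) x) \<le> cmod c * C + cmod d * D" for x
    proof -
      have "?w x * cmod (iter_partial js (\<lambda>x. c * f x + d * g x) x)
          \<le> ?w x * (cmod c * cmod (iter_partial js f x) + cmod d * cmod (iter_partial js g x))"
        unfolding iter_partial_lincomb[OF cf]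
        by (intro mult_left_mono) (auto intro: order_trans[OF norm_triangle_ineq] simp: norm_mult)
      also have "\<dots> = cmod c * (?w x * cmod (iter_partial js f x)) + cmod d * (?w x * cmod (iter_partial js g x))"
        by (simp add: algebra_simps)
      also have "\<dots> \<le> cmod c * C + cmod d * D" using C[of x] D[of x] by (intro add_mono mult_left_mono) auto
      finally show ?thesis .
    qed
    then show ?thesis by blast
  qed
  then show ?thesis by (simp add: exp_schwartz_iff C_infty_lincomb cf)
qed

lemma exp_schwartz_0: "(\<lambda>x. 0) \<in> exp_schwartz a"
  by (auto simp: exp_schwartz_iff C_infty_0 iter_partial_0)

lemma exp_schwartz_add: "f \<in> exp_schwartz a \<Longrightarrow> g \<in> exp_schwartz a \<Longrightarrow> (\<lambda>x. f x + g x) \<in> exp_schwartz a"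
  and exp_schwartz_diff: "f \<in> exp_schwartz a \<Longrightarrow> g \<in> exp_schwartz a \<Longrightarrow> (\<lambda>x. f x - g x) \<in> exp_schwartz a"
  and exp_schwartz_cmult: "f \<in> exp_schwartz a \<Longrightarrow> (\<lambda>x. c * f x) \<in> exp_schwartz a"
  using exp_schwartz_lincomb[of f a g 1 1] exp_schwartz_lincomb[of f a g 1 "-1"]
    exp_schwartz_lincomb[of f a f c 0] by simp_all

lemma exp_schwartz_sum:
  "finite S \<Longrightarrow> (\<And>i. i \<in> S \<Longrightarrow> f i \<in> exp_schwartz a) \<Longrightarrow> (\<lambda>x. \<Sum>i\<in>S. f i x) \<in> exp_schwartz a"
  by (induction S rule: finite_induct) (simp_all add: exp_schwartz_0 exp_schwartz_add)

lemma exp_schwartz_laplacian: "f \<in> exp_schwartz a \<Longrightarrow> laplacian f \<in> exp_schwartz a"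
  unfolding laplacian_eq_cmult_sum
  by (intro exp_schwartz_cmult exp_schwartz_sum exp_schwartz_partial_deriv finite)

lemma exp_schwartz_bounded:
  assumes "f \<in> exp_schwartz a" "a \<ge> 0"
  shows "\<exists>D\<ge>0. \<forall>x. cmod (f x) \<le> D"
proof -
  from assms(1) obtain D where D: "\<forall>x. exp (a * norm x) * (1 + norm x) ^ 0 * cmod (iter_partial [] f x) \<le> D"
    unfolding exp_schwartz_iff by blast
  have "cmod (f x) \<le> D" for x
  proof -
    have "1 * cmod (f x) \<le> exp (a * norm x) * cmod (f x)" using assms(2) by (intro mult_right_mono) auto
    also have "\<dots> \<le> D" using D by simp
    finally show ?thesis by simp
  qed
  then show ?thesis using norm_ge_zero order_trans by blast
qed

lemma exp_schwartz_continuous: "f \<in> exp_schwartz a \<Longrightarrow> continuous_on UNIV f"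
  by (intro C_infty_continuous exp_schwartz_C_infty)

lemma exp_schwartz_axis_derivative:
  "f \<in> exp_schwartz a \<Longrightarrow> ((\<lambda>t. f (x + t *\<^sub>R axis i 1)) has_vector_derivative partial_deriv i f x) (at 0)"
  by (intro C_infty_has_vector_derivative exp_schwartz_C_infty)

section \<open>Complex Gaussians\<close>

lemma power_le_fact_mult_exp:
  fixes x :: real assumes "x \<ge> 0" shows "x ^ p \<le> fact p * exp x"
proof -
  have "sum (\<lambda>n. x ^ n /\<^sub>R fact n) {p} \<le> (\<Sum>n. x ^ n /\<^sub>R fact n)"
    using assms by (intro sum_le_suminf summable_exp_generic) auto
  then have "x ^ p / fact p \<le> exp x" by (simp add: exp_def divide_inverse mult.commute)
  then show ?thesis by (simp add: field_simps)
qed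

text \<open>Completing the square: \<open>a \<bar>s\<bar> r - b r\<^sup>2\<close> is largest at \<open>R = a \<bar>s\<bar> / (2 b)\<close>, where it equals
\<open>a\<^sup>2 s\<^sup>2 / (4 b)\<close>. What remains is a Gaussian centred at \<open>R\<close>, which absorbs any power of \<open>1 + r\<close>
at the price of the same power of \<open>1 + R\<close>. The exponential rate is sharp; only a polynomial factor
is lost, and the equality case of the theorem depends on this.\<close>

lemma gaussian_weight_bound:
  fixes a b :: real
  assumes "a \<ge> 0" "b > 0"
  shows "\<exists>C\<ge>0. \<forall>s r. r \<ge> 0 \<longrightarrow>
    exp (- b * r\<^sup>2) * exp (a * (\<bar>s\<bar> * r)) * (1 + r) ^ p \<le> C * (1 + \<bar>s\<bar>) ^ p * exp (a\<^sup>2 / (4 * b) * s\<^sup>2)"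
proof -
  let ?M = "fact p * exp (1 + 1 / (4 * b)) :: real"
  have "exp (- b * r\<^sup>2) * exp (a * (\<bar>s\<bar> * r)) * (1 + r) ^ p
      \<le> (?M * (1 + a / (2 * b)) ^ p) * (1 + \<bar>s\<bar>) ^ p * exp (a\<^sup>2 / (4 * b) * s\<^sup>2)" if r: "r \<ge> 0" for s r
  proof -
    define R where "R = a * \<bar>s\<bar> / (2 * b)"
    define u where "u = \<bar>r - R\<bar>"
    have R: "R \<ge> 0" and u: "u \<ge> 0" using assms by (auto simp: R_def u_def)
    have "- b * r\<^sup>2 + a * (\<bar>s\<bar> * r) = a\<^sup>2 / (4 * b) * s\<^sup>2 - b * u\<^sup>2"
    proof -
      have "u\<^sup>2 = (r - R)\<^sup>2" by (simp add: u_def)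
      moreover have "b * R\<^sup>2 = a\<^sup>2 / (4 * b) * s\<^sup>2" "2 * b * R = a * \<bar>s\<bar>"
        using \<open>b > 0\<close> by (simp_all add: R_def power_divide power_mult_distrib power2_eq_square)
      moreover have "b * (r - R)\<^sup>2 = b * r\<^sup>2 - (2 * b * R) * r + b * R\<^sup>2"
        by (simp add: power2_eq_square algebra_simps)
      ultimately show ?thesis by simp
    qed
    then have e: "exp (- b * r\<^sup>2) * exp (a * (\<bar>s\<bar> * r)) = exp (a\<^sup>2 / (4 * b) * s\<^sup>2) * exp (- b * u\<^sup>2)"
      by (simp add: exp_add[symmetric])
    have "r \<le> u + R" unfolding u_def by linarith
    then have "1 + r \<le> (1 + R) * (1 + u)" using mult_nonneg_nonneg[OF R u] by (simp add: algebra_simps)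
    then have p1: "(1 + r) ^ p \<le> (1 + R) ^ p * (1 + u) ^ p"
      using r by (metis power_mono power_mult_distrib add_nonneg_nonneg zero_le_one)
    have "(1 + R) \<le> (1 + a / (2 * b)) * (1 + \<bar>s\<bar>)"
    proof -
      define c where "c = a / (2 * b)"
      have "c \<ge> 0" "R = c * \<bar>s\<bar>" using assms by (simp_all add: c_def R_def)
      then show ?thesis unfolding c_def[symmetric] by (simp add: algebra_simps)
    qed
    then have p2: "(1 + R) ^ p \<le> (1 + a / (2 * b)) ^ p * (1 + \<bar>s\<bar>) ^ p"
      using R by (metis power_mono power_mult_distrib add_nonneg_nonneg zero_le_one)
    have "0 \<le> b * (u - 1 / (2 * b))\<^sup>2" using \<open>b > 0\<close> by simp
    then have "1 + u - b * u\<^sup>2 \<le> 1 + 1 / (4 * b)"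
    proof -
      have "b * (u - 1 / (2 * b))\<^sup>2 = b * u\<^sup>2 - u + 1 / (4 * b)"
        using \<open>b > 0\<close> by (simp add: power2_eq_square field_simps)
      with \<open>0 \<le> b * (u - 1 / (2 * b))\<^sup>2\<close> show ?thesis by linarith
    qed
    then have "exp (- b * u\<^sup>2) * exp (1 + u) \<le> exp (1 + 1 / (4 * b))"
      by (simp add: exp_add[symmetric])
    then have 1: "fact p * (exp (- b * u\<^sup>2) * exp (1 + u)) \<le> ?M" by (intro mult_left_mono) auto
    have "exp (- b * u\<^sup>2) * (1 + u) ^ p \<le> exp (- b * u\<^sup>2) * (fact p * exp (1 + u))"
      using u by (intro mult_left_mono power_le_fact_mult_exp) auto
    also have "\<dots> = fact p * (exp (- b * u\<^sup>2) * exp (1 + u))"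
      by (rule mult.left_commute)
    also note 1
    finally have p3: "exp (- b * u\<^sup>2) * (1 + u) ^ p \<le> ?M" .
    have "exp (- b * u\<^sup>2) * (1 + r) ^ p \<le> exp (- b * u\<^sup>2) * ((1 + R) ^ p * (1 + u) ^ p)"
      using p1 by (intro mult_left_mono) auto
    also have "\<dots> = (exp (- b * u\<^sup>2) * (1 + u) ^ p) * (1 + R) ^ p" by (simp add: mult_ac)
    also have "\<dots> \<le> ?M * ((1 + a / (2 * b)) ^ p * (1 + \<bar>s\<bar>) ^ p)"
      using R u by (intro mult_mono p3 p2) auto
    finally have "exp (a\<^sup>2 / (4 * b) * s\<^sup>2) * (exp (- b * u\<^sup>2) * (1 + r) ^ p)
      \<le> exp (a\<^sup>2 / (4 * b) * s\<^sup>2) * (?M * ((1 + a / (2 * b)) ^ p * (1 + \<bar>s\<bar>) ^ p))"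
      by (rule mult_left_mono) simp
    then show ?thesis unfolding e by (simp add: mult_ac)
  qed
  moreover have "?M * (1 + a / (2 * b)) ^ p \<ge> 0" using assms by simp
  ultimately show ?thesis by blast
qed

lemma integral_pos:
  fixes g :: "real^'d::finite \<Rightarrow> real"
  assumes "integrable lborel g" "\<And>x. g x > 0"
  shows "(\<integral>x. g x \<partial>lborel) > 0"
proof (rule ccontr)
  assume "\<not> ?thesis"
  moreover have "(\<integral>x. g x \<partial>lborel) \<ge> 0" using assms(2) by (intro Bochner_Integration.integral_nonneg less_imp_le)
  ultimately have "(\<integral>x. g x \<partial>lborel) = 0" by simp
  then have "AE x in lborel. g x = 0"
    using assms by (subst (asm) integral_nonneg_eq_0_iff_AE) (auto intro: less_imp_le)
  then have "AE x::real^'d in lborel. False"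
    by eventually_elim (metis assms(2) less_irrefl)
  then show False by (simp add: trivial_limit_def[symmetric] ae_filter_eq_bot_iff)
qed

definition gauss :: "complex \<Rightarrow> real^'d::finite \<Rightarrow> complex" where
  "gauss \<beta> y = exp (- (\<beta> * of_real ((norm y)\<^sup>2)))"

lemma norm_gauss: "cmod (gauss \<beta> y) = exp (- Re \<beta> * (norm y)\<^sup>2)"
  by (simp add: gauss_def norm_exp_eq_Re)

lemma continuous_on_gauss [continuous_intros]:
  "continuous_on S g \<Longrightarrow> continuous_on S (\<lambda>x. gauss \<beta> (g x))"
  unfolding gauss_def by (intro continuous_intros)

lemma norm_axis_line_sq: "(norm (x + t *\<^sub>R axis k 1 :: real^'d::finite))\<^sup>2 = (norm x)\<^sup>2 + 2 * t * x $ k + t\<^sup>2"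
  unfolding power2_norm_eq_inner
  by (simp add: inner_add_left inner_add_right inner_axis inner_axis' inner_commute power2_eq_square algebra_simps)

lemma gauss_axis_derivative:
  "((\<lambda>t. gauss \<beta> (x + t *\<^sub>R axis k 1)) has_vector_derivative - (2 * \<beta>) * (of_real (x $ k) * gauss \<beta> x)) (at 0)"
proof -
  have "((\<lambda>t. (norm x)\<^sup>2 + 2 * t * x $ k + t\<^sup>2) has_real_derivative 2 * x $ k) (at 0)"
    by (auto intro!: derivative_eq_intros)
  from has_vector_derivative_of_real[OF this]
  have "((\<lambda>t. of_real ((norm x)\<^sup>2 + 2 * t * x $ k + t\<^sup>2)) has_vector_derivative (of_real (2 * x $ k) :: complex)) (at 0)" .
  then have "((\<lambda>t. - (\<beta> * of_real ((norm x)\<^sup>2 + 2 * t * x $ k + t\<^sup>2))) has_vector_derivative - (\<beta> * of_real (2 * x $ k))) (at 0)"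
    by (intro has_vector_derivative_minus has_vector_derivative_mult_right)
  from field_vector_diff_chain_at[OF this DERIV_exp]
  show ?thesis
    by (simp add: gauss_def norm_axis_line_sq o_def mult_ac)
qed

lemma gauss_moment_bound:
  assumes "b > 0"
  shows "\<exists>C\<ge>0. \<forall>\<beta> (y::real^'d::finite). Re \<beta> \<ge> b \<longrightarrow> cmod (gauss \<beta> y) * (1 + norm y) ^ p \<le> C / (1 + norm y) ^ q"
proof -
  obtain C where C: "C \<ge> 0" "\<And>r. r \<ge> 0 \<Longrightarrow> exp (- b * r\<^sup>2) * (1 + r) ^ (p + q) \<le> C"
  proof -
    from gaussian_weight_bound[OF order_refl assms, of "p + q"] obtain C where C: "C \<ge> 0"
      "\<forall>s r. r \<ge> 0 \<longrightarrow> exp (- b * r\<^sup>2) * exp (0 * (\<bar>s\<bar> * r)) * (1 + r) ^ (p + q) \<le> C * (1 + \<bar>s\<bar>) ^ (p + q) * exp (0\<^sup>2 / (4 * b) * s\<^sup>2)"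
      by blast
    show ?thesis by (rule that[OF C(1)]) (use C(2)[rule_format, of _ 0] in simp)
  qed
  have "cmod (gauss \<beta> y) * (1 + norm y) ^ p \<le> C / (1 + norm y) ^ q" if "Re \<beta> \<ge> b" for \<beta> and y :: "real^'d"
  proof -
    have "cmod (gauss \<beta> y) * (1 + norm y) ^ p * (1 + norm y) ^ q
        \<le> exp (- b * (norm y)\<^sup>2) * (1 + norm y) ^ (p + q)"
      using that unfolding norm_gauss power_add mult.assoc by (intro mult_right_mono) (auto intro: mult_right_mono)
    also have "\<dots> \<le> C" by (rule C) simp
    finally show ?thesis by (simp add: field_simps add_pos_nonneg)
  qed
  with C(1) show ?thesis by blast
qed

lemma norm_times_gauss_bound:
  fixes b :: real
  assumes "b > 0"
  shows "\<exists>C\<ge>0. \<forall>\<beta> (y::real^'d::finite). Re \<beta> \<ge> b \<longrightarrow> cmod (gauss \<beta> y) \<le> C / (1 + norm y) ^ q \<and>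
    norm y * cmod (gauss \<beta> y) \<le> C / (1 + norm y) ^ q \<and> (norm y)\<^sup>2 * cmod (gauss \<beta> y) \<le> C / (1 + norm y) ^ q"
proof -
  obtain C where C: "C \<ge> 0" "\<And>\<beta> (y::real^'d). Re \<beta> \<ge> b \<Longrightarrow> cmod (gauss \<beta> y) * (1 + norm y) ^ 2 \<le> C / (1 + norm y) ^ q"
    using gauss_moment_bound[OF assms, of 2 q] by blast
  have *: "w * cmod (gauss \<beta> y) \<le> C / (1 + norm y) ^ q"
    if "Re \<beta> \<ge> b" "w \<le> (1 + norm y)\<^sup>2" for \<beta> w and y :: "real^'d"
    using order_trans[OF mult_right_mono[OF that(2) norm_ge_zero] C(2)[OF that(1), of y, unfolded mult.commute[of "cmod _"]]] .
  have "cmod (gauss \<beta> y) \<le> C / (1 + norm y) ^ q \<and> norm y * cmod (gauss \<beta> y) \<le> C / (1 + norm y) ^ q \<and>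
      (norm y)\<^sup>2 * cmod (gauss \<beta> y) \<le> C / (1 + norm y) ^ q" if "Re \<beta> \<ge> b" for \<beta> and y :: "real^'d"
    using *[OF that, of 1 y] *[OF that, of "norm y" y] *[OF that, of "(norm y)\<^sup>2" y]
    by (simp add: power2_eq_square algebra_simps add_nonneg_nonneg)
  with C(1) show ?thesis by blast
qed

lemma integrable_gauss:
  assumes "Re \<beta> > 0" shows "integrable lborel (gauss \<beta> :: real^'d::finite \<Rightarrow> complex)"
proof -
  obtain C where C0: "C \<ge> 0" and C':
    "\<forall>\<beta>' (y::real^'d). Re \<beta>' \<ge> Re \<beta> \<longrightarrow> cmod (gauss \<beta>' y) \<le> inv_power C y \<and>
      norm y * cmod (gauss \<beta>' y) \<le> inv_power C y \<and> (norm y)\<^sup>2 * cmod (gauss \<beta>' y) \<le> inv_power C y"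
    using norm_times_gauss_bound[OF assms, where 'd='d and q="CARD('d) + 2"] by blast
  note C = C0 C'[rule_format, THEN conjunct1] C'[rule_format, THEN conjunct2, THEN conjunct1]
    C'[rule_format, THEN conjunct2, THEN conjunct2]
  show ?thesis by (rule integrable_dominated[OF _ C(2)]) (intro continuous_intros order_refl)+
qed

text \<open>The first argument only carries the dimension, which the complex number \<open>\<beta>\<close> does not determine.\<close>

definition gauss_mass :: "'d::finite itself \<Rightarrow> complex \<Rightarrow> complex" where
  "gauss_mass _ \<beta> = (\<integral>y. gauss \<beta> (y :: real^'d) \<partial>lborel)"

text \<open>Integration by parts applied to \<open>y\<^sub>k exp (- \<beta> \<bar>y\<bar>\<^sup>2)\<close>.\<close>

lemma gauss_second_moment:
  assumes "Re \<beta> > 0"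
  shows "(\<integral>y. of_real ((y $ k)\<^sup>2) * gauss \<beta> (y :: real^'d::finite) \<partial>lborel) = gauss_mass TYPE('d) \<beta> / (2 * \<beta>)"
    and "integrable lborel (\<lambda>y :: real^'d::finite. of_real ((y $ k)\<^sup>2) * gauss \<beta> y)"
proof -
  obtain C where C0: "C \<ge> 0" and C':
    "\<forall>\<beta>' (y::real^'d). Re \<beta>' \<ge> Re \<beta> \<longrightarrow> cmod (gauss \<beta>' y) \<le> inv_power C y \<and>
      norm y * cmod (gauss \<beta>' y) \<le> inv_power C y \<and> (norm y)\<^sup>2 * cmod (gauss \<beta>' y) \<le> inv_power C y"
    using norm_times_gauss_bound[OF assms, where 'd='d and q="CARD('d) + 2"] by blast
  note C = C0 C'[rule_format, THEN conjunct1] C'[rule_format, THEN conjunct2, THEN conjunct1]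
    C'[rule_format, THEN conjunct2, THEN conjunct2]
  let ?F = "\<lambda>y::real^'d. of_real (y $ k) * gauss \<beta> y"
  let ?F' = "\<lambda>y::real^'d. gauss \<beta> y - (2 * \<beta>) * (of_real ((y $ k)\<^sup>2) * gauss \<beta> y)"
  let ?w = "\<lambda>y::real^'d. inv_power C y"
  have b1: "cmod (?F y) \<le> ?w y" for y
    using order_trans[OF mult_right_mono[OF component_le_norm_cart[of y k] norm_ge_zero] C(3)[OF order_refl, of y]]
    by (simp add: norm_mult)
  have "(y $ k)\<^sup>2 \<le> (norm y)\<^sup>2" for y :: "real^'d"
    using power_mono[OF component_le_norm_cart[of y k] abs_ge_zero, of 2] by simp
  then have b2: "cmod (of_real ((y $ k)\<^sup>2) * gauss \<beta> y) \<le> ?w y" for y :: "real^'d"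
    using order_trans[OF mult_right_mono[OF _ norm_ge_zero] C(4)[OF order_refl, of y], of "(y $ k)\<^sup>2"]
    by (simp add: norm_mult norm_power)
  show int: "integrable lborel (\<lambda>y :: real^'d. of_real ((y $ k)\<^sup>2) * gauss \<beta> y)"
    by (rule integrable_dominated[OF _ b2]) (intro continuous_intros)
  have "(\<integral>y. ?F' y \<partial>lborel) = 0"
  proof (rule integral_axis_derivative_eq_0)
    show "((\<lambda>t. ?F (x + t *\<^sub>R axis k 1)) has_vector_derivative ?F' x) (at 0)" for x
    proof -
      have "((\<lambda>t. of_real (x $ k + t)) has_vector_derivative (1 :: complex)) (at 0)"
      proof -
        have "((\<lambda>t. x $ k + t) has_real_derivative 1) (at 0)" by (auto intro!: derivative_eq_intros)
        from has_vector_derivative_of_real[OF this] show ?thesis by simp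
      qed
      from has_vector_derivative_mult[OF this gauss_axis_derivative[of \<beta> x k]]
      show ?thesis by (simp add: axis_def power2_eq_square algebra_simps)
    qed
    show "norm (?F x) \<le> inv_power (C + 2 * cmod \<beta> * C) x" for x
      using order_trans[OF b1[of x] divide_right_mono[of C "C + 2 * cmod \<beta> * C"]] C(1) by simp
    show "norm (?F' x) \<le> inv_power (C + 2 * cmod \<beta> * C) x" for x
    proof -
      have "norm (?F' x) \<le> cmod (gauss \<beta> x) + 2 * cmod \<beta> * cmod (of_real ((x $ k)\<^sup>2) * gauss \<beta> x)"
        by (rule order_trans[OF norm_triangle_ineq4]) (simp add: norm_mult)
      also have "\<dots> \<le> ?w x + 2 * cmod \<beta> * ?w x"
        using C(2)[OF order_refl, of x] b2[of x] by (intro add_mono mult_left_mono) auto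
      finally show ?thesis by (simp add: add_divide_distrib)
    qed
  qed (intro continuous_intros)+
  moreover have "(\<integral>y. ?F' y \<partial>lborel) = gauss_mass TYPE('d) \<beta> - 2 * \<beta> * (\<integral>y. of_real ((y $ k)\<^sup>2) * gauss \<beta> (y :: real^'d) \<partial>lborel)"
    using int integrable_gauss[OF assms, where 'd='d] by (simp add: gauss_mass_def)
  moreover have "\<beta> \<noteq> 0" using assms by auto
  ultimately show "(\<integral>y. of_real ((y $ k)\<^sup>2) * gauss \<beta> (y :: real^'d) \<partial>lborel) = gauss_mass TYPE('d) \<beta> / (2 * \<beta>)"
    by (simp add: field_simps)
qed

lemma gauss_mass_derivative:
  assumes "Re (p + of_real s0 * q) > 0"
  shows "((\<lambda>s. gauss_mass TYPE('d::finite) (p + of_real s * q)) has_vector_derivative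
    - (q * of_nat CARD('d) / (2 * (p + of_real s0 * q))) * gauss_mass TYPE('d) (p + of_real s0 * q)) (at s0)"
proof -
  let ?\<beta> = "\<lambda>s. p + of_real s * q"
  define b where "b = Re (?\<beta> s0) / 2"
  (* On the delta-neighbourhood of s0 the real part stays above b, which makes the domination uniform. *)
  define \<delta> where "\<delta> = b / (\<bar>Re q\<bar> + 1)"
  have b: "b > 0" using assms by (simp add: b_def)
  then have \<delta>: "\<delta> > 0" by (simp add: \<delta>_def add_nonneg_pos)
  have near: "Re (?\<beta> s) \<ge> b" if "\<bar>s - s0\<bar> < \<delta>" for s
  proof -
    have "\<bar>s - s0\<bar> * \<bar>Re q\<bar> \<le> \<delta> * (\<bar>Re q\<bar> + 1)" using that by (intro mult_mono) auto
    also have "\<dots> = b" by (simp add: \<delta>_def add_nonneg_pos)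
    finally have "\<bar>(s - s0) * Re q\<bar> \<le> b" by (simp add: abs_mult)
    moreover have "Re (?\<beta> s) = Re (?\<beta> s0) + (s - s0) * Re q" by (simp add: algebra_simps)
    ultimately show ?thesis by (simp add: b_def abs_le_iff)
  qed
  obtain C where C0: "C \<ge> 0" and C':
    "\<forall>\<beta>' (y::real^'d). Re \<beta>' \<ge> b \<longrightarrow> cmod (gauss \<beta>' y) \<le> inv_power C y \<and>
      norm y * cmod (gauss \<beta>' y) \<le> inv_power C y \<and> (norm y)\<^sup>2 * cmod (gauss \<beta>' y) \<le> inv_power C y"
    using norm_times_gauss_bound[OF b, where 'd='d and q="CARD('d) + 2"] by blast
  note C = C0 C'[rule_format, THEN conjunct1] C'[rule_format, THEN conjunct2, THEN conjunct1]
    C'[rule_format, THEN conjunct2, THEN conjunct2]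
  have "((\<lambda>s. \<integral>y. gauss (?\<beta> s) (y::real^'d) \<partial>lborel) has_vector_derivative
      (\<integral>y. - q * (of_real ((norm (y::real^'d))\<^sup>2) * gauss (?\<beta> s0) y) \<partial>lborel)) (at s0)"
  proof (rule has_vector_derivative_integral[OF \<delta>])
    show "((\<lambda>s. gauss (?\<beta> s) y) has_vector_derivative - q * (of_real ((norm y)\<^sup>2) * gauss (?\<beta> s) y)) (at s)"
      for s and y :: "real^'d"
    proof -
      have "((\<lambda>z. exp (- ((p + z * q) * of_real ((norm y)\<^sup>2)))) has_field_derivative
          - q * (of_real ((norm y)\<^sup>2) * exp (- ((p + of_real s * q) * of_real ((norm y)\<^sup>2))))) (at (of_real s))"
        by (auto intro!: derivative_eq_intros)
      from has_vector_derivative_real_field[OF this] show ?thesis by (simp add: gauss_def)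
    qed
    show "norm (- q * (of_real ((norm y)\<^sup>2) * gauss (?\<beta> s) y)) \<le> inv_power (cmod q * C) y"
      if "\<bar>s - s0\<bar> < \<delta>" for s and y :: "real^'d"
      using mult_left_mono[OF C(4)[OF near[OF that], of y], of "cmod q"] by (simp add: norm_mult norm_power)
    show "integrable lborel (gauss (?\<beta> s0) :: real^'d \<Rightarrow> complex)" by (rule integrable_gauss[OF assms])
  qed (intro continuous_intros)+
  moreover have "(\<integral>y. - q * (of_real ((norm (y::real^'d))\<^sup>2) * gauss (?\<beta> s0) y) \<partial>lborel)
      = - q * (\<Sum>k\<in>(UNIV :: 'd set). gauss_mass TYPE('d) (?\<beta> s0) / (2 * ?\<beta> s0))"
  proof -
    have "of_real ((norm y)\<^sup>2) * gauss (?\<beta> s0) y = (\<Sum>k\<in>UNIV. of_real ((y $ k)\<^sup>2) * gauss (?\<beta> s0) y)" for y :: "real^'d"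
      by (simp add: norm_vec_def L2_set_def sum_nonneg sum_distrib_right)
    then show ?thesis
      using gauss_second_moment[OF assms, where 'd = 'd] by simp
  qed
  ultimately show ?thesis by (simp add: gauss_mass_def mult.assoc)
qed

text \<open>By the differential equation of \<open>gauss_mass_derivative\<close> the product of the mass with
\<open>\<beta> powr (d / 2)\<close> is constant along the segment from \<open>1\<close> to \<open>\<beta>\<close>, and at \<open>1\<close> the mass is a positive
number.\<close>

lemma gauss_mass_nonzero:
  assumes "Re \<beta> > 0" shows "gauss_mass TYPE('d::finite) \<beta> \<noteq> 0"
proof -
  let ?\<beta> = "\<lambda>s. 1 + of_real s * (\<beta> - 1)"
  let ?J = "gauss_mass TYPE('d)"
  let ?\<psi> = "\<lambda>s. ?J (?\<beta> s) * exp (of_nat CARD('d) / 2 * Ln (?\<beta> s))"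
  have pos: "Re (?\<beta> s) > 0" if "s \<in> {0..1}" for s
  proof -
    have "Re (?\<beta> s) = (1 - s) + s * Re \<beta>" by (simp add: algebra_simps)
    also have "\<dots> > 0" using that assms by (cases "s = 1") (auto intro: add_pos_nonneg)
    finally show ?thesis .
  qed
  have "(?\<psi> has_vector_derivative 0) (at s within {0..1})" if s: "s \<in> {0..1}" for s
  proof -
    have "?\<beta> s \<notin> \<real>\<^sub>\<le>\<^sub>0" using pos[OF s] by (auto simp: complex_nonpos_Reals_iff)
    moreover have "((\<lambda>z. 1 + z * (\<beta> - 1)) has_field_derivative (\<beta> - 1)) (at (of_real s))"
      by (auto intro!: derivative_eq_intros)
    ultimately have "((\<lambda>z. Ln (1 + z * (\<beta> - 1))) has_field_derivative 1 / ?\<beta> s * (\<beta> - 1)) (at (of_real s))"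
      using DERIV_chain2[OF has_field_derivative_Ln] by (simp add: divide_inverse)
    note 1 = DERIV_chain2[OF DERIV_exp DERIV_cmult[OF this, of "of_nat CARD('d) / 2"]]
    from has_vector_derivative_mult[OF gauss_mass_derivative[OF pos[OF s], where 'd = 'd] has_vector_derivative_real_field[OF 1]]
    show ?thesis by (simp add: mult_ac has_vector_derivative_at_within)
  qed
  then obtain c where c: "\<And>s. s \<in> {0..1} \<Longrightarrow> ?\<psi> s = c"
    using has_vector_derivative_zero_constant[of "{0..1}" ?\<psi>] by auto
  have "?\<psi> 1 = ?\<psi> 0" using c[of 0] c[of 1] by simp
  moreover have "?J 1 \<noteq> 0"
  proof -
    have eq: "gauss 1 y = complex_of_real (exp (- (norm y)\<^sup>2))" for y :: "real^'d"
      by (simp add: gauss_def exp_of_real[symmetric])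
    have "integrable lborel (\<lambda>y::real^'d. exp (- (norm y)\<^sup>2))"
      using integrable_gauss[of 1, where 'd='d] unfolding eq by (simp add: complex_of_real_integrable_eq)
    from integral_pos[OF this] have "(\<integral>y. exp (- (norm (y::real^'d))\<^sup>2) \<partial>lborel) > 0" by simp
    then show ?thesis unfolding gauss_mass_def eq by simp
  qed
  ultimately show ?thesis by auto
qed

lemma gauss_bounds:
  fixes \<beta> :: complex
  assumes "Re \<beta> > 0"
  shows "\<exists>C\<ge>0. \<forall>y::real^'d::finite. cmod (gauss \<beta> y) \<le> inv_power C y \<and>
    norm y * cmod (gauss \<beta> y) \<le> inv_power C y"
proof -
  obtain C where "C \<ge> 0" "\<forall>\<beta>' (y::real^'d). Re \<beta>' \<ge> Re \<beta> \<longrightarrow> cmod (gauss \<beta>' y) \<le> inv_power C y \<and>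
      norm y * cmod (gauss \<beta>' y) \<le> inv_power C y \<and> (norm y)\<^sup>2 * cmod (gauss \<beta>' y) \<le> inv_power C y"
    using norm_times_gauss_bound[OF assms, where 'd='d and q="CARD('d) + 2"] by blast
  then show ?thesis by (intro exI[of _ C]) auto
qed

section \<open>The complex heat flow\<close>

text \<open>The operator \<open>exp (- (s\<^sup>2 / (4 \<beta>)) \<Delta>)\<close>, written as an average of translates of \<open>f\<close> against a fixed
Gaussian. The time is a square because this makes \<open>heat\<close> smooth in \<open>s\<close> at \<open>s = 0\<close>, where the usual
heat kernel is singular.\<close>

definition heat :: "complex \<Rightarrow> real \<Rightarrow> (real^'d::finite \<Rightarrow> complex) \<Rightarrow> real^'d \<Rightarrow> complex" where
  "heat \<beta> s f x = (\<integral>y. gauss \<beta> y * f (x - s *\<^sub>R y) \<partial>lborel) / gauss_mass TYPE('d) \<beta>"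

lemma heat_integrand:
  fixes g :: "real^'d::finite \<Rightarrow> complex"
  assumes "Re \<beta> > 0" "continuous_on UNIV g" "\<And>x. cmod (g x) \<le> D"
  shows "\<exists>C. \<forall>s x y. cmod (gauss \<beta> y * g (x - s *\<^sub>R y)) \<le> inv_power C y"
    and "continuous_on UNIV (\<lambda>y. gauss \<beta> y * g (x - s *\<^sub>R y))"
    and "continuous_on UNIV (\<lambda>x. gauss \<beta> y * g (x - s *\<^sub>R y))"
    and "integrable lborel (\<lambda>y. gauss \<beta> y * g (x - s *\<^sub>R y))"
proof -
  obtain C where C: "\<And>y::real^'d. cmod (gauss \<beta> y) \<le> inv_power C y"
    using gauss_bounds[OF assms(1), where 'd='d] by metis
  have D: "D \<ge> 0" using order_trans[OF norm_ge_zero assms(3)] .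
  have b: "cmod (gauss \<beta> y * g (x - s *\<^sub>R y)) \<le> inv_power (C * D) y" for s x y
    using mult_mono[OF C assms(3) order_trans[OF norm_ge_zero C] norm_ge_zero] by (simp add: norm_mult)
  then show "\<exists>C. \<forall>s x y. cmod (gauss \<beta> y * g (x - s *\<^sub>R y)) \<le> inv_power C y" by blast
  show c: "continuous_on UNIV (\<lambda>y. gauss \<beta> y * g (x - s *\<^sub>R y))"
    by (intro continuous_intros continuous_on_compose2[OF assms(2)]) auto
  show "continuous_on UNIV (\<lambda>x. gauss \<beta> y * g (x - s *\<^sub>R y))"
    by (intro continuous_intros continuous_on_compose2[OF assms(2)]) auto
  show "integrable lborel (\<lambda>y. gauss \<beta> y * g (x - s *\<^sub>R y))"
    by (rule integrable_dominated[OF c b])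
qed

lemma heat_axis_derivative:
  assumes f: "f \<in> exp_schwartz a" and "a \<ge> 0" "Re \<beta> > 0"
  shows "((\<lambda>t. heat \<beta> s f (x + t *\<^sub>R axis i 1)) has_vector_derivative heat \<beta> s (partial_deriv i f) x) (at 0)"
proof -
  note f' = exp_schwartz_partial_deriv[OF f, of i]
  obtain D where D: "\<And>x. cmod (f x) \<le> D" using exp_schwartz_bounded[OF f \<open>a \<ge> 0\<close>] by metis
  obtain D' where D': "\<And>x. cmod (partial_deriv i f x) \<le> D'" using exp_schwartz_bounded[OF f' \<open>a \<ge> 0\<close>] by metis
  note h = heat_integrand[OF \<open>Re \<beta> > 0\<close> exp_schwartz_continuous[OF f] D]
  note h' = heat_integrand[OF \<open>Re \<beta> > 0\<close> exp_schwartz_continuous[OF f'] D']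
  obtain C where C: "\<And>s x y. cmod (gauss \<beta> y * partial_deriv i f (x - s *\<^sub>R y)) \<le> inv_power C y"
    using h'(1) by blast
  have "((\<lambda>t. \<integral>y. gauss \<beta> y * f (x + t *\<^sub>R axis i 1 - s *\<^sub>R y) \<partial>lborel) has_vector_derivative
      (\<integral>y. gauss \<beta> y * partial_deriv i f (x + 0 *\<^sub>R axis i 1 - s *\<^sub>R y) \<partial>lborel)) (at 0)"
  proof (rule has_vector_derivative_integral[OF zero_less_one])
    fix t y
    have "((\<lambda>t. f ((x - s *\<^sub>R y) + t *\<^sub>R axis i 1)) has_vector_derivative partial_deriv i f ((x - s *\<^sub>R y) + t *\<^sub>R axis i 1)) (at t)"
      by (rule has_vector_derivative_along_line[OF exp_schwartz_axis_derivative[OF f]])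
    then show "((\<lambda>t. gauss \<beta> y * f (x + t *\<^sub>R axis i 1 - s *\<^sub>R y)) has_vector_derivative
        gauss \<beta> y * partial_deriv i f (x + t *\<^sub>R axis i 1 - s *\<^sub>R y)) (at t)"
      by (intro has_vector_derivative_mult_right) (simp add: algebra_simps)
  qed (rule h h' C)+
  from has_vector_derivative_mult_left[OF this, of "1 / gauss_mass TYPE('a) \<beta>"]
  show ?thesis by (simp add: heat_def)
qed

lemma heat_continuous:
  assumes f: "f \<in> exp_schwartz a" and "a \<ge> 0" "Re \<beta> > 0"
  shows "continuous_on UNIV (heat \<beta> s f)"
proof -
  obtain D where D: "\<And>x. cmod (f x) \<le> D" using exp_schwartz_bounded[OF f \<open>a \<ge> 0\<close>] by metis
  note h = heat_integrand[OF \<open>Re \<beta> > 0\<close> exp_schwartz_continuous[OF f] D]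
  from h(1) obtain C where "\<And>s x y. cmod (gauss \<beta> y * f (x - s *\<^sub>R y)) \<le> inv_power C y" by blast
  then have "continuous_on UNIV (\<lambda>x. \<integral>y. gauss \<beta> y * f (x - s *\<^sub>R y) \<partial>lborel)"
    by (intro continuous_on_integral h)
  then show ?thesis
    unfolding heat_def by (intro continuous_on_divide) (auto simp: gauss_mass_nonzero[OF \<open>Re \<beta> > 0\<close>])
qed

lemma C_infty_heat:
  assumes "f \<in> exp_schwartz a" "a \<ge> 0" "Re \<beta> > 0"
  shows "C_infty (heat \<beta> s f)"
  by (rule C_infty_coinduct[where S = "heat \<beta> s ` exp_schwartz a"])
    (use assms in \<open>auto intro: heat_continuous intro!: heat_axis_derivative exp_schwartz_partial_deriv\<close>)

lemma iter_partial_heat: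
  assumes "f \<in> exp_schwartz a" "a \<ge> 0" "Re \<beta> > 0"
  shows "iter_partial js (heat \<beta> s f) = heat \<beta> s (iter_partial js f)"
  by (induction js)
    (auto intro!: ext partial_deriv_eqI heat_axis_derivative exp_schwartz_iter_partial assms)

text \<open>The weight is submultiplicative, hence its value at \<open>x\<close> can be distributed over \<open>s y\<close> and \<open>x - s y\<close>.
The second factor is absorbed by the bound on \<open>g\<close>, the first one by the Gaussian.\<close>

lemma heat_weighted_bound:
  assumes "a \<ge> 0" "Re \<beta> > 0"
  shows "\<exists>C\<ge>0. \<exists>N. \<forall>s D (g :: real^'d::finite \<Rightarrow> complex). continuous_on UNIV g \<longrightarrow>
    (\<forall>x. exp (a * norm x) * (1 + norm x) ^ m * cmod (g x) \<le> D) \<longrightarrow>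
    (\<forall>x. exp (a * norm x) * (1 + norm x) ^ m * cmod (heat \<beta> s g x)
      \<le> C * (1 + \<bar>s\<bar>) ^ N * exp (a\<^sup>2 / (4 * Re \<beta>) * s\<^sup>2) * D)"
proof -
  let ?p = "m + (CARD('d) + 2)"
  let ?w = "\<lambda>x::real^'d. exp (a * norm x) * (1 + norm x) ^ m"
  let ?J = "gauss_mass TYPE('d) \<beta>"
  obtain C where C: "C \<ge> 0" "\<And>s r. r \<ge> 0 \<Longrightarrow>
    exp (- Re \<beta> * r\<^sup>2) * exp (a * (\<bar>s\<bar> * r)) * (1 + r) ^ ?p \<le> C * (1 + \<bar>s\<bar>) ^ ?p * exp (a\<^sup>2 / (4 * Re \<beta>) * s\<^sup>2)"
    using gaussian_weight_bound[OF assms, of ?p] by blast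
  let ?I = "\<integral>y. 1 / (1 + norm (y::real^'d)) ^ (CARD('d) + 2) \<partial>lborel"
  have "?w x * cmod (heat \<beta> s g x) \<le> (C * ?I / cmod ?J) * (1 + \<bar>s\<bar>) ^ (m + ?p) * exp (a\<^sup>2 / (4 * Re \<beta>) * s\<^sup>2) * D"
    if g: "continuous_on UNIV g" and D: "\<And>x. ?w x * cmod (g x) \<le> D" for s D x and g :: "real^'d \<Rightarrow> complex"
  proof -
    let ?E = "C * (1 + \<bar>s\<bar>) ^ (m + ?p) * exp (a\<^sup>2 / (4 * Re \<beta>) * s\<^sup>2) * D"
    have "D \<ge> 0" by (rule order_trans[OF _ D[of 0]]) simp
    have w_mult: "?w x \<le> ?w (s *\<^sub>R y) * ?w (x - s *\<^sub>R y)" for x y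
    proof -
      have n: "norm x \<le> norm (s *\<^sub>R y) + norm (x - s *\<^sub>R y)" by (metis norm_triangle_sub add.commute)
      then have "exp (a * norm x) \<le> exp (a * norm (s *\<^sub>R y)) * exp (a * norm (x - s *\<^sub>R y))"
        using mult_left_mono[OF n \<open>a \<ge> 0\<close>] by (simp add: exp_add[symmetric] algebra_simps)
      moreover have "1 + norm x \<le> (1 + norm (s *\<^sub>R y)) * (1 + norm (x - s *\<^sub>R y))"
        using n mult_nonneg_nonneg[OF norm_ge_zero[of "s *\<^sub>R y"] norm_ge_zero[of "x - s *\<^sub>R y"]]
        unfolding distrib_left distrib_right by linarith
      then have "(1 + norm x) ^ m \<le> (1 + norm (s *\<^sub>R y)) ^ m * (1 + norm (x - s *\<^sub>R y)) ^ m"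
        unfolding power_mult_distrib[symmetric] by (intro power_mono) auto
      ultimately have "?w x \<le> (exp (a * norm (s *\<^sub>R y)) * exp (a * norm (x - s *\<^sub>R y)))
          * ((1 + norm (s *\<^sub>R y)) ^ m * (1 + norm (x - s *\<^sub>R y)) ^ m)"
        by (intro mult_mono) auto
      then show ?thesis by (simp add: mult_ac)
    qed
    have pt: "?w x * cmod (gauss \<beta> y * g (x - s *\<^sub>R y)) \<le> ?E * inv_power 1 y" for y
    proof -
      let ?G = "exp (- Re \<beta> * (norm y)\<^sup>2) * exp (a * (\<bar>s\<bar> * norm y))"
      have "1 + \<bar>s\<bar> * norm y \<le> (1 + \<bar>s\<bar>) * (1 + norm y)" by (simp add: algebra_simps)
      then have s1: "(1 + \<bar>s\<bar> * norm y) ^ m \<le> (1 + \<bar>s\<bar>) ^ m * (1 + norm y) ^ m"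
        unfolding power_mult_distrib[symmetric] by (intro power_mono) auto
      have "?w x * cmod (gauss \<beta> y * g (x - s *\<^sub>R y))
          \<le> (?w (s *\<^sub>R y) * ?w (x - s *\<^sub>R y)) * cmod (gauss \<beta> y * g (x - s *\<^sub>R y))"
        by (intro mult_right_mono w_mult) auto
      also have "\<dots> = (?G * (1 + \<bar>s\<bar> * norm y) ^ m) * (?w (x - s *\<^sub>R y) * cmod (g (x - s *\<^sub>R y)))"
        by (simp add: norm_mult norm_gauss mult_ac)
      also have "\<dots> \<le> (?G * ((1 + \<bar>s\<bar>) ^ m * (1 + norm y) ^ m)) * D"
        by (intro mult_mono mult_left_mono s1 D) auto
      also have "\<dots> = ((1 + \<bar>s\<bar>) ^ m * D) * (?G * (1 + norm y) ^ m)" by (simp add: mult_ac)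
      also have "?G * (1 + norm y) ^ m = inv_power (?G * (1 + norm y) ^ ?p) y"
      proof -
        have "1 + norm y \<noteq> 0" by (metis add_pos_nonneg less_irrefl norm_ge_zero zero_less_one)
        then show ?thesis by (simp only: power_add) simp
      qed
      also have "((1 + \<bar>s\<bar>) ^ m * D) * \<dots> \<le> ((1 + \<bar>s\<bar>) ^ m * D) *
          ((C * (1 + \<bar>s\<bar>) ^ ?p * exp (a\<^sup>2 / (4 * Re \<beta>) * s\<^sup>2)) / (1 + norm y) ^ (CARD('d) + 2))"
        using \<open>D \<ge> 0\<close> by (intro mult_left_mono divide_right_mono C) auto
      also have "\<dots> = ?E * inv_power 1 y"
        by (simp only: power_add[of _ m ?p]) (simp add: mult_ac)
      finally show ?thesis .
    qed
    have intw: "integrable lborel (\<lambda>y::real^'d. ?E * inv_power 1 y)"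
      by (intro integrable_mult_right integrable_inverse_power_norm)
    have "?w x * cmod (\<integral>y. gauss \<beta> y * g (x - s *\<^sub>R y) \<partial>lborel)
        = cmod (\<integral>y. of_real (?w x) * (gauss \<beta> y * g (x - s *\<^sub>R y)) \<partial>lborel)"
      by (subst integral_mult_right_zero) (simp only: norm_mult norm_of_real, simp)
    also have "\<dots> \<le> (\<integral>y. cmod (of_real (?w x) * (gauss \<beta> y * g (x - s *\<^sub>R y))) \<partial>lborel)"
      by (rule integral_norm_bound)
    also have "\<dots> \<le> (\<integral>y. ?E * (1 / (1 + norm (y::real^'d)) ^ (CARD('d) + 2)) \<partial>lborel)"
    proof (rule Bochner_Integration.integral_mono'[OF intw])
      show "cmod (of_real (?w x) * (gauss \<beta> y * g (x - s *\<^sub>R y))) \<le> ?E * inv_power 1 y" for y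
        using pt[of y] by (simp only: norm_mult norm_of_real abs_mult abs_exp_cancel) (simp add: norm_mult)
      show "0 \<le> ?E * inv_power 1 y" for y :: "real^'d"
        by (rule order_trans[OF _ pt[of y]]) simp
    qed
    also have "\<dots> = ?E * ?I" by (rule integral_mult_right_zero)
    finally have "?w x * cmod (\<integral>y. gauss \<beta> y * g (x - s *\<^sub>R y) \<partial>lborel) / cmod ?J \<le> ?E * ?I / cmod ?J"
      by (intro divide_right_mono) auto
    then show ?thesis by (simp add: heat_def norm_divide mult_ac)
  qed
  moreover have "C * ?I / cmod ?J \<ge> 0"
    using C(1) by (intro divide_nonneg_nonneg mult_nonneg_nonneg Bochner_Integration.integral_nonneg) auto
  ultimately show ?thesis by blast
qed

lemma heat_in_exp_schwartz:
  assumes "f \<in> exp_schwartz a" "a \<ge> 0" "Re \<beta> > 0"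
  shows "heat \<beta> s f \<in> exp_schwartz a"
  unfolding exp_schwartz_iff
proof (intro conjI allI)
  show "C_infty (heat \<beta> s f)" by (rule C_infty_heat[OF assms])
  fix m js
  obtain C N where *: "\<forall>s D (g :: real^'a \<Rightarrow> complex). continuous_on UNIV g \<longrightarrow>
    (\<forall>x. exp (a * norm x) * (1 + norm x) ^ m * cmod (g x) \<le> D) \<longrightarrow>
    (\<forall>x. exp (a * norm x) * (1 + norm x) ^ m * cmod (heat \<beta> s g x)
      \<le> C * (1 + \<bar>s\<bar>) ^ N * exp (a\<^sup>2 / (4 * Re \<beta>) * s\<^sup>2) * D)"
    using heat_weighted_bound[OF assms(2,3), of m] by blast
  obtain D where "\<forall>x. exp (a * norm x) * (1 + norm x) ^ m * cmod (iter_partial js f x) \<le> D"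
    using assms(1) unfolding exp_schwartz_iff by blast
  with * exp_schwartz_continuous[OF exp_schwartz_iter_partial[OF assms(1), of js]]
  show "\<exists>C. \<forall>x. exp (a * norm x) * (1 + norm x) ^ m * cmod (iter_partial js (heat \<beta> s f) x) \<le> C"
    unfolding iter_partial_heat[OF assms] by blast
qed

lemma heat_0:
  assumes "Re \<beta> > 0" shows "heat \<beta> 0 f = f"
  using gauss_mass_nonzero[OF assms, where 'd='a] by (simp add: heat_def gauss_mass_def fun_eq_iff)

lemma laplacian_heat_integral:
  fixes f :: "real^'d::finite \<Rightarrow> complex"
  assumes "f \<in> exp_schwartz a" "a \<ge> 0" "Re \<beta> > 0"
  shows "(\<integral>y. gauss \<beta> y * laplacian f (x - s *\<^sub>R y) \<partial>lborel)
    = - (\<Sum>i\<in>UNIV. \<integral>y. gauss \<beta> y * partial_deriv i (partial_deriv i f) (x - s *\<^sub>R y) \<partial>lborel)"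
proof -
  have "integrable lborel (\<lambda>y. gauss \<beta> y * partial_deriv i (partial_deriv i f) (x - s *\<^sub>R y))" for i
  proof -
    have g: "partial_deriv i (partial_deriv i f) \<in> exp_schwartz a" by (intro exp_schwartz_partial_deriv assms)
    from exp_schwartz_bounded[OF this \<open>a \<ge> 0\<close>] obtain D where "\<And>x. cmod (partial_deriv i (partial_deriv i f) x) \<le> D" by metis
    from heat_integrand(4)[OF \<open>Re \<beta> > 0\<close> exp_schwartz_continuous[OF g] this] show ?thesis .
  qed
  then show ?thesis by (simp add: laplacian_def sum_distrib_left)
qed

lemma laplacian_heat:
  assumes "f \<in> exp_schwartz a" "a \<ge> 0" "Re \<beta> > 0"
  shows "laplacian (heat \<beta> s f) = heat \<beta> s (laplacian f)"
proof
  fix x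
  have "partial_deriv i (partial_deriv i (heat \<beta> s f)) = heat \<beta> s (partial_deriv i (partial_deriv i f))" for i
    using iter_partial_heat[OF assms, of "[i, i]"] by simp
  then show "laplacian (heat \<beta> s f) x = heat \<beta> s (laplacian f) x"
    by (simp add: laplacian_def[of "heat \<beta> s f"] heat_def laplacian_heat_integral[OF assms] sum_divide_distrib)
qed

text \<open>The factor \<open>y\<^sub>i\<close> that differentiation in \<open>s\<close> produces is, up to a constant, the derivative of the
Gaussian. Moving this derivative to \<open>g\<close> yields the factor \<open>s\<close> and turns a first order expression
into the Laplacian (\<open>heat_time_derivative\<close>).\<close>

lemma heat_integration_by_parts:
  assumes g: "g \<in> exp_schwartz a" and "a \<ge> 0" "Re \<beta> > 0"
  shows "(\<integral>y. of_real (y $ i) * (gauss \<beta> y * g (x - s *\<^sub>R y)) \<partial>lborel)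
    = - (of_real s / (2 * \<beta>)) * (\<integral>y. gauss \<beta> y * partial_deriv i g (x - s *\<^sub>R y) \<partial>lborel)" (is "?L = ?R")
    and "integrable lborel (\<lambda>y. of_real (y $ i) * (gauss \<beta> y * g (x - s *\<^sub>R y)))"
proof -
  note g' = exp_schwartz_partial_deriv[OF g, of i]
  obtain D where D: "D \<ge> 0" "\<And>x. cmod (g x) \<le> D" using exp_schwartz_bounded[OF g \<open>a \<ge> 0\<close>] by blast
  obtain D' where D': "D' \<ge> 0" "\<And>x. cmod (partial_deriv i g x) \<le> D'" using exp_schwartz_bounded[OF g' \<open>a \<ge> 0\<close>] by blast
  obtain C where C: "C \<ge> 0" "\<And>y::real^'a. cmod (gauss \<beta> y) \<le> inv_power C y"
    "\<And>y::real^'a. norm y * cmod (gauss \<beta> y) \<le> inv_power C y"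
    using gauss_bounds[OF \<open>Re \<beta> > 0\<close>] by metis
  let ?w = "\<lambda>y::real^'a. inv_power 1 y"
  let ?F = "\<lambda>y. gauss \<beta> y * g (x - s *\<^sub>R y)"
  let ?F1 = "\<lambda>y. of_real (y $ i) * (gauss \<beta> y * g (x - s *\<^sub>R y))"
  let ?F2 = "\<lambda>y. gauss \<beta> y * partial_deriv i g (x - s *\<^sub>R y)"
  let ?F' = "\<lambda>y. - (2 * \<beta>) * ?F1 y - of_real s * ?F2 y"
  note cont = exp_schwartz_continuous[OF g] exp_schwartz_continuous[OF g']
  note h = heat_integrand[OF \<open>Re \<beta> > 0\<close> cont(1) D(2)] and h' = heat_integrand[OF \<open>Re \<beta> > 0\<close> cont(2) D'(2)]
  have bF: "cmod (?F y) \<le> C * D * ?w y" for y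
    using mult_mono[OF C(2)[of y] D(2)[of "x - s *\<^sub>R y"]] C(1) by (simp add: norm_mult)
  have bF2: "cmod (?F2 y) \<le> C * D' * ?w y" for y
    using mult_mono[OF C(2)[of y] D'(2)[of "x - s *\<^sub>R y"]] C(1) by (simp add: norm_mult)
  have bF1: "cmod (?F1 y) \<le> C * D * ?w y" for y
  proof -
    have "cmod (?F1 y) = (\<bar>y $ i\<bar> * cmod (gauss \<beta> y)) * cmod (g (x - s *\<^sub>R y))" by (simp add: norm_mult)
    also have "\<dots> \<le> inv_power C y * D"
      using C(1) order_trans[OF mult_right_mono[OF component_le_norm_cart[of y i] norm_ge_zero] C(3)[of y]]
      by (intro mult_mono D) auto
    finally show ?thesis by simp
  qed
  have cF1: "continuous_on UNIV ?F1" by (intro continuous_intros h(2))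
  show int1: "integrable lborel ?F1" by (rule integrable_dominated[OF cF1, of "C * D"]) (use bF1 in simp)
  have "(\<integral>y. ?F' y \<partial>lborel) = 0"
  proof (rule integral_axis_derivative_eq_0)
    let ?B = "C * D + (2 * cmod \<beta> * (C * D) + \<bar>s\<bar> * (C * D'))"
    show "((\<lambda>t. ?F (y + t *\<^sub>R axis i 1)) has_vector_derivative ?F' y) (at 0)" for y
    proof -
      have "((\<lambda>t. - s * t) has_vector_derivative - s) (at 0)"
        by (auto intro!: derivative_eq_intros simp: has_real_derivative_iff_has_vector_derivative[symmetric])
      moreover have "((\<lambda>t. g ((x - s *\<^sub>R y) + t *\<^sub>R axis i 1)) has_vector_derivative partial_deriv i g (x - s *\<^sub>R y)) (at (- s * 0))"
        using exp_schwartz_axis_derivative[OF g, of "x - s *\<^sub>R y" i] by simp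
      ultimately have "((\<lambda>t. g ((x - s *\<^sub>R y) + (- s * t) *\<^sub>R axis i 1)) has_vector_derivative (- s) *\<^sub>R partial_deriv i g (x - s *\<^sub>R y)) (at 0)"
        by (rule vector_diff_chain_at[unfolded o_def])
      note d = has_vector_derivative_mult[OF gauss_axis_derivative[of \<beta> y i] this]
      have "x - s *\<^sub>R (y + t *\<^sub>R axis i 1) = (x - s *\<^sub>R y) + (- s * t) *\<^sub>R axis i 1" for t
        by (simp add: algebra_simps)
      then show ?thesis
        using has_vector_derivative_eq_rhs[OF d, of "?F' y"] by (simp add: algebra_simps scaleR_conv_of_real[of _ "_ :: complex"])
    qed
    show "continuous_on UNIV ?F" by (rule h(2))
    show "continuous_on UNIV ?F'" by (intro continuous_intros cF1 h'(2))
    have mono: "u * ?w y \<le> ?B / (1 + norm y) ^ (CARD('a) + 2)" if "u \<le> ?B" for u and y :: "real^'a"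
      using divide_right_mono[OF that, of "(1 + norm y) ^ (CARD('a) + 2)"] by simp
    have CD: "C * D \<ge> 0" "C * D' \<ge> 0" using C(1) D(1) D'(1) by auto
    show "norm (?F y) \<le> ?B / (1 + norm y) ^ (CARD('a) + 2)" for y
      by (rule order_trans[OF bF mono]) (use CD in simp)
    show "norm (?F' y) \<le> ?B / (1 + norm y) ^ (CARD('a) + 2)" for y
    proof -
      have "norm (?F' y) \<le> 2 * cmod \<beta> * cmod (?F1 y) + \<bar>s\<bar> * cmod (?F2 y)"
        by (rule order_trans[OF norm_triangle_ineq4]) (simp add: norm_mult)
      also have "\<dots> \<le> 2 * cmod \<beta> * (C * D * ?w y) + \<bar>s\<bar> * (C * D' * ?w y)"
        by (intro add_mono mult_left_mono bF1 bF2) auto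
      also have "\<dots> = (2 * cmod \<beta> * (C * D) + \<bar>s\<bar> * (C * D')) * ?w y"
        by (simp only: distrib_right mult.assoc)
      also have "\<dots> \<le> ?B / (1 + norm y) ^ (CARD('a) + 2)" by (rule mono) (use CD in simp)
      finally show ?thesis .
    qed
  qed
  moreover have "(\<integral>y. ?F' y \<partial>lborel) = - (2 * \<beta>) * ?L - of_real s * (\<integral>y. ?F2 y \<partial>lborel)"
    using int1 h'(4) by simp
  moreover have "\<beta> \<noteq> 0" using assms by auto
  ultimately show "?L = ?R" by (simp add: field_simps add_eq_0_iff)
qed

lemma heat_time_derivative:
  fixes f :: "real^'d::finite \<Rightarrow> complex"
  assumes f: "f \<in> exp_schwartz a" and "a \<ge> 0" "Re \<beta> > 0"
  shows "((\<lambda>s. heat \<beta> s f x) has_vector_derivative - (of_real s / (2 * \<beta>)) * heat \<beta> s (laplacian f) x) (at s)"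
proof -
  note f' = exp_schwartz_partial_deriv[OF f]
  obtain D where D: "\<And>x. cmod (f x) \<le> D" using exp_schwartz_bounded[OF f \<open>a \<ge> 0\<close>] by metis
  have "\<forall>i. \<exists>D. \<forall>x. cmod (partial_deriv i f x) \<le> D" using exp_schwartz_bounded[OF f' \<open>a \<ge> 0\<close>] by metis
  then obtain D' where D': "\<And>i x. cmod (partial_deriv i f x) \<le> D' i" by metis
  obtain C where C: "C \<ge> 0"
    "\<And>y::real^'d. cmod (gauss \<beta> y) \<le> inv_power C y"
    "\<And>y::real^'d. norm y * cmod (gauss \<beta> y) \<le> inv_power C y"
    using gauss_bounds[OF \<open>Re \<beta> > 0\<close>] by metis
  note h = heat_integrand[OF \<open>Re \<beta> > 0\<close> exp_schwartz_continuous[OF f] D]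
  let ?F' = "\<lambda>s y. gauss \<beta> y * - (\<Sum>i\<in>UNIV. (y $ i) *\<^sub>R partial_deriv i f (x - s *\<^sub>R y))"
  have "((\<lambda>s. \<integral>y. gauss \<beta> y * f (x - s *\<^sub>R y) \<partial>lborel) has_vector_derivative (\<integral>y. ?F' s y \<partial>lborel)) (at s)"
  proof (rule has_vector_derivative_integral[OF zero_less_one])
    show "((\<lambda>s. gauss \<beta> y * f (x - s *\<^sub>R y)) has_vector_derivative ?F' s y) (at s)" for s y
      by (intro has_vector_derivative_mult_right C_infty_derivative_along_ray exp_schwartz_C_infty[OF f])
    show "norm (?F' s y) \<le> inv_power (C * (\<Sum>i\<in>UNIV. D' i)) y" for s y
    proof -
      have "cmod (\<Sum>i\<in>UNIV. (y $ i) *\<^sub>R partial_deriv i f (x - s *\<^sub>R y)) \<le> norm y * (\<Sum>i\<in>UNIV. D' i)"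
        unfolding sum_distrib_left by (rule sum_norm_le) (auto intro!: mult_mono D' component_le_norm_cart)
      then have "norm (?F' s y) \<le> cmod (gauss \<beta> y) * (norm y * (\<Sum>i\<in>UNIV. D' i))"
        by (simp only: norm_mult norm_minus_cancel mult_left_mono norm_ge_zero)
      also have "\<dots> = (norm y * cmod (gauss \<beta> y)) * (\<Sum>i\<in>UNIV. D' i)" by simp
      also have "\<dots> \<le> inv_power C y * (\<Sum>i\<in>UNIV. D' i)"
        by (intro mult_right_mono C sum_nonneg order_trans[OF norm_ge_zero D'])
      finally show ?thesis by simp
    qed
    show "continuous_on UNIV (?F' s)"
      by (intro continuous_intros continuous_on_compose2[OF exp_schwartz_continuous[OF f']]) auto
  qed (rule h)+
  also have "(\<integral>y. ?F' s y \<partial>lborel) = - (\<Sum>i\<in>UNIV. \<integral>y. of_real (y $ i) * (gauss \<beta> y * partial_deriv i f (x - s *\<^sub>R y)) \<partial>lborel)"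
  proof -
    have "?F' s y = - (\<Sum>i\<in>UNIV. of_real (y $ i) * (gauss \<beta> y * partial_deriv i f (x - s *\<^sub>R y)))" for y
      by (simp add: sum_distrib_left scaleR_conv_of_real mult_ac)
    then show ?thesis
      using heat_integration_by_parts(2)[OF f' \<open>a \<ge> 0\<close> \<open>Re \<beta> > 0\<close>] by simp
  qed
  also have "\<dots> = (of_real s / (2 * \<beta>)) * (\<Sum>i\<in>UNIV. \<integral>y. gauss \<beta> y * partial_deriv i (partial_deriv i f) (x - s *\<^sub>R y) \<partial>lborel)"
    unfolding heat_integration_by_parts(1)[OF f' \<open>a \<ge> 0\<close> \<open>Re \<beta> > 0\<close>] by (simp add: sum_negf sum_distrib_left)
  also have "\<dots> = - (of_real s / (2 * \<beta>)) * (\<integral>y. gauss \<beta> y * laplacian f (x - s *\<^sub>R y) \<partial>lborel)"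
    by (simp add: laplacian_heat_integral[OF assms])
  finally have "((\<lambda>s. \<integral>y. gauss \<beta> y * f (x - s *\<^sub>R y) \<partial>lborel) has_vector_derivative
      - (of_real s / (2 * \<beta>)) * (\<integral>y. gauss \<beta> y * laplacian f (x - s *\<^sub>R y) \<partial>lborel)) (at s)" .
  from has_vector_derivative_mult_left[OF this, of "1 / gauss_mass TYPE('d) \<beta>"]
  show ?thesis by (simp add: heat_def)
qed

section \<open>Evolutions generated by a shift recurrence\<close>

lemma norm_exp_series_le:
  fixes c :: "nat \<Rightarrow> complex"
  assumes "\<And>n. cmod (c n) \<le> M * R ^ n" "R \<ge> 0"
  shows "summable (\<lambda>n. c n / fact n * w ^ n)" and "cmod (\<Sum>n. c n / fact n * w ^ n) \<le> M * exp (R * cmod w)"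
proof -
  have s: "(\<lambda>n. M * ((R * cmod w) ^ n /\<^sub>R fact n)) sums (M * exp (R * cmod w))"
    by (intro sums_mult exp_converges)
  have le: "cmod (c n / fact n * w ^ n) \<le> M * ((R * cmod w) ^ n /\<^sub>R fact n)" for n
  proof -
    have "cmod (c n / fact n * w ^ n) = cmod (c n) * (cmod w ^ n / fact n)"
      by (simp add: norm_mult norm_divide norm_power)
    also have "\<dots> \<le> (M * R ^ n) * (cmod w ^ n / fact n)"
      by (intro mult_right_mono assms) auto
    also have "\<dots> = M * ((R * cmod w) ^ n /\<^sub>R fact n)"
      by (simp add: power_mult_distrib divide_inverse mult_ac)
    finally show ?thesis .
  qed
  show "summable (\<lambda>n. c n / fact n * w ^ n)"
    by (rule summable_comparison_test'[OF sums_summable[OF s]]) (use le in auto)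
  show "cmod (\<Sum>n. c n / fact n * w ^ n) \<le> M * exp (R * cmod w)"
    using norm_suminf_le[OF le sums_summable[OF s]] sums_unique[OF s] by simp
qed

text \<open>The formal solution \<open>exp (- B w \<sigma>) c\<close>, where \<open>\<sigma>\<close> shifts sequences to the left.\<close>

definition evolution :: "complex \<Rightarrow> (nat \<Rightarrow> complex) \<Rightarrow> nat \<Rightarrow> complex \<Rightarrow> complex" where
  "evolution B c k w = (\<Sum>n. ((- B) ^ n * c (k + n)) / fact n * w ^ n)"

lemma evolution_0: "evolution B c k 0 = c k"
  unfolding evolution_def by (subst suminf_finite[of "{0}"]) auto

lemma evolution_derivative:
  assumes "\<And>n. cmod (c n) \<le> M"
  shows "(evolution B c k has_field_derivative - B * evolution B c (k + 1) w) (at w)"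
proof -
  let ?a = "\<lambda>k n. ((- B) ^ n * c (k + n)) / fact n"
  have le: "cmod ((- B) ^ n * c (k + n)) \<le> M * cmod B ^ n" for n k
    using mult_right_mono[OF assms, of "cmod B ^ n" "k + n"] by (simp add: norm_mult norm_power mult_ac)
  have sm: "summable (\<lambda>n. ?a k n * w ^ n)" for k w
    using norm_exp_series_le(1)[OF le norm_ge_zero] .
  have "diffs (?a k) n = - B * ?a (k + 1) n" for n
    by (simp add: diffs_def divide_simps del: of_nat_Suc)
  then have "(\<Sum>n. diffs (?a k) n * w ^ n) = - B * evolution B c (k + 1) w"
    unfolding evolution_def using suminf_mult[OF sm[of "k + 1" w], of "- B"] by (simp add: mult.assoc)
  then show ?thesis
    using termdiffs_strong_converges_everywhere[OF sm, of k w] by (simp add: evolution_def[abs_def])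
qed

text \<open>The difference \<open>D\<^sub>k\<close> of both sides satisfies \<open>D\<^sub>k' = - 2 s B D\<^sub>k\<^sub>+\<^sub>1\<close> and \<open>D\<^sub>k 0 = 0\<close>. A bound that
holds for all \<open>k\<close> improves by one integration to \<open>M' (\<bar>B\<bar> s\<^sup>2) ^ m / m!\<close> for every \<open>m\<close>, which
tends to \<open>0\<close>.\<close>

lemma evolution_unique:
  fixes h :: "nat \<Rightarrow> real \<Rightarrow> complex"
  assumes der: "\<And>k s. (h k has_vector_derivative - (2 * of_real s * B) * h (k + 1) s) (at s)"
    and bnd: "\<And>k s. cmod (h k s) \<le> M" and s: "s \<ge> 0"
  shows "h k s = evolution B (\<lambda>n. h n 0) k (of_real (s\<^sup>2))"
proof -
  let ?G = "\<lambda>k s. evolution B (\<lambda>n. h n 0) k (of_real (s\<^sup>2))"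
  have M: "M \<ge> 0" using order_trans[OF norm_ge_zero bnd[of 0 0]] .
  let ?D = "\<lambda>k s. h k s - ?G k s"
  have G': "(?G k has_vector_derivative - (2 * of_real s * B) * ?G (k + 1) s) (at s)" for k s
  proof -
    have "((\<lambda>z. z\<^sup>2) has_field_derivative 2 * of_real s) (at (of_real s :: complex))"
      by (auto intro!: derivative_eq_intros)
    from DERIV_chain2[OF evolution_derivative[of "\<lambda>n. h n 0" M B k, OF bnd] this]
    have "((\<lambda>z. evolution B (\<lambda>n. h n 0) k (z\<^sup>2)) has_field_derivative - (2 * of_real s * B) * ?G (k + 1) s) (at (of_real s))"
      by (simp add: mult_ac)
    from has_vector_derivative_real_field[OF this] show ?thesis by simp
  qed
  have D': "(?D k has_vector_derivative - (2 * of_real s * B) * ?D (k + 1) s) (at s)" for k s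
    by (rule has_vector_derivative_eq_rhs[OF has_vector_derivative_diff[OF der G']]) (simp add: algebra_simps)
  define M' where "M' = M + M * exp (cmod B * s\<^sup>2)"
  have D0: "cmod (?D k \<sigma>) \<le> M'" if "\<sigma> \<in> {0..s}" for k \<sigma>
  proof -
    have "cmod ((- B) ^ n * h (k + n) 0) \<le> M * cmod B ^ n" for n
      using mult_right_mono[OF bnd, of "cmod B ^ n" "k + n" 0] by (simp add: norm_mult norm_power mult_ac)
    from norm_exp_series_le(2)[OF this norm_ge_zero, of "of_real (\<sigma>\<^sup>2)"]
    have "cmod (?G k \<sigma>) \<le> M * exp (cmod B * \<sigma>\<^sup>2)" by (simp add: evolution_def norm_power)
    also have "\<dots> \<le> M * exp (cmod B * s\<^sup>2)"
      using that M by (intro mult_left_mono) (auto intro!: mult_left_mono power_mono)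
    finally show ?thesis unfolding M'_def
      by (intro order_trans[OF norm_triangle_ineq4 add_mono[OF bnd]])
  qed
  have Dm: "\<sigma> \<in> {0..s} \<Longrightarrow> cmod (?D k \<sigma>) \<le> M' * ((cmod B * \<sigma>\<^sup>2) ^ m / fact m)" for k \<sigma> m
  proof (induction m arbitrary: k \<sigma>)
    case 0
    then show ?case using D0 by simp
  next
    case (Suc m)
    let ?\<phi> = "\<lambda>\<sigma>. M' * ((cmod B * \<sigma>\<^sup>2) ^ Suc m / fact (Suc m))"
    let ?\<phi>' = "\<lambda>\<sigma>. 2 * \<sigma> * cmod B * (M' * ((cmod B * \<sigma>\<^sup>2) ^ m / fact m))"
    show ?case
    proof (cases "\<sigma> = 0")
      case True
      then show ?thesis by (simp add: evolution_0)
    next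
      case False
      have phi': "(?\<phi> has_vector_derivative ?\<phi>' \<sigma>) (at \<sigma>)" for \<sigma>
      proof -
        have "((\<lambda>\<sigma>. M' / fact (Suc m) * (cmod B * \<sigma>\<^sup>2) ^ Suc m) has_real_derivative
            M' / fact (Suc m) * (of_nat (Suc m) * (cmod B * (2 * \<sigma>)) * (cmod B * \<sigma>\<^sup>2) ^ m)) (at \<sigma>)"
          by (auto intro!: derivative_eq_intros simp del: of_nat_Suc power_Suc)
        moreover have "M' / fact (Suc m) * (of_nat (Suc m) * (cmod B * (2 * \<sigma>)) * (cmod B * \<sigma>\<^sup>2) ^ m) = ?\<phi>' \<sigma>"
          by (simp add: field_simps del: of_nat_Suc)
        ultimately have "((\<lambda>\<sigma>. M' / fact (Suc m) * (cmod B * \<sigma>\<^sup>2) ^ Suc m) has_real_derivative ?\<phi>' \<sigma>) (at \<sigma>)"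
          by (rule DERIV_cong)
        moreover have "?\<phi> = (\<lambda>\<sigma>. M' / fact (Suc m) * (cmod B * \<sigma>\<^sup>2) ^ Suc m)"
          by (simp only: times_divide_eq_left times_divide_eq_right)
        ultimately show ?thesis
          by (simp only: has_real_derivative_iff_has_vector_derivative)
      qed
      have "norm (?D k \<sigma> - ?D k 0) \<le> ?\<phi> \<sigma> - ?\<phi> 0"
      proof (rule differentiable_bound_general[OF _ _ _ D' phi'])
        show "0 < \<sigma>" using Suc.prems False by simp
        show "continuous_on {0..\<sigma>} (?D k)"
          using D' by (intro continuous_at_imp_continuous_on ballI has_vector_derivative_continuous)
        show "continuous_on {0..\<sigma>} ?\<phi>"
          by (intro continuous_intros) simp
        show "norm (- (2 * of_real x * B) * ?D (k + 1) x) \<le> ?\<phi>' x" if "0 < x" "x < \<sigma>" for x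
        proof -
          have "cmod (?D (k + 1) x) \<le> M' * ((cmod B * x\<^sup>2) ^ m / fact m)"
            using that Suc.prems by (intro Suc.IH) auto
          from mult_left_mono[OF this, of "2 * x * cmod B"] that
          show ?thesis by (simp add: norm_mult)
        qed
      qed
      then show ?thesis by (simp add: evolution_0)
    qed
  qed
  have "(\<lambda>m. M' * ((cmod B * s\<^sup>2) ^ m / fact m)) \<longlonglongrightarrow> M' * 0"
    using summable_LIMSEQ_zero[OF summable_exp_generic[of "cmod B * s\<^sup>2"]]
    by (intro tendsto_mult tendsto_const) (simp add: divide_inverse mult.commute)
  then have "cmod (?D k s) \<le> 0"
    using Dm[of s k] s by (intro LIMSEQ_le_const[of _ _ "cmod (?D k s)"]) auto
  then show ?thesis by simp
qed

text \<open>The Taylor coefficients of \<open>evolution B c 0\<close> at \<open>z\<close> are \<open>(- B) ^ n evolution B c n z / n!\<close>: a bound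
that is uniform in the index at a single point \<open>z\<close> controls the function everywhere.\<close>

lemma evolution_taylor_bound:
  assumes c: "\<And>n. cmod (c n) \<le> M" and P: "\<And>k. cmod (evolution B c k z) \<le> P"
  shows "cmod (evolution B c 0 w) \<le> P * exp (cmod B * cmod (w - z))"
proof -
  note d = evolution_derivative[OF c]
  have hol: "evolution B c k holomorphic_on S" for k S
    by (rule holomorphic_on_subset[of _ UNIV]) (auto intro: d simp: holomorphic_on_open)
  have ders: "(deriv ^^ n) (evolution B c 0) = (\<lambda>w. (- B) ^ n * evolution B c n w)" for n
  proof (induction n)
    case (Suc n)
    have "((\<lambda>w. (- B) ^ n * evolution B c n w) has_field_derivative (- B) ^ Suc n * evolution B c (Suc n) w) (at w)" for w
      by (rule DERIV_cong[OF DERIV_cmult[OF d]]) (simp add: mult_ac)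
    then show ?case by (auto simp: Suc.IH intro!: DERIV_imp_deriv)
  qed simp
  have "w \<in> ball z (cmod (w - z) + 1)" by (simp add: dist_norm norm_minus_commute)
  from holomorphic_power_series[OF hol this, of 0]
  have "(\<lambda>n. (- B) ^ n * evolution B c n z / fact n * (w - z) ^ n) sums evolution B c 0 w"
    by (simp add: ders)
  moreover have "cmod ((- B) ^ n * evolution B c n z) \<le> P * cmod B ^ n" for n
    using mult_right_mono[OF P[of n], of "cmod B ^ n"] by (simp add: norm_mult norm_power mult_ac)
  from norm_exp_series_le(2)[OF this norm_ge_zero]
  have "cmod (\<Sum>n. (- B) ^ n * evolution B c n z / fact n * (w - z) ^ n) \<le> P * exp (cmod B * cmod (w - z))" .
  ultimately show ?thesis by (simp add: sums_iff)
qed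

text \<open>Polynomial growth makes \<open>f\<close> a polynomial, and a nonconstant polynomial is unbounded on every ray.\<close>

lemma entire_polynomial_growth_const:
  assumes hol: "f holomorphic_on UNIV"
    and growth: "\<And>z. cmod (f z) \<le> K * (1 + cmod z) ^ n"
    and ray: "\<And>u::real. u \<ge> 0 \<Longrightarrow> cmod (f (- of_real u)) \<le> L"
  shows "f z = f 0"
proof -
  let ?c = "\<lambda>k. (deriv ^^ k) f 0 / fact k"
  have K: "K \<ge> 0" using order_trans[OF norm_ge_zero growth[of 0]] by simp
  have poly: "f z = (\<Sum>k\<le>n. ?c k * z ^ k)" for z
  proof (rule Liouville_polynomial[OF hol, of 1 "K * 2 ^ n"])
    fix z :: complex assume "1 \<le> cmod z"
    then have "(1 + cmod z) ^ n \<le> (2 * cmod z) ^ n" by (intro power_mono) auto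
    from order_trans[OF growth mult_left_mono[OF this K]]
    show "cmod (f z) \<le> K * 2 ^ n * cmod z ^ n" by (simp only: power_mult_distrib mult.assoc)
  qed
  have "?c k = 0" if "1 \<le> k" "k \<le> n" for k
  proof (rule ccontr)
    assume "?c k \<noteq> 0"
    with that have "\<exists>k. k \<noteq> 0 \<and> k \<le> n \<and> ?c k \<noteq> 0" by (intro exI[of _ k]) simp
    from polyfun_extremal[OF this, of "L + 1"]
    have "eventually (\<lambda>z. cmod (f z) \<ge> L + 1) at_infinity" by (simp only: poly[symmetric])
    then obtain b where b: "\<And>z. cmod z \<ge> b \<Longrightarrow> cmod (f z) \<ge> L + 1"
      unfolding eventually_at_infinity by blast
    from b[of "- of_real (max b 0)"] ray[of "max b 0"] show False by simp
  qed
  then have "?c k * z ^ k = ?c k * 0 ^ k" if "k \<le> n" for k z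
    using that by (cases "k = 0") auto
  then have "(\<Sum>k\<le>n. ?c k * z ^ k) = (\<Sum>k\<le>n. ?c k * 0 ^ k)" by (intro sum.cong) auto
  from trans[OF poly trans[OF this poly[symmetric]]] show ?thesis .
qed

text \<open>The analytic core of the uniqueness statements. With \<open>t = u\<^sup>2\<close>, the bound at \<open>t\<close> transported to \<open>w\<close> is
\<open>(1 + u) ^ N exp (- \<rho> t + \<bar>B\<bar> \<bar>w - t\<bar>)\<close>, and \<open>t \<ge> 0\<close> is free to choose.\<close>

lemma evolution_decay:
  fixes h :: "nat \<Rightarrow> real \<Rightarrow> complex"
  assumes der: "\<And>k s. (h k has_vector_derivative - (2 * of_real s * B) * h (k + 1) s) (at s)"
    and bnd: "\<And>k s. cmod (h k s) \<le> C * (1 + \<bar>s\<bar>) ^ N * exp (- \<rho> * s\<^sup>2)" and "\<rho> > 0"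
  shows "cmod B < \<rho> \<Longrightarrow> h 0 0 = 0" and "cmod B = \<rho> \<Longrightarrow> B * h 1 0 = \<rho> * h 0 0"
proof -
  let ?G = "evolution B (\<lambda>n. h n 0)"
  have C: "C \<ge> 0" using order_trans[OF norm_ge_zero bnd[of 0 0]] by simp
  obtain K where K: "K \<ge> 0" "\<And>r. r \<ge> 0 \<Longrightarrow> exp (- \<rho> * r\<^sup>2) * (1 + r) ^ N \<le> K"
  proof -
    from gaussian_weight_bound[OF order_refl \<open>\<rho> > 0\<close>, of N] obtain K where K: "K \<ge> 0"
      "\<forall>s r. r \<ge> 0 \<longrightarrow> exp (- \<rho> * r\<^sup>2) * exp (0 * (\<bar>s\<bar> * r)) * (1 + r) ^ N \<le> K * (1 + \<bar>s\<bar>) ^ N * exp (0\<^sup>2 / (4 * \<rho>) * s\<^sup>2)"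
      by blast
    show ?thesis by (rule that[OF K(1)]) (use K(2)[rule_format, of _ 0] in simp)
  qed
  have M: "cmod (h k s) \<le> C * K" for k s
  proof -
    have "cmod (h k s) \<le> C * (exp (- \<rho> * \<bar>s\<bar>\<^sup>2) * (1 + \<bar>s\<bar>) ^ N)"
      using bnd[of k s] by (simp add: mult_ac)
    also have "\<dots> \<le> C * K" using C by (intro mult_left_mono K) auto
    finally show ?thesis .
  qed
  have G_real: "cmod (?G k (of_real (u\<^sup>2))) \<le> C * (1 + u) ^ N * exp (- \<rho> * u\<^sup>2)" if "u \<ge> 0" for u k
    using bnd[of k u] that unfolding evolution_unique[of h, OF der M that, symmetric] by simp
  have G_bound: "cmod (?G 0 w) \<le> C * (1 + u) ^ N * exp (- \<rho> * u\<^sup>2) * exp (cmod B * cmod (w - of_real (u\<^sup>2)))"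
    if "u \<ge> 0" for u w
    by (rule evolution_taylor_bound[OF M G_real[OF that]])
  show "h 0 0 = 0" if B: "cmod B < \<rho>"
  proof -
    let ?\<delta> = "\<rho> - cmod B"
    (* The bound has N powers of 1 + u; the power N + 1 leaves a factor 1 / (1 + u) that tends to 0. *)
    from gaussian_weight_bound[OF order_refl, of ?\<delta> "Suc N"] B obtain K' where K':
      "\<forall>s r. r \<ge> 0 \<longrightarrow> exp (- ?\<delta> * r\<^sup>2) * exp (0 * (\<bar>s\<bar> * r)) * (1 + r) ^ Suc N \<le> K' * (1 + \<bar>s\<bar>) ^ Suc N * exp (0\<^sup>2 / (4 * ?\<delta>) * s\<^sup>2)"
      by auto
    have "cmod (h 0 0) * (1 + u) \<le> C * K'" if "u \<ge> 0" for u
    proof -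
      have "cmod (h 0 0) \<le> C * (1 + u) ^ N * exp (- \<rho> * u\<^sup>2) * exp (cmod B * u\<^sup>2)"
        using G_bound[OF that, of 0] by (simp add: evolution_0 norm_power)
      also have "\<dots> = C * ((1 + u) ^ N * exp (- ?\<delta> * u\<^sup>2))"
        by (simp add: exp_add[symmetric] algebra_simps)
      finally have "cmod (h 0 0) * (1 + u) \<le> C * ((1 + u) ^ N * exp (- ?\<delta> * u\<^sup>2)) * (1 + u)"
        using that by (intro mult_right_mono) auto
      also have "\<dots> = C * (exp (- ?\<delta> * u\<^sup>2) * (1 + u) ^ Suc N)" by (simp only: power_Suc mult_ac)
      also have "\<dots> \<le> C * K'"
        using C K'[rule_format, OF that, of 0] by (intro mult_left_mono) auto
      finally show ?thesis .
    qed
    note le = this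
    show ?thesis
    proof (rule ccontr)
      assume nz: "h 0 0 \<noteq> 0"
      have "C * K' \<ge> 0" by (rule order_trans[OF _ le[of 0]]) auto
      with le[of "C * K' / cmod (h 0 0)"] nz show False by (simp add: field_simps mult_le_0_iff)
    qed
  qed
  show "B * h 1 0 = \<rho> * h 0 0" if B: "cmod B = \<rho>"
  proof -
    let ?f = "\<lambda>w. exp (of_real \<rho> * w) * ?G 0 w"
    have f': "(?f has_field_derivative of_real \<rho> * ?f w + exp (of_real \<rho> * w) * (- B * ?G 1 w)) (at w)" for w
      using evolution_derivative[of "\<lambda>n. h n 0", OF M, of B 0 w]
      by (auto intro!: derivative_eq_intros)
    have "?f holomorphic_on UNIV" using f' by (auto simp: holomorphic_on_open)
    moreover have "cmod (?f w) \<le> (C * exp \<rho> * 2 ^ N) * (1 + cmod w) ^ N" for w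
    proof -
      (* t is so large that the distance from w to t exceeds t - Re w by at most 1:
         then the exponentials cancel up to a constant. *)
      define t where "t = cmod w + (cmod w)\<^sup>2"
      have t: "t \<ge> 0" by (simp add: t_def)
      have "sqrt t \<le> 1 + cmod w"
        by (rule real_le_lsqrt) (auto simp: t_def power2_eq_square algebra_simps)
      then have "1 + sqrt t \<le> 2 * (1 + cmod w)" using norm_ge_zero[of w] unfolding distrib_left by linarith
      then have st: "(1 + sqrt t) ^ N \<le> (2 * (1 + cmod w)) ^ N" using t by (intro power_mono) auto
      have re: "Re w \<le> cmod w" by (rule complex_Re_le_cmod)
      have "(cmod (w - of_real t))\<^sup>2 = (t - Re w)\<^sup>2 + (Im w)\<^sup>2"
        by (simp add: cmod_power2 power2_commute)
      also have "\<dots> \<le> (t - Re w)\<^sup>2 + (cmod w)\<^sup>2" by (simp add: cmod_power2)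
      also have "\<dots> \<le> (t - Re w)\<^sup>2 + 2 * (t - Re w) + 1" using re by (simp add: t_def)
      also have "\<dots> = (t - Re w + 1)\<^sup>2" by (simp add: power2_eq_square algebra_simps)
      finally have dist: "cmod (w - of_real t) \<le> t - Re w + 1"
        by (rule power2_le_imp_le) (unfold t_def, use re zero_le_power2[of "cmod w"] in linarith)
      have "cmod (?f w) \<le> exp (\<rho> * Re w) * (C * (1 + sqrt t) ^ N * exp (- \<rho> * t) * exp (\<rho> * cmod (w - of_real t)))"
        using G_bound[of "sqrt t" w] t by (simp add: norm_mult norm_exp_eq_Re B)
      also have "\<dots> \<le> exp (\<rho> * Re w) * (C * (2 * (1 + cmod w)) ^ N * exp (- \<rho> * t) * exp (\<rho> * (t - Re w + 1)))"
        using C st dist \<open>\<rho> > 0\<close> by (intro mult_left_mono mult_mono) auto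
      also have "\<dots> = C * (2 * (1 + cmod w)) ^ N * (exp (\<rho> * Re w) * exp (- \<rho> * t) * exp (\<rho> * (t - Re w + 1)))"
        by (simp only: mult_ac)
      also have "exp (\<rho> * Re w) * exp (- \<rho> * t) * exp (\<rho> * (t - Re w + 1)) = exp \<rho>"
        by (simp add: exp_add[symmetric] algebra_simps)
      also have "C * (2 * (1 + cmod w)) ^ N * exp \<rho> = (C * exp \<rho> * 2 ^ N) * (1 + cmod w) ^ N"
        by (simp only: power_mult_distrib mult_ac)
      finally show ?thesis .
    qed
    moreover have "cmod (?f (- of_real u)) \<le> C" if "u \<ge> 0" for u
    proof -
      have "cmod (?f (- of_real u)) \<le> exp (- (\<rho> * u)) * (C * exp (\<rho> * u))"
        using G_bound[of 0 "- of_real u"] that by (simp add: norm_mult norm_exp_eq_Re B)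
      also have "\<dots> = C" by (simp add: exp_minus)
      finally show ?thesis .
    qed
    ultimately have const: "?f w = ?f 0" for w by (rule entire_polynomial_growth_const)
    have "(?f has_field_derivative 0) (at 0)"
      by (subst const[abs_def]) simp
    from DERIV_unique[OF this f'[of 0]] show ?thesis by (simp add: evolution_0)
  qed
qed

section \<open>Seminorms and continuous functionals\<close>

lemma weighted_deriv_nonneg: "weighted_deriv a m \<alpha> f x \<ge> 0"
  by (simp add: weighted_deriv_def)

lemma weighted_deriv_le_exp_seminorm:
  "f \<in> exp_schwartz a \<Longrightarrow> weighted_deriv a m \<alpha> f x \<le> exp_seminorm a m \<alpha> f"
  unfolding exp_seminorm_def exp_schwartz_def by (intro cSUP_upper) auto

lemma exp_seminorm_le:
  "(\<And>x. weighted_deriv a m \<alpha> f x \<le> C) \<Longrightarrow> exp_seminorm a m \<alpha> f \<le> C"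
  unfolding exp_seminorm_def by (intro cSUP_least) auto

lemma exp_seminorm_nonneg: "f \<in> exp_schwartz a \<Longrightarrow> exp_seminorm a m \<alpha> f \<ge> 0"
  using order_trans[OF weighted_deriv_nonneg weighted_deriv_le_exp_seminorm] by blast

lemma weighted_deriv_cmult:
  "C_infty f \<Longrightarrow> weighted_deriv a m \<alpha> (\<lambda>x. c * f x) x = cmod c * weighted_deriv a m \<alpha> f x"
  by (simp add: weighted_deriv_def multi_deriv_eq_iter_partial iter_partial_cmult norm_mult)

lemma exp_seminorm_add:
  assumes "f \<in> exp_schwartz a" "g \<in> exp_schwartz a"
  shows "exp_seminorm a m \<alpha> (\<lambda>x. f x + g x) \<le> exp_seminorm a m \<alpha> f + exp_seminorm a m \<alpha> g"
proof (rule exp_seminorm_le)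
  fix x
  have "multi_deriv \<alpha> (\<lambda>x. f x + g x) x = multi_deriv \<alpha> f x + multi_deriv \<alpha> g x"
    using iter_partial_lincomb[of f g _ 1 1] exp_schwartz_C_infty[OF assms(1)] exp_schwartz_C_infty[OF assms(2)]
    by (simp add: multi_deriv_eq_iter_partial)
  then have "weighted_deriv a m \<alpha> (\<lambda>x. f x + g x) x
      \<le> exp (a * norm x) * (1 + norm x) ^ m * (cmod (multi_deriv \<alpha> f x) + cmod (multi_deriv \<alpha> g x))"
    unfolding weighted_deriv_def by (intro mult_left_mono) (auto simp: norm_triangle_ineq)
  also have "\<dots> = weighted_deriv a m \<alpha> f x + weighted_deriv a m \<alpha> g x"
    by (simp add: weighted_deriv_def algebra_simps)
  also have "\<dots> \<le> exp_seminorm a m \<alpha> f + exp_seminorm a m \<alpha> g"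
    by (intro add_mono weighted_deriv_le_exp_seminorm assms)
  finally show "weighted_deriv a m \<alpha> (\<lambda>x. f x + g x) x \<le> exp_seminorm a m \<alpha> f + exp_seminorm a m \<alpha> g" .
qed

lemma exp_seminorm_cmult_le:
  assumes "f \<in> exp_schwartz a"
  shows "exp_seminorm a m \<alpha> (\<lambda>x. c * f x) \<le> cmod c * exp_seminorm a m \<alpha> f"
  by (rule exp_seminorm_le)
    (simp add: weighted_deriv_cmult exp_schwartz_C_infty[OF assms] mult_left_mono weighted_deriv_le_exp_seminorm[OF assms])

lemma exp_seminorm_cmult:
  assumes "f \<in> exp_schwartz a"
  shows "exp_seminorm a m \<alpha> (\<lambda>x. c * f x) = cmod c * exp_seminorm a m \<alpha> f"
proof (rule antisym[OF exp_seminorm_cmult_le[OF assms]])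
  show "cmod c * exp_seminorm a m \<alpha> f \<le> exp_seminorm a m \<alpha> (\<lambda>x. c * f x)"
  proof (cases "c = 0")
    case True
    then show ?thesis using exp_seminorm_nonneg[OF exp_schwartz_0] by simp
  next
    case False
    have "exp_seminorm a m \<alpha> (\<lambda>x. (1 / c) * (c * f x)) \<le> cmod (1 / c) * exp_seminorm a m \<alpha> (\<lambda>x. c * f x)"
      by (intro exp_seminorm_cmult_le exp_schwartz_cmult assms)
    with False show ?thesis by (simp add: norm_divide field_simps)
  qed
qed

lemma exp_seminorm_0: "exp_seminorm a m \<alpha> (\<lambda>x. 0) = 0"
  using exp_seminorm_cmult[OF exp_schwartz_0, of a m \<alpha> 0] by simp

lemma topspace_exp_schwartz_topology:
  "topspace (exp_schwartz_topology a :: (real^'d::finite \<Rightarrow> complex) topology) = exp_schwartz a"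
proof -
  have "\<Union> {{g \<in> exp_schwartz a. exp_seminorm a m \<alpha> (\<lambda>x. g x - f x) < \<epsilon>} | f m \<alpha> \<epsilon>.
      f \<in> exp_schwartz a \<and> \<epsilon> > 0} = (exp_schwartz a :: (real^'d \<Rightarrow> complex) set)" (is "?U = _")
  proof
    show "exp_schwartz a \<subseteq> ?U"
    proof
      fix f :: "real^'d \<Rightarrow> complex" assume f: "f \<in> exp_schwartz a"
      let ?B = "{g \<in> exp_schwartz a. exp_seminorm a 0 (\<lambda>_. 0) (\<lambda>x. g x - f x) < 1}"
      have "f \<in> ?B" using f by (simp add: exp_seminorm_0)
      moreover have "?B \<in> {{g \<in> exp_schwartz a. exp_seminorm a m \<alpha> (\<lambda>x. g x - f x) < \<epsilon>} | f m \<alpha> \<epsilon>.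
          f \<in> exp_schwartz a \<and> \<epsilon> > 0}"
        using f zero_less_one by blast
      ultimately show "f \<in> ?U" by blast
    qed
  qed blast
  then show ?thesis by (simp add: exp_schwartz_topology_def)
qed

lemma openin_exp_schwartz_topology_ball:
  assumes "f \<in> exp_schwartz a" "\<epsilon> > 0"
  shows "openin (exp_schwartz_topology a) {g \<in> exp_schwartz a. exp_seminorm a m \<alpha> (\<lambda>x. g x - f x) < \<epsilon>}"
  unfolding exp_schwartz_topology_def using assms by (intro topology_generated_by_Basis) blast

text \<open>The balls form only a subbasis, so a neighbourhood is described by finitely many seminorms. The
centre of a subbasic ball is moved to \<open>f\<close> by the triangle inequality.\<close>

lemma openin_exp_schwartz_topologyD:
  assumes "openin (exp_schwartz_topology a) U" "f \<in> U"
  shows "\<exists>F \<epsilon>. finite F \<and> \<epsilon> > 0 \<and> (\<forall>g\<in>exp_schwartz a.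
    (\<forall>(m, \<alpha>)\<in>F. exp_seminorm a m \<alpha> (\<lambda>x. g x - f x) < \<epsilon>) \<longrightarrow> g \<in> U)"
proof -
  have "generate_topology_on {{g \<in> exp_schwartz a. exp_seminorm a m \<alpha> (\<lambda>x. g x - f x) < \<epsilon>} | f m \<alpha> \<epsilon>.
        f \<in> exp_schwartz a \<and> \<epsilon> > 0} U"
    using assms(1) by (simp add: exp_schwartz_topology_def openin_topology_generated_by_iff)
  then show ?thesis using assms(2)
  proof (induction U)
    case Empty
    then show ?case by simp
  next
    case (Int V W)
    from Int.IH(1) Int.prems obtain F \<epsilon> where F: "finite F" "\<epsilon> > 0" "\<forall>g\<in>exp_schwartz a.
      (\<forall>(m, \<alpha>)\<in>F. exp_seminorm a m \<alpha> (\<lambda>x. g x - f x) < \<epsilon>) \<longrightarrow> g \<in> V" by auto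
    from Int.IH(2) Int.prems obtain F' \<epsilon>' where F': "finite F'" "\<epsilon>' > 0" "\<forall>g\<in>exp_schwartz a.
      (\<forall>(m, \<alpha>)\<in>F'. exp_seminorm a m \<alpha> (\<lambda>x. g x - f x) < \<epsilon>') \<longrightarrow> g \<in> W" by auto
    show ?case
      by (rule exI[of _ "F \<union> F'"], rule exI[of _ "min \<epsilon> \<epsilon>'"]) (use F F' in fastforce)
  next
    case (UN K)
    then obtain k where k: "k \<in> K" "f \<in> k" by auto
    from UN.IH[OF k] obtain F \<epsilon> where F: "finite F" "\<epsilon> > 0" "\<forall>g\<in>exp_schwartz a.
      (\<forall>(m, \<alpha>)\<in>F. exp_seminorm a m \<alpha> (\<lambda>x. g x - f x) < \<epsilon>) \<longrightarrow> g \<in> k" by auto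
    with k(1) show ?case by (intro exI[of _ F] exI[of _ \<epsilon>]) auto
  next
    case (Basis V)
    then obtain f0 m \<alpha> \<epsilon> where f0: "f0 \<in> exp_schwartz a"
      and V: "V = {g \<in> exp_schwartz a. exp_seminorm a m \<alpha> (\<lambda>x. g x - f0 x) < \<epsilon>}" by auto
    with Basis.prems have f: "f \<in> exp_schwartz a" "exp_seminorm a m \<alpha> (\<lambda>x. f x - f0 x) < \<epsilon>" by auto
    have "g \<in> V" if g: "g \<in> exp_schwartz a"
      "exp_seminorm a m \<alpha> (\<lambda>x. g x - f x) < \<epsilon> - exp_seminorm a m \<alpha> (\<lambda>x. f x - f0 x)" for g
      using exp_seminorm_add[OF exp_schwartz_diff[OF g(1) f(1)] exp_schwartz_diff[OF f(1) f0], of m \<alpha>] g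
      by (simp add: V)
    with f(2) show ?case
      by (intro exI[of _ "{(m, \<alpha>)}"] exI[of _ "\<epsilon> - exp_seminorm a m \<alpha> (\<lambda>x. f x - f0 x)"]) auto
  qed
qed

text \<open>A homogeneous function that is less than \<open>1\<close> near \<open>0\<close> is controlled by finitely many of the defining
seminorms. This serves both a distribution and the seminorm of the uniform bound.\<close>

lemma continuous_homogeneous_bound:
  fixes \<Phi> :: "(real^'d::finite \<Rightarrow> complex) \<Rightarrow> real"
  assumes hom: "\<And>c f. f \<in> exp_schwartz a \<Longrightarrow> \<Phi> (\<lambda>x. c * f x) = cmod c * \<Phi> f"
    and cont: "continuous_map (exp_schwartz_topology a) euclideanreal \<Phi>"
  shows "\<exists>F C. finite F \<and> C \<ge> 0 \<and> (\<forall>f\<in>exp_schwartz a. \<Phi> f \<le> C * (\<Sum>(m, \<alpha>)\<in>F. exp_seminorm a m \<alpha> f))"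
proof -
  let ?U = "{f \<in> exp_schwartz a. \<Phi> f \<in> {..<1}}"
  have "openin (exp_schwartz_topology a) ?U"
    using openin_continuous_map_preimage[OF cont, of "{..<1}"] by (simp add: topspace_exp_schwartz_topology)
  moreover have "(\<lambda>x. 0) \<in> ?U"
    using hom[OF exp_schwartz_0, of 0] exp_schwartz_0 by simp
  ultimately obtain F \<epsilon> where F: "finite F" "\<epsilon> > 0"
    and U: "\<And>g. g \<in> exp_schwartz a \<Longrightarrow> \<forall>(m, \<alpha>)\<in>F. exp_seminorm a m \<alpha> g < \<epsilon> \<Longrightarrow> \<Phi> g < 1"
    using openin_exp_schwartz_topologyD[of a ?U "\<lambda>x. 0"] by auto
  have "\<Phi> f \<le> (1 / \<epsilon>) * (\<Sum>(m, \<alpha>)\<in>F. exp_seminorm a m \<alpha> f)" if f: "f \<in> exp_schwartz a" for f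
  proof (rule ccontr)
    let ?S = "\<Sum>(m, \<alpha>)\<in>F. exp_seminorm a m \<alpha> f"
    assume "\<not> ?thesis"
    then have less: "?S < \<epsilon> * \<Phi> f" using F(2) by (simp add: field_simps)
    have "?S \<ge> 0" by (intro sum_nonneg) (auto simp: exp_seminorm_nonneg[OF f])
    with less have pos: "\<Phi> f > 0" using F(2) by (smt (verit) zero_less_mult_pos)
    have "exp_seminorm a m \<alpha> (\<lambda>x. of_real (1 / \<Phi> f) * f x) < \<epsilon>" if "(m, \<alpha>) \<in> F" for m \<alpha>
    proof -
      have "exp_seminorm a m \<alpha> f \<le> ?S"
        using member_le_sum[OF that, of "\<lambda>(m, \<alpha>). exp_seminorm a m \<alpha> f"] F(1)
        by (auto simp: exp_seminorm_nonneg[OF f])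
      then show ?thesis using less pos unfolding exp_seminorm_cmult[OF f] by (simp add: norm_divide field_simps)
    qed
    then have "\<Phi> (\<lambda>x. of_real (1 / \<Phi> f) * f x) < 1"
      by (intro U exp_schwartz_cmult f) auto
    then show False using pos by (simp only: hom[OF f]) (simp add: norm_divide)
  qed
  then show ?thesis using F by (intro exI[of _ F] exI[of _ "1 / \<epsilon>"]) auto
qed

lemma continuous_map_exp_schwartz_lipschitz:
  fixes \<Phi> :: "(real^'d::finite \<Rightarrow> complex) \<Rightarrow> 'b::metric_space"
  assumes lip: "\<And>f g. f \<in> exp_schwartz a \<Longrightarrow> g \<in> exp_schwartz a \<Longrightarrow>
    dist (\<Phi> g) (\<Phi> f) \<le> C * exp_seminorm a m \<alpha> (\<lambda>x. g x - f x)"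
  shows "continuous_map (exp_schwartz_topology a) euclidean \<Phi>"
proof (unfold continuous_map_def topspace_exp_schwartz_topology, intro conjI allI impI)
  fix U :: "'b set" assume "openin euclidean U"
  then have "open U" by simp
  show "openin (exp_schwartz_topology a) {f \<in> exp_schwartz a. \<Phi> f \<in> U}" (is "openin _ ?V")
  proof (subst openin_subopen, intro ballI)
    fix f assume f: "f \<in> ?V"
    then obtain e where e: "e > 0" "\<And>y. dist y (\<Phi> f) < e \<Longrightarrow> y \<in> U"
      using \<open>open U\<close> unfolding open_dist by blast
    let ?B = "{g \<in> exp_schwartz a. exp_seminorm a m \<alpha> (\<lambda>x. g x - f x) < e / (\<bar>C\<bar> + 1)}"
    have "openin (exp_schwartz_topology a) ?B"
      using f e(1) by (intro openin_exp_schwartz_topology_ball) auto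
    moreover have "f \<in> ?B" using f e(1) by (simp add: exp_seminorm_0)
    moreover have "?B \<subseteq> ?V"
    proof
      fix g assume g: "g \<in> ?B"
      let ?p = "exp_seminorm a m \<alpha> (\<lambda>x. g x - f x)"
      have p: "?p \<ge> 0" using f g by (intro exp_seminorm_nonneg exp_schwartz_diff) auto
      have "dist (\<Phi> g) (\<Phi> f) \<le> C * ?p" using f g by (intro lip) auto
      also have "\<dots> \<le> (\<bar>C\<bar> + 1) * ?p" using p by (intro mult_right_mono) auto
      also have "\<dots> < e" using g e(1) by (simp add: field_simps)
      finally show "g \<in> ?V" using g e(2) by simp
    qed
    ultimately show "\<exists>T. openin (exp_schwartz_topology a) T \<and> f \<in> T \<and> T \<subseteq> ?V" by blast
  qed
qed auto

lemma exp_tempered_distr_add: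
  "T \<in> exp_tempered_distr a \<Longrightarrow> f \<in> exp_schwartz a \<Longrightarrow> g \<in> exp_schwartz a \<Longrightarrow>
    T (\<lambda>x. f x + g x) = T f + T g"
  and exp_tempered_distr_cmult:
  "T \<in> exp_tempered_distr a \<Longrightarrow> f \<in> exp_schwartz a \<Longrightarrow> T (\<lambda>x. c * f x) = c * T f"
  by (simp_all add: exp_tempered_distr_def)

lemma exp_tempered_distr_diff:
  assumes "T \<in> exp_tempered_distr a" "f \<in> exp_schwartz a" "g \<in> exp_schwartz a"
  shows "T (\<lambda>x. f x - g x) = T f - T g"
  using exp_tempered_distr_add[OF assms(1,2) exp_schwartz_cmult[OF assms(3), of "- 1"]]
    exp_tempered_distr_cmult[OF assms(1,3), of "- 1"] by simp

lemma exp_tempered_distr_bound: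
  assumes "T \<in> exp_tempered_distr a"
  shows "\<exists>F C. finite F \<and> C \<ge> 0 \<and> (\<forall>f\<in>exp_schwartz a. cmod (T f) \<le> C * (\<Sum>(m, \<alpha>)\<in>F. exp_seminorm a m \<alpha> f))"
proof (rule continuous_homogeneous_bound)
  show "continuous_map (exp_schwartz_topology a) euclideanreal (\<lambda>f. cmod (T f))"
    using assms by (intro continuous_map_norm) (simp add: exp_tempered_distr_def)
qed (use assms in \<open>simp add: exp_tempered_distr_cmult norm_mult\<close>)

section \<open>Functionals along the heat flow and the decaying recurrence\<close>

lemma multi_deriv_exp_schwartz: "f \<in> exp_schwartz a \<Longrightarrow> multi_deriv \<alpha> f \<in> exp_schwartz a"
  by (simp add: multi_deriv_eq_iter_partial exp_schwartz_iter_partial)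

lemma multi_deriv_heat:
  "f \<in> exp_schwartz a \<Longrightarrow> a \<ge> 0 \<Longrightarrow> Re \<beta> > 0 \<Longrightarrow> multi_deriv \<alpha> (heat \<beta> s f) = heat \<beta> s (multi_deriv \<alpha> f)"
  by (simp add: multi_deriv_eq_iter_partial iter_partial_heat)

lemma heat_weighted_deriv_growth:
  assumes "a \<ge> 0" "Re \<beta> > 0" and f: "f \<in> exp_schwartz a"
  shows "\<exists>C\<ge>0. \<exists>N. \<forall>s x. weighted_deriv a m \<alpha> (heat \<beta> s f) x \<le> C * (1 + \<bar>s\<bar>) ^ N * exp (a\<^sup>2 / (4 * Re \<beta>) * s\<^sup>2)"
proof -
  obtain C N where C: "C \<ge> 0" "\<And>s D (g :: real^'a \<Rightarrow> complex) x. continuous_on UNIV g \<Longrightarrow>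
    (\<forall>x. exp (a * norm x) * (1 + norm x) ^ m * cmod (g x) \<le> D) \<Longrightarrow>
    exp (a * norm x) * (1 + norm x) ^ m * cmod (heat \<beta> s g x)
      \<le> C * (1 + \<bar>s\<bar>) ^ N * exp (a\<^sup>2 / (4 * Re \<beta>) * s\<^sup>2) * D"
    using heat_weighted_bound[OF assms(1,2), of m, where 'd='a] by blast
  let ?D = "exp_seminorm a m \<alpha> f"
  have "weighted_deriv a m \<alpha> (heat \<beta> s f) x \<le> (C * ?D) * (1 + \<bar>s\<bar>) ^ N * exp (a\<^sup>2 / (4 * Re \<beta>) * s\<^sup>2)" for s x
    using C(2)[OF exp_schwartz_continuous[OF multi_deriv_exp_schwartz[OF f, of \<alpha>]], of ?D x s]
      weighted_deriv_le_exp_seminorm[OF f, of m \<alpha>]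
    by (simp add: weighted_deriv_def multi_deriv_heat[OF f assms(1,2)] mult_ac)
  moreover have "C * ?D \<ge> 0" using C(1) exp_seminorm_nonneg[OF f] by simp
  ultimately show ?thesis by blast
qed

lemma heat_seminorm_sum_growth:
  assumes "a \<ge> 0" "Re \<beta> > 0" and f: "f \<in> exp_schwartz a" and "finite F"
  shows "\<exists>C\<ge>0. \<exists>N. \<forall>s. (\<Sum>(m, \<alpha>)\<in>F. exp_seminorm a m \<alpha> (heat \<beta> s f)) \<le> C * (1 + \<bar>s\<bar>) ^ N * exp (a\<^sup>2 / (4 * Re \<beta>) * s\<^sup>2)"
  using \<open>finite F\<close>
proof (induction F rule: finite_induct)
  case empty
  then show ?case by (intro exI[of _ 0]) auto
next
  case (insert p F)
  obtain m \<alpha> where p: "p = (m, \<alpha>)" by (cases p)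
  from heat_weighted_deriv_growth[OF assms(1-3), of m \<alpha>] obtain C N where
    C: "C \<ge> 0" "\<And>s. exp_seminorm a m \<alpha> (heat \<beta> s f) \<le> C * (1 + \<bar>s\<bar>) ^ N * exp (a\<^sup>2 / (4 * Re \<beta>) * s\<^sup>2)"
    using exp_seminorm_le by metis
  from insert.IH obtain C' N' where C': "C' \<ge> 0"
    "\<And>s. (\<Sum>(m, \<alpha>)\<in>F. exp_seminorm a m \<alpha> (heat \<beta> s f)) \<le> C' * (1 + \<bar>s\<bar>) ^ N' * exp (a\<^sup>2 / (4 * Re \<beta>) * s\<^sup>2)"
    by blast
  have up: "C * (1 + \<bar>s\<bar>) ^ N * e \<le> C * (1 + \<bar>s\<bar>) ^ (N + N') * e" "C' * (1 + \<bar>s\<bar>) ^ N' * e \<le> C' * (1 + \<bar>s\<bar>) ^ (N + N') * e"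
    if "e \<ge> 0" for s e :: real
    using C(1) C'(1) that by (auto intro!: mult_right_mono mult_left_mono power_increasing)
  have "(\<Sum>(m, \<alpha>)\<in>insert p F. exp_seminorm a m \<alpha> (heat \<beta> s f))
      \<le> (C + C') * (1 + \<bar>s\<bar>) ^ (N + N') * exp (a\<^sup>2 / (4 * Re \<beta>) * s\<^sup>2)" for s
    using add_mono[OF order_trans[OF C(2)[of s] up(1)] order_trans[OF C'(2)[of s] up(2)]] insert.hyps
    by (simp add: p algebra_simps)
  then show ?case using C(1) C'(1) by (intro exI[of _ "C + C'"]) auto
qed

text \<open>Differentiability of the heat flow in \<open>s\<close> with respect to each seminorm: the second derivative in \<open>s\<close>
involves the heat flows of \<open>\<Delta> f\<close> and \<open>\<Delta>\<^sup>2 f\<close>, whose weighted sizes are bounded for bounded \<open>s\<close>.\<close>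

lemma heat_taylor_remainder:
  assumes "a \<ge> 0" "Re \<beta> > 0" and f: "f \<in> exp_schwartz a"
  shows "\<exists>K. \<forall>h x. \<bar>h\<bar> \<le> 1 \<longrightarrow> weighted_deriv a m \<alpha>
    (\<lambda>x. (heat \<beta> (s + h) f x - heat \<beta> s f x) - (of_real h * (- (of_real s / (2 * \<beta>)))) * heat \<beta> s (laplacian f) x) x \<le> K * h\<^sup>2"
proof -
  let ?\<kappa> = "a\<^sup>2 / (4 * Re \<beta>)"
  let ?w = "\<lambda>x::real^'a. exp (a * norm x) * (1 + norm x) ^ m"
  define g where "g = multi_deriv \<alpha> f"
  have Lf: "laplacian f \<in> exp_schwartz a" and LLf: "laplacian (laplacian f) \<in> exp_schwartz a"
    using f by (intro exp_schwartz_laplacian; simp)+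
  have g: "g \<in> exp_schwartz a" "laplacian g = multi_deriv \<alpha> (laplacian f)"
    "laplacian (laplacian g) = multi_deriv \<alpha> (laplacian (laplacian f))"
    using multi_deriv_exp_schwartz[OF f] exp_schwartz_C_infty[OF f] exp_schwartz_C_infty[OF Lf]
    by (simp_all add: g_def multi_deriv_eq_iter_partial iter_partial_laplacian C_infty_laplacian)
  obtain C1 N1 where C1: "C1 \<ge> 0" "\<And>\<tau> x. ?w x * cmod (heat \<beta> \<tau> (laplacian g) x) \<le> C1 * (1 + \<bar>\<tau>\<bar>) ^ N1 * exp (?\<kappa> * \<tau>\<^sup>2)"
    using heat_weighted_deriv_growth[OF assms(1,2) Lf, of m \<alpha>]
    unfolding weighted_deriv_def multi_deriv_heat[OF Lf assms(1,2)] g(2) by blast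
  obtain C2 N2 where C2: "C2 \<ge> 0" "\<And>\<tau> x. ?w x * cmod (heat \<beta> \<tau> (laplacian (laplacian g)) x) \<le> C2 * (1 + \<bar>\<tau>\<bar>) ^ N2 * exp (?\<kappa> * \<tau>\<^sup>2)"
    using heat_weighted_deriv_growth[OF assms(1,2) LLf, of m \<alpha>]
    unfolding weighted_deriv_def multi_deriv_heat[OF LLf assms(1,2)] g(3) by blast
  define S where "S = \<bar>s\<bar> + 1"
  define K1 where "K1 = C1 * (1 + S) ^ N1 * exp (?\<kappa> * S\<^sup>2)"
  define K2 where "K2 = C2 * (1 + S) ^ N2 * exp (?\<kappa> * S\<^sup>2)"
  have \<kappa>: "?\<kappa> \<ge> 0" using assms(2) by simp
  have gr: "C * (1 + \<bar>\<tau>\<bar>) ^ N * exp (?\<kappa> * \<tau>\<^sup>2) \<le> C * (1 + S) ^ N * exp (?\<kappa> * S\<^sup>2)"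
    if "C \<ge> 0" "\<bar>\<tau>\<bar> \<le> S" for C \<tau> N
  proof -
    have "\<tau>\<^sup>2 \<le> S\<^sup>2" using power_mono[OF that(2) abs_ge_zero, of 2] by simp
    then have "exp (?\<kappa> * \<tau>\<^sup>2) \<le> exp (?\<kappa> * S\<^sup>2)" using mult_left_mono[OF _ \<kappa>] by simp
    moreover have "(1 + \<bar>\<tau>\<bar>) ^ N \<le> (1 + S) ^ N" using that by (intro power_mono) auto
    ultimately show ?thesis using that by (intro mult_mono mult_left_mono) auto
  qed
  (* K bounds the weighted size of the second derivative on the unit interval around s. *)
  define K where "K = cmod (1 / (2 * \<beta>)) * K1 + cmod ((S / (2 * \<beta>))\<^sup>2) * K2"
  have wpos: "?w x > 0" for x by (intro mult_pos_pos zero_less_power) (auto simp: add_pos_nonneg)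
  have main: "?w x * cmod ((heat \<beta> (s + h) g x - heat \<beta> s g x) - (of_real h * (- (of_real s / (2 * \<beta>)))) * heat \<beta> s (laplacian g) x) \<le> K * h\<^sup>2"
    if h: "\<bar>h\<bar> \<le> 1" for h x
  proof -
    let ?c = "\<lambda>\<tau>. - (of_real \<tau> / (2 * \<beta>))"
    let ?u = "\<lambda>\<tau>. heat \<beta> \<tau> g x"
    let ?u' = "\<lambda>\<tau>. ?c \<tau> * heat \<beta> \<tau> (laplacian g) x"
    let ?u'' = "\<lambda>\<tau>. - (1 / (2 * \<beta>)) * heat \<beta> \<tau> (laplacian g) x + ?c \<tau> * (?c \<tau> * heat \<beta> \<tau> (laplacian (laplacian g)) x)"
    have seg: "\<bar>\<tau>\<bar> \<le> S \<and> \<bar>\<tau> - s\<bar> \<le> \<bar>h\<bar>" if "\<tau> \<in> closed_segment s (s + h)" for \<tau>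
      using that h by (auto simp: closed_segment_eq_real_ivl S_def split: if_splits)
    have u': "(?u has_vector_derivative ?u' \<tau>) (at \<tau>)" for \<tau>
      by (rule heat_time_derivative[OF g(1) assms(1,2)])
    have u'': "(?u' has_vector_derivative ?u'' \<tau>) (at \<tau>)" for \<tau>
    proof -
      have "((\<lambda>z. - (z / (2 * \<beta>))) has_field_derivative - (1 / (2 * \<beta>))) (at (of_real \<tau>))"
        using assms(2) by (auto intro!: derivative_eq_intros)
      from has_vector_derivative_mult[OF has_vector_derivative_real_field[OF this] heat_time_derivative[OF exp_schwartz_laplacian[OF g(1)] assms(1,2)]]
      show ?thesis by (simp add: add.commute)
    qed
    have bnd: "norm (?u'' \<tau>) \<le> K / ?w x" if "\<tau> \<in> closed_segment s (s + h)" for \<tau>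
    proof -
      from seg[OF that] have \<tau>: "\<bar>\<tau>\<bar> \<le> S" by simp
      have 1: "?w x * cmod (heat \<beta> \<tau> (laplacian g) x) \<le> K1"
        unfolding K1_def by (rule order_trans[OF C1(2) gr[OF C1(1) \<tau>]])
      have 2: "?w x * cmod (heat \<beta> \<tau> (laplacian (laplacian g)) x) \<le> K2"
        unfolding K2_def by (rule order_trans[OF C2(2) gr[OF C2(1) \<tau>]])
      have c: "cmod (?c \<tau> * ?c \<tau>) \<le> cmod ((S / (2 * \<beta>))\<^sup>2)"
      proof -
        have "cmod (?c \<tau>) \<le> cmod (S / (2 * \<beta>))"
          using \<tau> by (simp add: norm_divide divide_right_mono S_def)
        then have "cmod (?c \<tau>) * cmod (?c \<tau>) \<le> cmod (S / (2 * \<beta>)) * cmod (S / (2 * \<beta>))"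
          by (intro mult_mono) auto
        then show ?thesis by (simp only: norm_mult power2_eq_square)
      qed
      have "?w x * norm (?u'' \<tau>) \<le> ?w x * (cmod (1 / (2 * \<beta>)) * cmod (heat \<beta> \<tau> (laplacian g) x)
          + cmod (?c \<tau> * ?c \<tau>) * cmod (heat \<beta> \<tau> (laplacian (laplacian g)) x))"
        using wpos[of x]
        by (intro mult_left_mono order_trans[OF norm_triangle_ineq]) (simp_all only: mult.assoc[symmetric] norm_mult norm_minus_cancel order_refl less_imp_le)
      also have "\<dots> = cmod (1 / (2 * \<beta>)) * (?w x * cmod (heat \<beta> \<tau> (laplacian g) x))
          + cmod (?c \<tau> * ?c \<tau>) * (?w x * cmod (heat \<beta> \<tau> (laplacian (laplacian g)) x))"
        by (simp only: distrib_left mult_ac)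
      also have "\<dots> \<le> K"
        unfolding K_def using wpos[of x] by (intro add_mono mult_mono 1 2 c mult_nonneg_nonneg) auto
      finally show ?thesis using wpos[of x] by (simp add: pos_le_divide_eq mult.commute)
    qed
    have K0: "K / ?w x \<ge> 0" using order_trans[OF norm_ge_zero bnd[of s]] by simp
    have "norm ((?u (s + h) - (s + h) *\<^sub>R ?u' s) - (?u s - s *\<^sub>R ?u' s)) \<le> (K / ?w x * \<bar>h\<bar>) * \<bar>s + h - s\<bar>"
    proof (rule vector_derivative_bound_segment)
      show "((\<lambda>\<tau>. ?u \<tau> - \<tau> *\<^sub>R ?u' s) has_vector_derivative ?u' \<tau> - ?u' s) (at \<tau>)" for \<tau>
        by (rule has_vector_derivative_diff[OF u' has_vector_derivative_linear])
      fix \<tau> assume \<tau>: "\<tau> \<in> closed_segment s (s + h)"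
      have "norm (?u' \<tau> - ?u' s) \<le> K / ?w x * \<bar>\<tau> - s\<bar>"
      proof (rule vector_derivative_bound_segment[OF u''])
        fix \<sigma> assume "\<sigma> \<in> closed_segment s \<tau>"
        then have "\<sigma> \<in> closed_segment s (s + h)"
          using \<tau> by (meson closed_segment_subset convex_closed_segment ends_in_segment(1) subsetD)
        then show "norm (?u'' \<sigma>) \<le> K / ?w x" by (rule bnd)
      qed
      also have "\<dots> \<le> K / ?w x * \<bar>h\<bar>" using seg[OF \<tau>] K0 by (intro mult_left_mono) auto
      finally show "norm (?u' \<tau> - ?u' s) \<le> K / ?w x * \<bar>h\<bar>" .
    qed
    then have "norm ((?u (s + h) - (s + h) *\<^sub>R ?u' s) - (?u s - s *\<^sub>R ?u' s)) \<le> K * h\<^sup>2 / ?w x"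
      by (simp add: power2_eq_square)
    moreover have "(?u (s + h) - (s + h) *\<^sub>R ?u' s) - (?u s - s *\<^sub>R ?u' s)
        = (heat \<beta> (s + h) g x - heat \<beta> s g x) - (of_real h * (- (of_real s / (2 * \<beta>)))) * heat \<beta> s (laplacian g) x"
      by (simp add: scaleR_conv_of_real algebra_simps add_divide_distrib)
    ultimately show ?thesis using wpos[of x] by (simp only: pos_le_divide_eq mult.commute)
  qed
  have eq: "multi_deriv \<alpha> (\<lambda>x. (heat \<beta> (s + h) f x - heat \<beta> s f x) - c * heat \<beta> s (laplacian f) x) x
      = (heat \<beta> (s + h) g x - heat \<beta> s g x) - c * heat \<beta> s (laplacian g) x" for h c x
  proof -
    have ci: "C_infty (heat \<beta> \<tau> f)" "C_infty (heat \<beta> \<tau> (laplacian f))" for \<tau>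
      using f Lf assms(1,2) by (auto intro: C_infty_heat)
    have ci2: "C_infty (\<lambda>x. heat \<beta> (s + h) f x - heat \<beta> s f x)" "C_infty (\<lambda>x. c * heat \<beta> s (laplacian f) x)"
      using C_infty_lincomb[OF ci(1) ci(1), of 1 "s + h" "-1" s] C_infty_lincomb[OF ci(2) ci(2), of c s 0 s] by simp_all
    show ?thesis
      unfolding g_def multi_deriv_eq_iter_partial
        iter_partial_diff[OF ci2] iter_partial_diff[OF ci(1) ci(1)] iter_partial_cmult[OF ci(2)]
        iter_partial_heat[OF f assms(1,2)] iter_partial_heat[OF Lf assms(1,2)]
        iter_partial_laplacian[OF exp_schwartz_C_infty[OF f]] ..
  qed
  show ?thesis
    unfolding weighted_deriv_def eq using main by blast
qed

text \<open>A distribution is bounded by finitely many seminorms, and for each of them the first order Taylor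
remainder of the heat flow is quadratic.\<close>

lemma distr_heat_derivative:
  assumes T: "T \<in> exp_tempered_distr a" and f: "f \<in> exp_schwartz a" and a: "a \<ge> 0" and \<beta>: "Re \<beta> > 0"
  shows "((\<lambda>s. T (heat \<beta> s f)) has_vector_derivative - (of_real s / (2 * \<beta>)) * T (heat \<beta> s (laplacian f))) (at s)"
proof -
  let ?c = "- (of_real s / (2 * \<beta>))"
  define R where "R h = (\<lambda>x. (heat \<beta> (s + h) f x - heat \<beta> s f x) - (of_real h * ?c) * heat \<beta> s (laplacian f) x)" for h
  obtain F C where F: "finite F" "C \<ge> 0" "\<And>f. f \<in> exp_schwartz a \<Longrightarrow> cmod (T f) \<le> C * (\<Sum>(m, \<alpha>)\<in>F. exp_seminorm a m \<alpha> f)"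
    using exp_tempered_distr_bound[OF T] by blast
  have "\<exists>K. \<forall>h. \<bar>h\<bar> \<le> 1 \<longrightarrow> exp_seminorm a m \<alpha> (R h) \<le> K * h\<^sup>2" for m \<alpha>
  proof -
    from heat_taylor_remainder[OF a \<beta> f, of m \<alpha> s, folded R_def] obtain K
      where "\<forall>h x. \<bar>h\<bar> \<le> 1 \<longrightarrow> weighted_deriv a m \<alpha> (R h) x \<le> K * h\<^sup>2" by blast
    then show ?thesis by (intro exI[of _ K]) (simp add: exp_seminorm_le)
  qed
  then obtain K where K: "\<And>m \<alpha> h. \<bar>h\<bar> \<le> 1 \<Longrightarrow> exp_seminorm a m \<alpha> (R h) \<le> K m \<alpha> * h\<^sup>2" by metis
  have hs: "heat \<beta> \<tau> f \<in> exp_schwartz a" "heat \<beta> \<tau> (laplacian f) \<in> exp_schwartz a" for \<tau>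
    by (intro heat_in_exp_schwartz exp_schwartz_laplacian f a \<beta>)+
  have Tr: "T (R h) = T (heat \<beta> (s + h) f) - T (heat \<beta> s f) - h *\<^sub>R (?c * T (heat \<beta> s (laplacian f)))" for h
    unfolding R_def
    by (simp only: exp_tempered_distr_diff[OF T] exp_tempered_distr_cmult[OF T] exp_schwartz_diff
        exp_schwartz_cmult hs scaleR_conv_of_real mult.assoc)
  define L where "L = C * (\<Sum>(m, \<alpha>)\<in>F. \<bar>K m \<alpha>\<bar>)"
  have L: "L \<ge> 0" unfolding L_def using F(2) by (intro mult_nonneg_nonneg sum_nonneg) auto
  have rem: "cmod (T (R h)) \<le> L * h\<^sup>2" if h: "\<bar>h\<bar> \<le> 1" for h
  proof -
    have "R h \<in> exp_schwartz a" unfolding R_def by (intro exp_schwartz_diff exp_schwartz_cmult hs)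
    from F(3)[OF this] have "cmod (T (R h)) \<le> C * (\<Sum>(m, \<alpha>)\<in>F. exp_seminorm a m \<alpha> (R h))" .
    also have "\<dots> \<le> C * (\<Sum>(m, \<alpha>)\<in>F. \<bar>K m \<alpha>\<bar> * h\<^sup>2)"
      using F(2) K[OF h] by (intro mult_left_mono sum_mono) (auto intro: order_trans[OF _ mult_right_mono[OF abs_ge_self]])
    also have "\<dots> = L * h\<^sup>2" by (simp add: L_def sum_distrib_right case_prod_beta)
    finally show ?thesis .
  qed
  show ?thesis
    unfolding has_vector_derivative_def has_derivative_within_alt
  proof (intro conjI allI impI)
    fix e :: real assume "e > 0"
    define d where "d = min 1 (e / (L + 1))"
    have d: "d > 0" using \<open>e > 0\<close> L by (simp add: d_def)
    show "\<exists>d>0. \<forall>y\<in>UNIV. norm (y - s) < d \<longrightarrow> norm (T (heat \<beta> y f) - T (heat \<beta> s f)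
        - (y - s) *\<^sub>R (?c * T (heat \<beta> s (laplacian f)))) \<le> e * norm (y - s)"
    proof (intro exI[of _ d] conjI ballI impI d)
      fix y assume y: "norm (y - s) < d"
      then have "cmod (T (R (y - s))) \<le> L * \<bar>y - s\<bar> * \<bar>y - s\<bar>"
        using rem[of "y - s"] by (simp add: d_def power2_eq_square abs_mult[symmetric] mult.assoc)
      also have "\<dots> \<le> e * \<bar>y - s\<bar>"
      proof (rule mult_right_mono)
        have "L * \<bar>y - s\<bar> \<le> (L + 1) * (e / (L + 1))" using y L by (intro mult_mono) (auto simp: d_def)
        then show "L * \<bar>y - s\<bar> \<le> e" using L by simp
      qed simp
      finally show "norm (T (heat \<beta> y f) - T (heat \<beta> s f)
        - (y - s) *\<^sub>R (?c * T (heat \<beta> s (laplacian f)))) \<le> e * norm (y - s)"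
        unfolding Tr by simp
    qed
  qed (rule bounded_linear_scaleR_left)
qed

lemma continuous_seminorm_bound:
  assumes "continuous_seminorm a \<gamma>"
  shows "\<exists>F C. finite F \<and> C \<ge> 0 \<and> (\<forall>f\<in>exp_schwartz a. \<gamma> f \<le> C * (\<Sum>(m, \<alpha>)\<in>F. exp_seminorm a m \<alpha> f))"
  using assms unfolding continuous_seminorm_def by (intro continuous_homogeneous_bound) auto

text \<open>The sequence \<open>h k s = exp (s\<^sup>2 \<zeta> z\<^sub>0) T (j + k) (heat \<beta> s f)\<close> satisfies the hypotheses of
\<open>evolution_decay\<close>.\<close>

lemma recurrence_dichotomy:
  fixes l\<^sub>0 z\<^sub>0 A :: complex and T :: "int \<Rightarrow> ('d::finite) functional"
  assumes a: "a = \<bar>Im l\<^sub>0\<bar>" "a \<noteq> 0" and z: "z\<^sub>0 \<in> outward_normal l\<^sub>0" and A: "A \<noteq> 0"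
    and T: "\<And>k. T k \<in> exp_tempered_distr a" and rec: "laplacian_recurrence a z\<^sub>0 A T"
    and bdd: "uniformly_bounded_distr a T" and f: "f \<in> exp_schwartz a"
  shows "cmod A < cmod (l\<^sub>0\<^sup>2 - z\<^sub>0) \<Longrightarrow> T j f = 0"
    and "cmod A = cmod (l\<^sub>0\<^sup>2 - z\<^sub>0) \<Longrightarrow> T j (laplacian f) = l\<^sub>0\<^sup>2 * T j f"
proof -
  obtain x y where l0: "l\<^sub>0 = Complex x y" by (cases l\<^sub>0)
  have y: "y \<noteq> 0" and a0: "a \<ge> 0" and a2: "a\<^sup>2 = y\<^sup>2" using a by (auto simp: l0)
  obtain r where r: "r \<ge> 0" and z0: "z\<^sub>0 = l\<^sub>0\<^sup>2 + \<i> * of_real r * of_real (Im l\<^sub>0) * l\<^sub>0"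
    using z by (auto simp: outward_normal_def)
  define n2 where "n2 = x\<^sup>2 + y\<^sup>2"
  have n2: "n2 > 0" using y by (simp add: n2_def add_nonneg_pos)
  (* zeta turns the outward normal direction into the negative real direction;
     beta is the matching Gaussian parameter, so that heat is exp (- s^2 zeta Delta). *)
  define \<zeta> where "\<zeta> = Complex 1 (x / y)"
  define \<beta> where "\<beta> = 1 / (4 * \<zeta>)"
  define \<rho> where "\<rho> = r * n2"
  have \<zeta>0: "\<zeta> \<noteq> 0" by (simp add: \<zeta>_def complex_eq_iff)
  have Re\<beta>: "Re \<beta> = y\<^sup>2 / (4 * n2)"
    using y n2 by (simp add: \<beta>_def \<zeta>_def n2_def Re_divide power2_eq_square field_simps)
  then have \<beta>pos: "Re \<beta> > 0" using y n2 by simp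
  have \<kappa>: "a\<^sup>2 / (4 * Re \<beta>) = n2" using y n2 by (simp add: Re\<beta> a2)
  have \<zeta>l: "\<zeta> * (l\<^sub>0\<^sup>2 - z\<^sub>0) = of_real \<rho>"
    using y by (simp add: \<zeta>_def z0 l0 \<rho>_def n2_def complex_eq_iff power2_eq_square field_simps)
  have Re\<zeta>z: "Re (\<zeta> * z\<^sub>0) + n2 = - \<rho>"
    using y by (simp add: \<zeta>_def z0 l0 \<rho>_def n2_def power2_eq_square field_simps)
  have \<rho>: "\<rho> = cmod \<zeta> * cmod (l\<^sub>0\<^sup>2 - z\<^sub>0)"
    using \<zeta>l r n2 by (metis \<rho>_def abs_of_nonneg less_imp_le mult_nonneg_nonneg norm_mult norm_of_real)
  let ?B = "\<zeta> * A"
  define h where "h k s = exp (of_real (s\<^sup>2) * (\<zeta> * z\<^sub>0)) * T (j + int k) (heat \<beta> s f)" for k s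
  have hs: "heat \<beta> s f \<in> exp_schwartz a" for s by (rule heat_in_exp_schwartz[OF f a0 \<beta>pos])
  have recD: "T k (laplacian \<psi>) = z\<^sub>0 * T k \<psi> + A * T (k + 1) \<psi>" if "\<psi> \<in> exp_schwartz a" for k \<psi>
    using rec that unfolding laplacian_recurrence_def distr_eq_def laplacian_distr_def
    by (metis diff_eq_eq add.commute)
  have der: "(h k has_vector_derivative - (2 * of_real s * ?B) * h (k + 1) s) (at s)" for k s
  proof -
    have "((\<lambda>z. exp (z\<^sup>2 * (\<zeta> * z\<^sub>0))) has_field_derivative exp ((of_real s)\<^sup>2 * (\<zeta> * z\<^sub>0)) * (2 * of_real s * (\<zeta> * z\<^sub>0))) (at (of_real s))"
      by (auto intro!: derivative_eq_intros)
    from has_vector_derivative_mult[OF has_vector_derivative_real_field[OF this] distr_heat_derivative[OF T[of "j + int k"] f a0 \<beta>pos]]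
    have d: "(h k has_vector_derivative
        exp ((of_real s)\<^sup>2 * (\<zeta> * z\<^sub>0)) * (- (of_real s / (2 * \<beta>)) * T (j + int k) (heat \<beta> s (laplacian f)))
        + (exp ((of_real s)\<^sup>2 * (\<zeta> * z\<^sub>0)) * (2 * of_real s * (\<zeta> * z\<^sub>0))) * T (j + int k) (heat \<beta> s f)) (at s)"
      by (simp add: h_def[abs_def])
    have c: "of_real s / (2 * \<beta>) = 2 * of_real s * \<zeta>" by (simp add: \<beta>_def)
    have t: "T (j + int k) (heat \<beta> s (laplacian f)) = z\<^sub>0 * T (j + int k) (heat \<beta> s f) + A * T (j + int (k + 1)) (heat \<beta> s f)"
      using recD[OF hs[of s], of "j + int k"] by (simp add: laplacian_heat[OF f a0 \<beta>pos] add_ac)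
    show ?thesis
      by (rule has_vector_derivative_eq_rhs[OF d]) (simp only: c t, simp add: h_def algebra_simps)
  qed
  obtain \<gamma> M where \<gamma>: "continuous_seminorm a \<gamma>" "M > 0" "\<And>f k. f \<in> exp_schwartz a \<Longrightarrow> cmod (T k f) \<le> M * \<gamma> f"
    using bdd unfolding uniformly_bounded_distr_def by blast
  obtain F C where F: "finite F" "C \<ge> 0" "\<And>f. f \<in> exp_schwartz a \<Longrightarrow> \<gamma> f \<le> C * (\<Sum>(m, \<alpha>)\<in>F. exp_seminorm a m \<alpha> f)"
    using continuous_seminorm_bound[OF \<gamma>(1)] by blast
  obtain C' N where C': "C' \<ge> 0" "\<And>s. (\<Sum>(m, \<alpha>)\<in>F. exp_seminorm a m \<alpha> (heat \<beta> s f)) \<le> C' * (1 + \<bar>s\<bar>) ^ N * exp (n2 * s\<^sup>2)"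
    using heat_seminorm_sum_growth[OF a0 \<beta>pos f F(1)] unfolding \<kappa> by blast
  have bnd: "cmod (h k s) \<le> (M * C * C') * (1 + \<bar>s\<bar>) ^ N * exp (- \<rho> * s\<^sup>2)" for k s
  proof -
    have "cmod (T (j + int k) (heat \<beta> s f)) \<le> M * (C * (C' * (1 + \<bar>s\<bar>) ^ N * exp (n2 * s\<^sup>2)))"
      using \<gamma>(2) F(2)
      by (intro order_trans[OF \<gamma>(3)[OF hs]] mult_left_mono order_trans[OF F(3)[OF hs]] C') auto
    then have "cmod (h k s) \<le> exp (s\<^sup>2 * Re (\<zeta> * z\<^sub>0)) * (M * (C * (C' * (1 + \<bar>s\<bar>) ^ N * exp (n2 * s\<^sup>2))))"
      unfolding h_def norm_mult norm_exp_eq_Re by (intro mult_mono) auto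
    also have "\<dots> = (M * C * C') * (1 + \<bar>s\<bar>) ^ N * (exp (s\<^sup>2 * Re (\<zeta> * z\<^sub>0)) * exp (n2 * s\<^sup>2))" by simp
    also have "exp (s\<^sup>2 * Re (\<zeta> * z\<^sub>0)) * exp (n2 * s\<^sup>2) = exp (s\<^sup>2 * (Re (\<zeta> * z\<^sub>0) + n2))"
      by (simp add: exp_add[symmetric] algebra_simps)
    also have "\<dots> = exp (- \<rho> * s\<^sup>2)" by (simp only: Re\<zeta>z mult.commute)
    finally show ?thesis .
  qed
  have h0: "h k 0 = T (j + int k) f" for k by (simp add: h_def heat_0[OF \<beta>pos])
  show "T j f = 0" if "cmod A < cmod (l\<^sub>0\<^sup>2 - z\<^sub>0)"
  proof -
    have "cmod ?B < \<rho>" unfolding \<rho> norm_mult using that \<zeta>0 by (intro mult_strict_left_mono) auto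
    then have "h 0 0 = 0"
      using evolution_decay(1)[where h = h and B = ?B, OF der bnd] by (metis le_less_trans norm_ge_zero)
    then show ?thesis by (simp add: h0)
  qed
  show "T j (laplacian f) = l\<^sub>0\<^sup>2 * T j f" if "cmod A = cmod (l\<^sub>0\<^sup>2 - z\<^sub>0)"
  proof -
    have B: "cmod ?B = \<rho>" unfolding \<rho> norm_mult that ..
    moreover have "\<rho> > 0" unfolding \<rho> that[symmetric] using \<zeta>0 A by simp
    ultimately have "?B * h 1 0 = \<rho> * h 0 0" using evolution_decay(2)[where h = h and B = ?B, OF der bnd] by blast
    then have "\<zeta> * (A * T (j + 1) f) = \<zeta> * ((l\<^sub>0\<^sup>2 - z\<^sub>0) * T j f)"
      unfolding mult.assoc[symmetric] \<zeta>l by (simp add: h0)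
    then have "A * T (j + 1) f = (l\<^sub>0\<^sup>2 - z\<^sub>0) * T j f" using \<zeta>0 by simp
    then show ?thesis using recD[OF f, of j] by (simp add: algebra_simps)
  qed
qed

section \<open>Plane waves and the failure of uniqueness\<close>

definition plane_wave :: "'d::finite \<Rightarrow> complex \<Rightarrow> real^'d \<Rightarrow> complex" where
  "plane_wave i l x = exp (\<i> * l * of_real (x $ i))"

lemma norm_plane_wave: "cmod (plane_wave i l x) = exp (- Im l * x $ i)"
  by (simp add: plane_wave_def norm_exp_eq_Re)

lemma norm_plane_wave_le:
  assumes "\<bar>Im l\<bar> \<le> a" shows "cmod (plane_wave i l x) \<le> exp (a * norm x)"
proof -
  have "- Im l * x $ i \<le> \<bar>Im l\<bar> * \<bar>x $ i\<bar>" by (metis abs_ge_self abs_minus_cancel abs_mult)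
  also have "\<dots> \<le> a * norm x" using assms by (intro mult_mono component_le_norm_cart) auto
  finally show ?thesis by (simp add: norm_plane_wave)
qed

lemma continuous_on_plane_wave [continuous_intros]: "continuous_on S (plane_wave i l)"
  unfolding plane_wave_def[abs_def] by (intro continuous_intros)

lemma axis_coordinate_derivative:
  "((\<lambda>t. complex_of_real ((x + t *\<^sub>R axis k 1) $ i)) has_vector_derivative (if k = i then 1 else 0)) (at 0)"
proof -
  have "((\<lambda>t. x $ i + t * (if k = i then 1 else 0)) has_real_derivative (if k = i then 1 else 0)) (at 0)"
    by (auto intro!: derivative_eq_intros)
  from has_vector_derivative_of_real[OF this] show ?thesis by (simp add: axis_def if_distrib cong: if_cong)
qed

lemma plane_wave_axis_derivative:
  "((\<lambda>t. plane_wave i l (x + t *\<^sub>R axis k 1)) has_vector_derivative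
    (if k = i then \<i> * l else 0) * plane_wave i l x) (at 0)"
proof -
  have "((\<lambda>t. \<i> * l * complex_of_real ((x + t *\<^sub>R axis k 1) $ i)) has_vector_derivative \<i> * l * (if k = i then 1 else 0)) (at 0)"
    by (intro has_vector_derivative_mult_right axis_coordinate_derivative)
  from field_vector_diff_chain_at[OF this DERIV_exp, unfolded o_def]
  show ?thesis
    unfolding plane_wave_def by (rule has_vector_derivative_eq_rhs) simp
qed

definition wave_pairing :: "'d::finite \<Rightarrow> complex \<Rightarrow> 'd functional" where
  "wave_pairing i l f = (\<integral>x. plane_wave i l x * f x \<partial>lborel)"

abbreviation decay_seminorm :: "real \<Rightarrow> (real^'d::finite \<Rightarrow> complex) \<Rightarrow> real" where
  "decay_seminorm a \<equiv> exp_seminorm a (CARD('d) + 2) (\<lambda>_. 0)"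

lemma multi_deriv_0:
  fixes f :: "real^'d::finite \<Rightarrow> complex"
  shows "multi_deriv (\<lambda>_. 0) f = f"
proof -
  have "concat (map (\<lambda>i. []) xs) = ([] :: 'd list)" for xs :: "'d list" by (induction xs) auto
  then show ?thesis by (simp only: multi_deriv_eq_iter_partial replicate_0 iter_partial_Nil)
qed

lemma wave_integrand_bound:
  fixes f :: "real^'d::finite \<Rightarrow> complex"
  assumes "\<bar>Im l\<bar> \<le> a" "f \<in> exp_schwartz a"
  shows "cmod (plane_wave i l x * f x) \<le> decay_seminorm a f / (1 + norm x) ^ (CARD('d) + 2)"
proof -
  have pos: "(1 + norm x) ^ (CARD('d) + 2) > 0" by (intro zero_less_power) (simp add: add_pos_nonneg)
  have "cmod (plane_wave i l x * f x) * (1 + norm x) ^ (CARD('d) + 2)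
      \<le> exp (a * norm x) * cmod (f x) * (1 + norm x) ^ (CARD('d) + 2)"
    unfolding norm_mult using norm_plane_wave_le[OF assms(1)] pos by (intro mult_right_mono) auto
  also have "\<dots> = weighted_deriv a (CARD('d) + 2) (\<lambda>_. 0) f x"
    by (simp only: weighted_deriv_def multi_deriv_0 mult_ac)
  also have "\<dots> \<le> decay_seminorm a f" by (rule weighted_deriv_le_exp_seminorm[OF assms(2)])
  finally show ?thesis using pos by (simp only: pos_le_divide_eq)
qed

lemma wave_integrand:
  assumes "\<bar>Im l\<bar> \<le> a" "f \<in> exp_schwartz a"
  shows "continuous_on UNIV (\<lambda>x. plane_wave i l x * f x)"
    and "integrable lborel (\<lambda>x. plane_wave i l x * f x)"
proof -
  show c: "continuous_on UNIV (\<lambda>x. plane_wave i l x * f x)"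
    by (intro continuous_intros exp_schwartz_continuous[OF assms(2)])
  show "integrable lborel (\<lambda>x. plane_wave i l x * f x)"
    by (rule integrable_dominated[OF c wave_integrand_bound[OF assms]])
qed

lemma wave_pairing_add:
  "\<bar>Im l\<bar> \<le> a \<Longrightarrow> f \<in> exp_schwartz a \<Longrightarrow> g \<in> exp_schwartz a \<Longrightarrow>
    wave_pairing i l (\<lambda>x. f x + g x) = wave_pairing i l f + wave_pairing i l g"
  using wave_integrand(2)[of l a f i] wave_integrand(2)[of l a g i]
  by (simp add: wave_pairing_def distrib_left)

lemma wave_pairing_cmult: "wave_pairing i l (\<lambda>x. c * f x) = c * wave_pairing i l f"
  by (simp add: wave_pairing_def mult.left_commute)

lemma wave_pairing_bound:
  fixes f :: "real^'d::finite \<Rightarrow> complex"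
  assumes "\<bar>Im l\<bar> \<le> a" "f \<in> exp_schwartz a"
  shows "cmod (wave_pairing i l f) \<le> (\<integral>x. 1 / (1 + norm (x::real^'d)) ^ (CARD('d) + 2) \<partial>lborel) * decay_seminorm a f"
proof -
  have "cmod (wave_pairing i l f) \<le> (\<integral>x. cmod (plane_wave i l x * f x) \<partial>lborel)"
    unfolding wave_pairing_def by (rule integral_norm_bound)
  also have "\<dots> \<le> (\<integral>x. decay_seminorm a f * (1 / (1 + norm (x::real^'d)) ^ (CARD('d) + 2)) \<partial>lborel)"
    using wave_integrand_bound[OF assms, of i]
    by (intro integral_mono integrable_norm integrable_mult_right integrable_inverse_power_norm wave_integrand(2)[OF assms]) auto
  finally show ?thesis by (simp only: integral_mult_right_zero mult.commute)
qed

lemma wave_pairing_partial_deriv: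
  assumes l: "\<bar>Im l\<bar> \<le> a" and f: "f \<in> exp_schwartz a"
  shows "wave_pairing i l (partial_deriv k f) = - (if k = i then \<i> * l else 0) * wave_pairing i l f"
proof -
  let ?c = "if k = i then \<i> * l else 0"
  note f' = exp_schwartz_partial_deriv[OF f, of k]
  note w = wave_integrand[OF l f, of i] and w' = wave_integrand[OF l f', of i]
  let ?F' = "\<lambda>x. plane_wave i l x * partial_deriv k f x + ?c * (plane_wave i l x * f x)"
  let ?D = "decay_seminorm a f" and ?D' = "decay_seminorm a (partial_deriv k f)"
  have D: "?D \<ge> 0" "?D' \<ge> 0" by (intro exp_seminorm_nonneg f f')+
  have "(\<integral>x. ?F' x \<partial>lborel) = 0"
  proof (rule integral_axis_derivative_eq_0)
    show "((\<lambda>t. plane_wave i l (x + t *\<^sub>R axis k 1) * f (x + t *\<^sub>R axis k 1)) has_vector_derivative ?F' x) (at 0)" for x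
      by (rule has_vector_derivative_eq_rhs[OF has_vector_derivative_mult[OF plane_wave_axis_derivative exp_schwartz_axis_derivative[OF f]]])
        simp
    show "continuous_on UNIV ?F'" by (intro continuous_intros w w')
    fix x :: "real^'a"
    let ?q = "(1 + norm x) ^ (CARD('a) + 2)"
    have q: "?q > 0" by (intro zero_less_power) (simp add: add_pos_nonneg)
    note b = wave_integrand_bound[OF l f, of i x] and b' = wave_integrand_bound[OF l f', of i x]
    have "0 \<le> cmod ?c * ?D" using D by (intro mult_nonneg_nonneg) auto
    then show "norm (plane_wave i l x * f x) \<le> (?D + ?D' + cmod ?c * ?D) / ?q"
      by (intro order_trans[OF b divide_right_mono]) (use D q in linarith)+
    have "norm (?F' x) \<le> cmod (plane_wave i l x * partial_deriv k f x) + cmod ?c * cmod (plane_wave i l x * f x)"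
      by (rule order_trans[OF norm_triangle_ineq]) (simp only: norm_mult order_refl)
    also have "\<dots> \<le> ?D' / ?q + cmod ?c * (?D / ?q)"
      by (intro add_mono mult_left_mono b b') simp
    also have "\<dots> = (?D' + cmod ?c * ?D) / ?q" by (simp only: add_divide_distrib times_divide_eq_right)
    also have "\<dots> \<le> (?D + ?D' + cmod ?c * ?D) / ?q" by (intro divide_right_mono) (use D q in linarith)+
    finally show "norm (?F' x) \<le> (?D + ?D' + cmod ?c * ?D) / ?q" .
  qed (rule w)
  moreover have "(\<integral>x. ?F' x \<partial>lborel) = wave_pairing i l (partial_deriv k f) + ?c * wave_pairing i l f"
    using w w' by (simp add: wave_pairing_def)
  ultimately show ?thesis by (simp add: add_eq_0_iff)
qed

lemma wave_pairing_laplacian: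
  assumes l: "\<bar>Im l\<bar> \<le> a" and f: "f \<in> exp_schwartz a"
  shows "wave_pairing i l (laplacian f) = l\<^sup>2 * wave_pairing i l f"
proof -
  have 2: "partial_deriv k (partial_deriv k f) \<in> exp_schwartz a" for k
    by (intro exp_schwartz_partial_deriv f)
  have "wave_pairing i l (laplacian f) = - (\<Sum>k\<in>UNIV. wave_pairing i l (partial_deriv k (partial_deriv k f)))"
    unfolding wave_pairing_def laplacian_def using wave_integrand(2)[OF l 2]
    by (simp add: sum_distrib_left)
  also have "\<dots> = - (\<Sum>k\<in>UNIV. (if k = i then (\<i> * l)\<^sup>2 * wave_pairing i l f else 0))"
    by (intro arg_cong[where f = uminus] sum.cong refl)
      (simp add: wave_pairing_partial_deriv[OF l] exp_schwartz_partial_deriv f power2_eq_square)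
  also have "\<dots> = l\<^sup>2 * wave_pairing i l f" by (simp add: power_mult_distrib)
  finally show ?thesis .
qed

inductive poly_fun :: "(real^'d::finite \<Rightarrow> complex) \<Rightarrow> bool" where
  const: "poly_fun (\<lambda>x. c)"
| coord: "poly_fun (\<lambda>x. of_real (x $ j))"
| add: "poly_fun p \<Longrightarrow> poly_fun q \<Longrightarrow> poly_fun (\<lambda>x. p x + q x)"
| mult: "poly_fun p \<Longrightarrow> poly_fun q \<Longrightarrow> poly_fun (\<lambda>x. p x * q x)"

lemma poly_fun_continuous: "poly_fun p \<Longrightarrow> continuous_on UNIV p"
  by (induction rule: poly_fun.induct) (intro continuous_intros; simp)+

lemma poly_fun_growth:
  "poly_fun p \<Longrightarrow> \<exists>C\<ge>0. \<exists>n. \<forall>x. cmod (p x) \<le> C * (1 + norm x) ^ n"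
proof (induction rule: poly_fun.induct)
  case (const c)
  show ?case by (intro exI[of _ "cmod c"] exI[of _ 0] conjI) auto
next
  case (coord j)
  have "cmod (of_real (x $ j)) \<le> 1 * (1 + norm x) ^ 1" for x :: "real^'a"
    using component_le_norm_cart[of x j] by simp
  then show ?case by (intro exI[of _ 1] exI[of _ "1::nat"] conjI) auto
next
  case (add p q)
  then obtain C n D m where C: "C \<ge> 0" "\<And>x. cmod (p x) \<le> C * (1 + norm x) ^ n"
    and D: "D \<ge> 0" "\<And>x. cmod (q x) \<le> D * (1 + norm x) ^ m" by metis
  have "cmod (p x + q x) \<le> (C + D) * (1 + norm x) ^ (n + m)" for x
  proof -
    have "cmod (p x + q x) \<le> C * (1 + norm x) ^ n + D * (1 + norm x) ^ m"
      by (intro order_trans[OF norm_triangle_ineq] add_mono C D)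
    also have "\<dots> \<le> C * (1 + norm x) ^ (n + m) + D * (1 + norm x) ^ (n + m)"
      using C(1) D(1) by (intro add_mono mult_left_mono power_increasing) auto
    finally show ?thesis by (simp add: distrib_right)
  qed
  with C(1) D(1) show ?case by (intro exI[of _ "C + D"]) auto
next
  case (mult p q)
  then obtain C n D m where C: "C \<ge> 0" "\<And>x. cmod (p x) \<le> C * (1 + norm x) ^ n"
    and D: "D \<ge> 0" "\<And>x. cmod (q x) \<le> D * (1 + norm x) ^ m" by metis
  have "cmod (p x * q x) \<le> (C * D) * (1 + norm x) ^ (n + m)" for x
  proof -
    have "cmod (p x * q x) \<le> (C * (1 + norm x) ^ n) * (D * (1 + norm x) ^ m)"
      unfolding norm_mult using C(1) by (intro mult_mono C D) auto
    also have "\<dots> = (C * D) * (1 + norm x) ^ (n + m)" by (simp add: power_add)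
    finally show ?thesis .
  qed
  with C(1) D(1) show ?case by (intro exI[of _ "C * D"]) auto
qed

lemma poly_fun_axis_derivative:
  "poly_fun p \<Longrightarrow> \<exists>p'. poly_fun p' \<and> (\<forall>x. ((\<lambda>t. p (x + t *\<^sub>R axis k 1)) has_vector_derivative p' x) (at 0))"
proof (induction rule: poly_fun.induct)
  case (const c)
  show ?case by (intro exI[of _ "\<lambda>x. 0"]) (auto intro: poly_fun.const)
next
  case (coord j)
  show ?case using axis_coordinate_derivative[of _ k j]
    by (intro exI[of _ "\<lambda>x. if k = j then 1 else 0"]) (blast intro: poly_fun.const)
next
  case (add p q)
  then obtain p' q' where "poly_fun p'" "poly_fun q'"
    "\<And>x. ((\<lambda>t. p (x + t *\<^sub>R axis k 1)) has_vector_derivative p' x) (at 0)"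
    "\<And>x. ((\<lambda>t. q (x + t *\<^sub>R axis k 1)) has_vector_derivative q' x) (at 0)" by blast
  then show ?case
    by (intro exI[of _ "\<lambda>x. p' x + q' x"]) (auto intro: poly_fun.add has_vector_derivative_add)
next
  case (mult p q)
  then obtain p' q' where d: "poly_fun p'" "poly_fun q'"
    "\<And>x. ((\<lambda>t. p (x + t *\<^sub>R axis k 1)) has_vector_derivative p' x) (at 0)"
    "\<And>x. ((\<lambda>t. q (x + t *\<^sub>R axis k 1)) has_vector_derivative q' x) (at 0)" by blast
  have "((\<lambda>t. p (x + t *\<^sub>R axis k 1) * q (x + t *\<^sub>R axis k 1)) has_vector_derivative p x * q' x + p' x * q x) (at 0)" for x
    using has_vector_derivative_mult[OF d(3,4), of x x] by simp
  moreover have "poly_fun (\<lambda>x. p x * q' x + p' x * q x)"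
    using d(1,2) mult.hyps by (intro poly_fun.add poly_fun.mult)
  ultimately show ?case by blast
qed

text \<open>The derivatives are polynomials times the function itself, and the Gaussian dominates every
exponential and every power.\<close>

lemma gauss_plane_wave_in_exp_schwartz:
  assumes "a \<ge> 0"
  shows "(\<lambda>x::real^'d::finite. gauss 1 x * plane_wave i l x) \<in> exp_schwartz a"
proof -
  let ?e = "\<lambda>x::real^'d. gauss 1 x * plane_wave i l x"
  let ?S = "{\<lambda>x. p x * ?e x | p. poly_fun p}"
  have e': "((\<lambda>t. ?e (x + t *\<^sub>R axis k 1)) has_vector_derivative
      (- 2 * of_real (x $ k) + (if k = i then \<i> * l else 0)) * ?e x) (at 0)" for x k
    by (rule has_vector_derivative_eq_rhs[OF has_vector_derivative_mult[OF gauss_axis_derivative plane_wave_axis_derivative]])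
      (simp add: algebra_simps)
  have mem: "?e \<in> ?S" using poly_fun.const[of 1] by (intro CollectI exI[of _ "\<lambda>x. 1"]) simp
  have der: "\<exists>g'\<in>?S. \<forall>x. ((\<lambda>t. g (x + t *\<^sub>R axis k 1)) has_vector_derivative g' x) (at 0)"
    if "g \<in> ?S" for g k
  proof -
    from that obtain p where p: "poly_fun p" "g = (\<lambda>x. p x * ?e x)" by blast
    from poly_fun_axis_derivative[OF p(1), of k] obtain p' where
      p': "poly_fun p'" "\<And>x. ((\<lambda>t. p (x + t *\<^sub>R axis k 1)) has_vector_derivative p' x) (at 0)" by blast
    let ?q = "\<lambda>x. p x * ((- 2) * of_real (x $ k) + (if k = i then \<i> * l else 0)) + p' x"
    have "poly_fun ?q" by (intro poly_fun.intros p p')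
    moreover have "((\<lambda>t. g (x + t *\<^sub>R axis k 1)) has_vector_derivative ?q x * ?e x) (at 0)" for x
      unfolding p(2)
      by (rule has_vector_derivative_eq_rhs[OF has_vector_derivative_mult[OF p'(2) e']]) (simp add: algebra_simps)
    ultimately show ?thesis
      by (intro bexI[of _ "\<lambda>x. ?q x * ?e x"] allI CollectI exI[of _ ?q] conjI refl)
  qed
  have cont: "continuous_on UNIV g" if "g \<in> ?S" for g
  proof -
    from that obtain p where p: "poly_fun p" "g = (\<lambda>x. p x * ?e x)" by blast
    show ?thesis unfolding p(2) by (intro continuous_intros poly_fun_continuous[OF p(1)])
  qed
  have "\<exists>C. \<forall>x. exp (a * norm x) * (1 + norm x) ^ m * cmod (iter_partial js ?e x) \<le> C" for m js
  proof -
    have "iter_partial js ?e \<in> ?S" by (rule iter_partial_closed[OF mem der])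
    then obtain p where p: "poly_fun p" "iter_partial js ?e = (\<lambda>x. p x * ?e x)" by blast
    obtain C n where C: "C \<ge> 0" "\<And>x. cmod (p x) \<le> C * (1 + norm x) ^ n"
      using poly_fun_growth[OF p(1)] by blast
    obtain K where K: "\<And>s r. r \<ge> 0 \<Longrightarrow> exp (- 1 * r\<^sup>2) * exp ((a + \<bar>Im l\<bar>) * (\<bar>s\<bar> * r)) * (1 + r) ^ (m + n)
        \<le> K * (1 + \<bar>s\<bar>) ^ (m + n) * exp ((a + \<bar>Im l\<bar>)\<^sup>2 / (4 * 1) * s\<^sup>2)"
      using gaussian_weight_bound[of "a + \<bar>Im l\<bar>" 1 "m + n"] assms by force
    let ?K = "K * (1 + \<bar>1::real\<bar>) ^ (m + n) * exp ((a + \<bar>Im l\<bar>)\<^sup>2 / (4 * 1) * 1\<^sup>2)"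
    have "exp (a * norm x) * (1 + norm x) ^ m * cmod (iter_partial js ?e x) \<le> C * ?K" for x
    proof -
      have "exp (a * norm x) * (1 + norm x) ^ m * cmod (iter_partial js ?e x)
          = exp (a * norm x) * (1 + norm x) ^ m * (cmod (p x) * (exp (- 1 * (norm x)\<^sup>2) * cmod (plane_wave i l x)))"
        by (simp add: p(2) norm_mult norm_gauss)
      also have "\<dots> \<le> exp (a * norm x) * (1 + norm x) ^ m * ((C * (1 + norm x) ^ n) * (exp (- 1 * (norm x)\<^sup>2) * exp (\<bar>Im l\<bar> * norm x)))"
        using C(1) norm_plane_wave_le[OF order_refl, of i l x] by (intro mult_left_mono mult_mono C) auto
      also have "\<dots> = C * (exp (- 1 * (norm x)\<^sup>2) * exp ((a + \<bar>Im l\<bar>) * (\<bar>1\<bar> * norm x)) * (1 + norm x) ^ (m + n))"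
      proof -
        have "exp ((a + \<bar>Im l\<bar>) * (\<bar>1\<bar> * norm x)) = exp (a * norm x) * exp (\<bar>Im l\<bar> * norm x)"
          by (simp add: distrib_right exp_add)
        then show ?thesis by (simp only: power_add mult_ac)
      qed
      also have "\<dots> \<le> C * ?K" by (intro mult_left_mono K C) simp
      finally show ?thesis .
    qed
    then show ?thesis by blast
  qed
  then show ?thesis
    unfolding exp_schwartz_iff using C_infty_coinduct[OF mem cont der] by blast
qed

text \<open>Pairing with the conjugate wave, damped by a Gaussian, gives the integral of a positive function.\<close>

lemma wave_pairing_nonzero:
  fixes i :: "'d::finite"
  assumes "\<bar>Im l\<bar> \<le> a"
  shows "\<exists>f\<in>exp_schwartz a. wave_pairing i l f \<noteq> 0"
proof
  let ?f = "\<lambda>x::real^'d. gauss 1 x * plane_wave i (- cnj l) x"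
  have "a \<ge> 0" using assms by linarith
  then show f: "?f \<in> exp_schwartz a" by (rule gauss_plane_wave_in_exp_schwartz)
  let ?g = "\<lambda>x::real^'d. exp (- (2 * Im l * x $ i) - (norm x)\<^sup>2)"
  have eq: "plane_wave i l x * ?f x = of_real (?g x)" for x
  proof -
    have "plane_wave i l x * ?f x = exp (\<i> * l * of_real (x $ i) + - (1 * of_real ((norm x)\<^sup>2)) + \<i> * (- cnj l) * of_real (x $ i))"
      unfolding plane_wave_def gauss_def exp_add by (simp only: mult_ac)
    also have "\<i> * l * of_real (x $ i) + - (1 * of_real ((norm x)\<^sup>2)) + \<i> * (- cnj l) * of_real (x $ i)
        = of_real (- (2 * Im l * x $ i) - (norm x)\<^sup>2)"
      by (simp add: complex_eq_iff)
    finally show ?thesis by (simp only: exp_of_real)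
  qed
  have "integrable lborel ?g"
    using wave_integrand(2)[OF assms f, of i] unfolding eq by (simp only: complex_of_real_integrable_eq)
  from integral_pos[OF this] have "(\<integral>x. ?g x \<partial>lborel) > 0" by simp
  then show "wave_pairing i l ?f \<noteq> 0"
    unfolding wave_pairing_def eq by simp
qed

lemma bounded_imp_exp_tempered_distr:
  assumes add: "\<And>f g. f \<in> exp_schwartz a \<Longrightarrow> g \<in> exp_schwartz a \<Longrightarrow> T (\<lambda>x. f x + g x) = T f + T g"
    and cmult: "\<And>c f. f \<in> exp_schwartz a \<Longrightarrow> T (\<lambda>x. c * f x) = c * T f"
    and bnd: "\<And>f. f \<in> exp_schwartz a \<Longrightarrow> cmod (T f) \<le> C * exp_seminorm a m \<alpha> f"
  shows "T \<in> exp_tempered_distr a"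
proof -
  have "dist (T g) (T f) \<le> C * exp_seminorm a m \<alpha> (\<lambda>x. g x - f x)"
    if "f \<in> exp_schwartz a" "g \<in> exp_schwartz a" for f g
    using bnd[OF exp_schwartz_diff[OF that(2,1)]] add[OF that(2) exp_schwartz_cmult[OF that(1), of "- 1"]]
      cmult[OF that(1), of "- 1"] by (simp add: dist_norm)
  then have "continuous_map (exp_schwartz_topology a) euclidean T"
    by (rule continuous_map_exp_schwartz_lipschitz)
  then show ?thesis using add cmult by (simp add: exp_tempered_distr_def)
qed

lemma continuous_seminorm_exp_seminorm: "continuous_seminorm a (exp_seminorm a m \<alpha>)"
  unfolding continuous_seminorm_def
proof (intro conjI ballI allI)
  have "exp_seminorm a m \<alpha> g \<le> exp_seminorm a m \<alpha> (\<lambda>x. g x - f x) + exp_seminorm a m \<alpha> f"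
    if "f \<in> exp_schwartz a" "g \<in> exp_schwartz a" for f g
    using exp_seminorm_add[OF exp_schwartz_diff[OF that(2,1)] that(1), of m \<alpha>] by simp
  moreover have "exp_seminorm a m \<alpha> (\<lambda>x. f x - g x) = exp_seminorm a m \<alpha> (\<lambda>x. g x - f x)"
    if "f \<in> exp_schwartz a" "g \<in> exp_schwartz a" for f g
    using exp_seminorm_cmult[OF exp_schwartz_diff[OF that], of m \<alpha> "- 1"] by simp
  ultimately have "dist (exp_seminorm a m \<alpha> g) (exp_seminorm a m \<alpha> f) \<le> 1 * exp_seminorm a m \<alpha> (\<lambda>x. g x - f x)"
    if "f \<in> exp_schwartz a" "g \<in> exp_schwartz a" for f g
    using that by (fastforce simp: dist_real_def abs_le_iff algebra_simps)
  then show "continuous_map (exp_schwartz_topology a) euclideanreal (exp_seminorm a m \<alpha>)"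
    by (rule continuous_map_exp_schwartz_lipschitz)
qed (simp_all add: exp_seminorm_add exp_seminorm_cmult)

text \<open>On the branch \<open>s \<mapsto> (s + \<i> Im l\<^sub>0)\<^sup>2\<close> the distance to \<open>z\<^sub>0\<close> is less than \<open>\<bar>A\<bar>\<close> at \<open>s = Re l\<^sub>0\<close> and
tends to infinity on both sides.\<close>

lemma parabola_meets_circle:
  fixes l\<^sub>0 z\<^sub>0 A :: complex
  assumes "cmod (l\<^sub>0\<^sup>2 - z\<^sub>0) < cmod A" "Im l\<^sub>0 \<noteq> 0"
  shows "\<exists>l1 l2. Im l1 = Im l\<^sub>0 \<and> Im l2 = Im l\<^sub>0 \<and> l1\<^sup>2 \<noteq> l2\<^sup>2 \<and>
    cmod (l1\<^sup>2 - z\<^sub>0) = cmod A \<and> cmod (l2\<^sup>2 - z\<^sub>0) = cmod A"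
proof -
  let ?l = "\<lambda>s. Complex s (Im l\<^sub>0)"
  let ?g = "\<lambda>s. cmod ((?l s)\<^sup>2 - z\<^sub>0)"
  define L where "L = cmod z\<^sub>0 + cmod A + 1"
  define R where "R = \<bar>Re l\<^sub>0\<bar> + L"
  have L: "L \<ge> 1" by (simp add: L_def)
  have cont: "continuous_on S ?g" for S
    by (intro continuous_intros)
  have far: "?g s \<ge> cmod A" if "\<bar>s\<bar> \<ge> L" for s
  proof -
    have "L \<le> L\<^sup>2" using mult_left_mono[of 1 L L] L by (simp add: power2_eq_square)
    also have "\<dots> \<le> s\<^sup>2" using power_mono[of L "\<bar>s\<bar>" 2] that L by simp
    also have "\<dots> \<le> cmod ((?l s)\<^sup>2)" by (simp add: norm_power cmod_power2)
    finally have "L - cmod z\<^sub>0 \<le> ?g s" using norm_triangle_ineq2[of "(?l s)\<^sup>2" z\<^sub>0] by linarith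
    then show ?thesis by (simp add: L_def)
  qed
  have ends: "\<bar>Re l\<^sub>0 - R\<bar> \<ge> L" "\<bar>Re l\<^sub>0 + R\<bar> \<ge> L" "Re l\<^sub>0 - R \<le> Re l\<^sub>0" "Re l\<^sub>0 \<le> Re l\<^sub>0 + R"
    using L by (simp_all add: R_def)
  have near: "?g (Re l\<^sub>0) < cmod A" using assms(1) by (simp add: complex_surj)
  obtain s1 where s1: "s1 \<le> Re l\<^sub>0" "?g s1 = cmod A"
    using IVT2'[of ?g "Re l\<^sub>0" "cmod A" "Re l\<^sub>0 - R"] near far[OF ends(1)] cont ends(3)
    by (meson less_imp_le)
  obtain s2 where s2: "Re l\<^sub>0 \<le> s2" "?g s2 = cmod A"
    using IVT'[of ?g "Re l\<^sub>0" "cmod A" "Re l\<^sub>0 + R"] near far[OF ends(2)] cont ends(4)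
    by (meson less_imp_le)
  have "s1 \<noteq> s2" using s1 s2 near by (metis less_irrefl order_antisym)
  then have "?l s1 \<noteq> ?l s2" "?l s1 \<noteq> - ?l s2" using assms(2) by (auto simp: complex_eq_iff)
  then have "(?l s1)\<^sup>2 \<noteq> (?l s2)\<^sup>2" by (simp only: power2_eq_iff) simp
  with s1 s2 show ?thesis by (intro exI[of _ "?l s1"] exI[of _ "?l s2"]) simp
qed

text \<open>A sum of two eigendistributions with different eigenvalues, neither of them zero, is not an
eigendistribution. Both coefficients have modulus \<open>1\<close> for all \<open>k\<close>, because both eigenvalues lie on
the circle of radius \<open>\<bar>A\<bar>\<close> around \<open>z\<^sub>0\<close>.\<close>

lemma recurrence_nonuniqueness:
  fixes l\<^sub>0 z\<^sub>0 A :: complex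
  assumes a: "a = \<bar>Im l\<^sub>0\<bar>" "a \<noteq> 0" and A: "cmod A > cmod (l\<^sub>0\<^sup>2 - z\<^sub>0)"
  shows "\<exists>T :: int \<Rightarrow> ('d::finite) functional.
    (\<forall>k. T k \<in> exp_tempered_distr a) \<and> laplacian_recurrence a z\<^sub>0 A T \<and> uniformly_bounded_distr a T \<and>
    \<not> (\<exists>\<mu>. distr_eq a (laplacian_distr (T 0)) (\<lambda>\<psi>. \<mu> * T 0 \<psi>))"
proof -
  have "Im l\<^sub>0 \<noteq> 0" using a by simp
  with A obtain l1 l2 where "Im l1 = Im l\<^sub>0" "Im l2 = Im l\<^sub>0" and ne: "l1\<^sup>2 \<noteq> l2\<^sup>2"
    and circ: "cmod (l1\<^sup>2 - z\<^sub>0) = cmod A" "cmod (l2\<^sup>2 - z\<^sub>0) = cmod A"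
    using parabola_meets_circle by blast
  then have im: "\<bar>Im l1\<bar> \<le> a" "\<bar>Im l2\<bar> \<le> a" using a by simp_all
  have A0: "A \<noteq> 0" using A by (metis norm_ge_zero norm_zero not_le)
  fix i :: 'd
  let ?q1 = "(l1\<^sup>2 - z\<^sub>0) / A" and ?q2 = "(l2\<^sup>2 - z\<^sub>0) / A"
  have q: "cmod ?q1 = 1" "cmod ?q2 = 1" using circ A0 by (auto simp: norm_divide)
  then have q0: "?q1 \<noteq> 0" "?q2 \<noteq> 0" by (metis norm_zero zero_neq_one)+
  define T :: "int \<Rightarrow> 'd functional" where
    "T k f = ?q1 powi k * wave_pairing i l1 f + ?q2 powi k * wave_pairing i l2 f" for k f
  let ?I = "\<integral>x. 1 / (1 + norm (x::real^'d)) ^ (CARD('d) + 2) \<partial>lborel"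
  have I: "?I \<ge> 0" by (intro Bochner_Integration.integral_nonneg) auto
  have bnd: "cmod (T k f) \<le> (2 * ?I) * decay_seminorm a f" if "f \<in> exp_schwartz a" for k f
  proof -
    have "cmod (T k f) \<le> cmod (?q1 powi k * wave_pairing i l1 f) + cmod (?q2 powi k * wave_pairing i l2 f)"
      unfolding T_def by (rule norm_triangle_ineq)
    also have "\<dots> = cmod (wave_pairing i l1 f) + cmod (wave_pairing i l2 f)"
      by (simp only: norm_mult norm_power_int q power_int_1_left mult_1)
    also have "\<dots> \<le> ?I * decay_seminorm a f + ?I * decay_seminorm a f"
      by (intro add_mono wave_pairing_bound im that)
    finally show ?thesis by (simp only: mult_2 distrib_right)
  qed
  have lap: "T k (laplacian f) = ?q1 powi k * (l1\<^sup>2 * wave_pairing i l1 f) + ?q2 powi k * (l2\<^sup>2 * wave_pairing i l2 f)"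
    if "f \<in> exp_schwartz a" for k f
    by (simp only: T_def wave_pairing_laplacian[OF im(1) that] wave_pairing_laplacian[OF im(2) that])
  have "T k \<in> exp_tempered_distr a" for k
  proof (rule bounded_imp_exp_tempered_distr)
    show "T k (\<lambda>x. f x + g x) = T k f + T k g" if "f \<in> exp_schwartz a" "g \<in> exp_schwartz a" for f g
      by (simp add: T_def wave_pairing_add[OF im(1) that] wave_pairing_add[OF im(2) that] distrib_left)
    show "T k (\<lambda>x. c * f x) = c * T k f" for c f
      by (simp add: T_def wave_pairing_cmult distrib_left)
  qed (rule bnd)
  moreover have "laplacian_recurrence a z\<^sub>0 A T"
    unfolding laplacian_recurrence_def distr_eq_def laplacian_distr_def
  proof (intro allI ballI)
    fix k and \<psi> :: "real^'d \<Rightarrow> complex" assume \<psi>: "\<psi> \<in> exp_schwartz a"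
    have "?q1 powi (k + 1) = ?q1 powi k * ?q1" "?q2 powi (k + 1) = ?q2 powi k * ?q2"
      by (rule power_int_add_1[OF disjI1[OF q0(1)]], rule power_int_add_1[OF disjI1[OF q0(2)]])
    then have q_Suc: "A * ?q1 powi (k + 1) = ?q1 powi k * (l1\<^sup>2 - z\<^sub>0)" "A * ?q2 powi (k + 1) = ?q2 powi k * (l2\<^sup>2 - z\<^sub>0)"
      using A0 by simp_all
    have "A * T (k + 1) \<psi> = A * ?q1 powi (k + 1) * wave_pairing i l1 \<psi> + A * ?q2 powi (k + 1) * wave_pairing i l2 \<psi>"
      by (simp only: T_def distrib_left mult.assoc)
    then show "T k (laplacian \<psi>) - z\<^sub>0 * T k \<psi> = A * T (k + 1) \<psi>"
      by (simp only: q_Suc lap[OF \<psi>]) (simp add: T_def algebra_simps)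
  qed
  moreover have "uniformly_bounded_distr a T"
    unfolding uniformly_bounded_distr_def
  proof (intro exI conjI ballI allI)
    show "continuous_seminorm a (decay_seminorm a :: (real^'d \<Rightarrow> complex) \<Rightarrow> real)"
      by (rule continuous_seminorm_exp_seminorm)
    show "2 * ?I + 1 > 0" by (intro add_nonneg_pos mult_nonneg_nonneg I) auto
    show "cmod (T k f) \<le> (2 * ?I + 1) * decay_seminorm a f" if "f \<in> exp_schwartz a" for f k
      using bnd[OF that, of k] exp_seminorm_nonneg[OF that, of "CARD('d) + 2" "\<lambda>_. 0"] by (simp add: distrib_right)
  qed
  moreover have False if "distr_eq a (laplacian_distr (T 0)) (\<lambda>\<psi>. \<mu> * T 0 \<psi>)" for \<mu>
  proof -
    have e: "(l1\<^sup>2 - \<mu>) * wave_pairing i l1 f + (l2\<^sup>2 - \<mu>) * wave_pairing i l2 f = 0" if "f \<in> exp_schwartz a" for f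
    proof -
      have "T 0 (laplacian f) = \<mu> * T 0 f"
        using \<open>distr_eq a (laplacian_distr (T 0)) (\<lambda>\<psi>. \<mu> * T 0 \<psi>)\<close> that
        by (simp add: distr_eq_def laplacian_distr_def)
      moreover have "T 0 (laplacian f) = l1\<^sup>2 * wave_pairing i l1 f + l2\<^sup>2 * wave_pairing i l2 f"
        by (simp only: lap[OF that] power_int_0_right mult_1_left)
      moreover have "T 0 f = wave_pairing i l1 f + wave_pairing i l2 f" by (simp add: T_def)
      ultimately show ?thesis by (simp add: algebra_simps)
    qed
    have e2: "(l1\<^sup>2 - \<mu>) * (l1\<^sup>2 * wave_pairing i l1 f) + (l2\<^sup>2 - \<mu>) * (l2\<^sup>2 * wave_pairing i l2 f) = 0"
      if "f \<in> exp_schwartz a" for f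
      using e[OF exp_schwartz_laplacian[OF that]]
      by (simp only: wave_pairing_laplacian[OF im(1) that] wave_pairing_laplacian[OF im(2) that])
    (* Eliminating one wave from the eigenvalue equations of f and of its Laplacian isolates the other. *)
    have "(l1\<^sup>2 - \<mu>) * (l1\<^sup>2 - l2\<^sup>2) * wave_pairing i l1 f = 0" "(l2\<^sup>2 - \<mu>) * (l2\<^sup>2 - l1\<^sup>2) * wave_pairing i l2 f = 0"
      if "f \<in> exp_schwartz a" for f
      using e[OF that] e2[OF that] by algebra+
    then have "l1\<^sup>2 = \<mu>" "l2\<^sup>2 = \<mu>"
      using wave_pairing_nonzero[OF im(1), of i] wave_pairing_nonzero[OF im(2), of i] ne by fastforce+
    with ne show False by simp
  qed
  ultimately show ?thesis by blast
qed

section \<open>The three regimes of the modulus of A\<close>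

theorem theorem2p3:
  fixes l\<^sub>0 z\<^sub>0 A :: complex and a :: real
  assumes "a = \<bar>Im l\<^sub>0\<bar>" and "a \<noteq> 0"
    and "z\<^sub>0 \<in> outward_normal l\<^sub>0"
    and "A \<noteq> 0"
  shows
    "(cmod A = cmod (l\<^sub>0\<^sup>2 - z\<^sub>0) \<longrightarrow>
       (\<forall>T :: int \<Rightarrow> ('d::finite) functional.
          (\<forall>k. T k \<in> exp_tempered_distr a) \<and> laplacian_recurrence a z\<^sub>0 A T \<and>
          uniformly_bounded_distr a T \<longrightarrow>
          distr_eq a (laplacian_distr (T 0)) (\<lambda>\<psi>. l\<^sub>0\<^sup>2 * T 0 \<psi>)))
     \<and>
     (cmod A < cmod (l\<^sub>0\<^sup>2 - z\<^sub>0) \<longrightarrow>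
       (\<forall>T :: int \<Rightarrow> 'd functional.
          (\<forall>k. T k \<in> exp_tempered_distr a) \<and> laplacian_recurrence a z\<^sub>0 A T \<and>
          uniformly_bounded_distr a T \<longrightarrow>
          (\<forall>k. distr_eq a (T k) (\<lambda>\<psi>. 0))))
     \<and>
     (cmod A > cmod (l\<^sub>0\<^sup>2 - z\<^sub>0) \<longrightarrow>
       (\<exists>T :: int \<Rightarrow> 'd functional.
          (\<forall>k. T k \<in> exp_tempered_distr a) \<and> laplacian_recurrence a z\<^sub>0 A T \<and>
          uniformly_bounded_distr a T \<and>
          \<not> (\<exists>\<mu>. distr_eq a (laplacian_distr (T 0)) (\<lambda>\<psi>. \<mu> * T 0 \<psi>))))"
  using recurrence_dichotomy[OF assms] recurrence_nonuniqueness[OF assms(1,2)]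
  unfolding distr_eq_def laplacian_distr_def by (intro conjI impI) auto

end
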